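(* For every $c>0$ and every positive integer $d$ there exists $n_0=n_0(c,d)$ with the following property. Let $\varepsilon>0$ and let $f(x,y,z)\in\mathbb{R}[x,y,z]$ be a polynomial of degree $d$ such that, for some $n>n_0$, the graph $w=f(x,y,z)$ contains at least $c\,n^{8/3+2\varepsilon}$ points of $A\times B\times C\times D$, where $A,B,C,D\subset\mathbb{R}$ with $|A|=n$, $|B|=|C|=n^{5/6+\varepsilon}$ and $|D|=n$. Then there exist polynomials $g,k,l,m\in\mathbb{R}[t]$ such that either $$f(x,y,z)=g(k(x)+l(y)+m(z))\quad\text{or}\quad f(x,y,z)=g(k(x)\cdot l(y)\cdot m(z)).$$
   Context: A point $(a,b,c',e)\in A\times B\times C\times D$ lies on the graph $w=f(x,y,z)$ if $e=f(a,b,c')$. *)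

theory Defs
  imports Complex_Main "HOL-Computational_Algebra.Polynomial"
begin

text \<open>A real trivariate polynomial function of total degree exactly d:
  f is given by coefficients a i j k (for i+j+k \<le> d) and some coefficient
  of total degree d is nonzero. Since polynomial functions over the reals
  determine their coefficients, this is exactly "f is a polynomial of degree d".\<close>
definition poly3_of_degree :: "(real \<Rightarrow> real \<Rightarrow> real \<Rightarrow> real) \<Rightarrow> nat \<Rightarrow> bool" where
  "poly3_of_degree f d \<longleftrightarrow>
     (\<exists>a :: nat \<Rightarrow> nat \<Rightarrow> nat \<Rightarrow> real.
        (\<forall>x y z. f x y z =
           (\<Sum>i\<le>d. \<Sum>j\<le>d. \<Sum>k\<le>d. if i + j + k \<le> d then a i j k * x ^ i * y ^ j * z ^ k else 0))
      \<and> (\<exists>i j k. i + j + k = d \<and> a i j k \<noteq> 0))"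

end

theory Submission
  imports Defs "HOL-Library.FuncSet" "HOL-Computational_Algebra.Polynomial_Factorial"
    "HOL-Computational_Algebra.Field_as_Ring"
begin

text \<open>Suppose first that \<open>f\<close> depends on all three variables. Cut \<open>A\<close> and \<open>D\<close> into consecutive blocks.
  For fixed \<open>(b, c)\<close> the polynomial \<open>f(x, b, c)\<close> crosses each boundary of a block of \<open>D\<close> at most \<open>d\<close>
  times, so there are many \<open>(a, a', b, c)\<close> with \<open>a, a'\<close> in a common block and with \<open>f(a, b, c)\<close>,
  \<open>f(a', b, c)\<close> in a common block. The map \<open>(a, a', b, c) \<mapsto> (a, a', f(a, b, c), f(a', b, c))\<close> sends
  them to a smaller set, so it cannot have generically finite fibres; hence its components are
  algebraically dependent and its Jacobian vanishes, that is, \<open>f_y / f_z\<close> does not depend on \<open>x\<close>.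
  By symmetry \<open>f_x : f_y : f_z = p(x) : q(y) : r(z)\<close>.

  If \<open>f\<close> depends on \<open>x\<close> and \<open>y\<close> only, the same argument is applied to
  \<open>(a, a', b, b') \<mapsto> (f(a, b), f(a', b), f(a, b'), f(a', b'))\<close> and gives \<open>f_x : f_y = p(x) : q(y)\<close>.

  Comparing leading terms, \<open>p, q, r\<close> are up to a common factor either derivatives \<open>k', l', m'\<close> or
  logarithmic derivatives of polynomials. In the first case \<open>f_x / k'\<close> is a polynomial of lower degree
  satisfying the same equations, and \<open>f = g(k + l + m)\<close> follows by integration. In the second case
  \<open>f\<close> is a sum of eigenfunctions of \<open>f \<mapsto> f_x / p\<close>, each of which is a product of powers, and all
  these are powers of a single product \<open>k(x) l(y) m(z)\<close>.\<close>

text \<open>The counting must be uniform in \<open>f\<close>, so generic finiteness is made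
  effective: a dimension count gives constants that depend on \<open>d\<close> only, and fibres are
  bounded off the zero set of one polynomial. These zeros have to be counted over near pairs, not
  over a full grid. With about t blocks on each side there are at least a constant times |X|^2 |Y|
  |Z| / t collisions. The zero set takes a share of order t / |X|, which forces t below n^(5/6). In
  the binary case the target has size n^4 / t^2 against |X|^2 |Y|^2 / t collisions, which forces t
  above n^(2/3). The midpoint t = n^(3/4) saves n^(1/12) on both sides. A second map is unavoidable:
  for f_z = 0 the Jacobian of the ternary map vanishes identically and carries no information.
  Integrating an arbitrary p(x) may lead out of the polynomials (arctangents, logarithms with
  unrelated residues). What excludes this is that a polynomial \<open>f\<close> solves the
  equations; its leading coefficients in each variable carry that information.\<close>

section \<open>Polynomial functions of several variables\<close>

text \<open>\<open>mpf k N\<close>: polynomial functions of the coordinates below \<open>k\<close> in which the degree in each single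
  variable (not the total degree) is at most \<open>N\<close>.\<close>

inductive mpf :: "nat \<Rightarrow> nat \<Rightarrow> ((nat \<Rightarrow> real) \<Rightarrow> real) \<Rightarrow> bool" for k N where
  monom: "(\<And>i. i < k \<Longrightarrow> e i \<le> N) \<Longrightarrow> mpf k N (\<lambda>x. a * (\<Prod>i<k. x i ^ e i))"
| add: "mpf k N f \<Longrightarrow> mpf k N g \<Longrightarrow> mpf k N (\<lambda>x. f x + g x)"

lemma mpf_const: "mpf k N (\<lambda>x. a)"
  using mpf.monom[of k "\<lambda>_. 0" N a] by simp

lemma mpf_scale:
  assumes "mpf k N f" shows "mpf k N (\<lambda>x. a * f x)"
  using assms
proof induction
  case (monom e b)
  then show ?case using mpf.monom[of k e N "a * b"] by (simp add: mult.assoc)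
next
  case (add f g)
  then show ?case using mpf.add[OF add.IH] by (simp add: distrib_left)
qed

lemma mpf_mono:
  assumes "mpf k N f" "N \<le> M" shows "mpf k M f"
  using assms
proof induction
  case (monom e b)
  then show ?case by (intro mpf.monom) (meson le_trans)
qed (auto intro: mpf.add)

lemma mpf_var:
  assumes "j < k" "1 \<le> N" shows "mpf k N (\<lambda>x. x j)"
proof -
  have "(\<lambda>x::nat\<Rightarrow>real. 1 * (\<Prod>i<k. x i ^ (if i = j then 1 else 0))) = (\<lambda>x. x j)"
  proof
    fix x :: "nat \<Rightarrow> real"
    have "(\<Prod>i<k. x i ^ (if i = j then 1 else 0)) = (\<Prod>i<k. if i = j then x i else 1)"
      by (intro prod.cong) auto
    also have "\<dots> = x j" using assms by (simp add: prod.delta')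
    finally show "1 * (\<Prod>i<k. x i ^ (if i = j then 1 else 0)) = x j" by simp
  qed
  then show ?thesis using mpf.monom[of k "\<lambda>i. if i = j then 1 else 0" N 1] assms by auto
qed

lemma mpf_mult:
  assumes "mpf k N f" "mpf k M g" shows "mpf k (N + M) (\<lambda>x. f x * g x)"
  using assms(1)
proof induction
  case (monom e a)
  note e = this
  from assms(2) show ?case
  proof induction
    case (monom e' b)
    have "(\<lambda>x::nat\<Rightarrow>real. a * (\<Prod>i<k. x i ^ e i) * (b * (\<Prod>i<k. x i ^ e' i)))
        = (\<lambda>x. a * b * (\<Prod>i<k. x i ^ (e i + e' i)))"
      by (auto simp: fun_eq_iff power_add prod.distrib)
    moreover have "mpf k (N + M) (\<lambda>x. a * b * (\<Prod>i<k. x i ^ (e i + e' i)))"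
      by (intro mpf.monom[of k "\<lambda>i. e i + e' i"] add_mono e monom)
    ultimately show ?case by simp
  next
    case (add f g)
    then show ?case using mpf.add[OF add.IH] by (simp add: distrib_left)
  qed
next
  case (add f1 f2)
  then show ?case using mpf.add[OF add.IH] by (simp add: distrib_right)
qed

lemma mpf_sum:
  assumes "\<And>i. i \<in> I \<Longrightarrow> mpf k N (f i)"
  shows "mpf k N (\<lambda>x. \<Sum>i\<in>I. f i x)"
  using assms by (induction I rule: infinite_finite_induct) (auto intro: mpf_const mpf.add)

lemma mpf_power:
  assumes "mpf k N f" shows "mpf k (m * N) (\<lambda>x. f x ^ m)"
  by (induction m) (auto intro: mpf_const mpf_mult assms)

lemma mpf_prod:
  assumes "finite I" "\<And>i. i \<in> I \<Longrightarrow> mpf k N (f i)"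
  shows "mpf k (card I * N) (\<lambda>x. \<Prod>i\<in>I. f i x)"
  using assms by (induction I) (auto intro: mpf_const mpf_mult)

lemma mpf_compose:
  assumes "mpf l M q" "\<And>i. i < l \<Longrightarrow> mpf k N (\<theta> i)"
  shows "mpf k (l * (M * N)) (\<lambda>x. q (\<lambda>i. \<theta> i x))"
  using assms(1)
proof induction
  case (monom e a)
  have "mpf k (M * N) (\<lambda>x. \<theta> i x ^ e i)" if "i < l" for i
    using mpf_power[OF assms(2)[OF that], of "e i"] monom[OF that] mpf_mono by (metis mult_le_mono1)
  then have "mpf k (card {..<l} * (M * N)) (\<lambda>x. \<Prod>i<l. \<theta> i x ^ e i)"
    by (intro mpf_prod) auto
  then show ?case by (intro mpf_scale) simp
qed (auto intro: mpf.add)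

text \<open>Counting needs the degree bound of \<open>mpf\<close>; the differential algebra only
  needs that some bound exists.\<close>

definition PF :: "nat \<Rightarrow> ((nat \<Rightarrow> real) \<Rightarrow> real) \<Rightarrow> bool" where
  "PF k f \<longleftrightarrow> (\<exists>N. mpf k N f)"

lemma PF_const [simp]: "PF k (\<lambda>x. a)"
  using mpf_const PF_def by blast

lemma PF_var: "j < k \<Longrightarrow> PF k (\<lambda>x. x j)"
  using mpf_var[of j k 1] PF_def by blast

lemma PF_add: "PF k f \<Longrightarrow> PF k g \<Longrightarrow> PF k (\<lambda>x. f x + g x)"
  unfolding PF_def by (metis mpf.add mpf_mono nat_le_linear)

lemma PF_mult: "PF k f \<Longrightarrow> PF k g \<Longrightarrow> PF k (\<lambda>x. f x * g x)"
  unfolding PF_def using mpf_mult by blast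

lemma PF_uminus: "PF k f \<Longrightarrow> PF k (\<lambda>x. - f x)"
  using PF_mult[of k "\<lambda>_. -1" f] by simp

lemma PF_diff: "PF k f \<Longrightarrow> PF k g \<Longrightarrow> PF k (\<lambda>x. f x - g x)"
  using PF_add[of k f "\<lambda>x. - g x"] PF_uminus by simp

lemma PF_sum: "(\<And>i. i \<in> I \<Longrightarrow> PF k (f i)) \<Longrightarrow> PF k (\<lambda>x. \<Sum>i\<in>I. f i x)"
  by (induction I rule: infinite_finite_induct) (auto intro: PF_add)

lemma PF_compose:
  assumes "PF l q" "\<And>i. i < l \<Longrightarrow> PF k (\<theta> i)"
  shows "PF k (\<lambda>x. q (\<lambda>i. \<theta> i x))"
proof -
  obtain M where M: "mpf l M q" using assms(1) PF_def by blast
  from assms(2) obtain N where N: "\<And>i. i < l \<Longrightarrow> mpf k (N i) (\<theta> i)" unfolding PF_def by metis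
  have "mpf k (\<Sum>i<l. N i) (\<theta> i)" if "i < l" for i
    using mpf_mono[OF N[OF that]] that by (metis finite_lessThan lessThan_iff member_le_sum zero_le)
  then have "mpf k (l * (M * (\<Sum>i<l. N i))) (\<lambda>x. q (\<lambda>i. \<theta> i x))"
    by (rule mpf_compose[OF M])
  then show ?thesis unfolding PF_def by blast
qed

lemma PF_poly: "PF k f \<Longrightarrow> PF k (\<lambda>x. poly p (f x))"
  by (induction p) (auto intro!: PF_add PF_mult)

lemma PF_power: "PF k f \<Longrightarrow> PF k (\<lambda>x. f x ^ n)"
  by (induction n) (auto intro!: PF_mult)

lemma mpf_line:
  assumes "mpf k N f"
  shows "\<exists>P :: real poly. \<forall>t. f (\<lambda>i. a i + t * (b i - a i)) = poly P t"
  using assms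
proof induction
  case (monom e c)
  show ?case
    by (rule exI[of _ "smult c (\<Prod>i<k. [:a i, b i - a i:] ^ e i)"]) (simp add: poly_prod)
next
  case (add f g)
  then show ?case by (metis poly_add)
qed

text \<open>Restricted to the line that joins a nonzero of \<open>f\<close> to a nonzero of
  \<open>g\<close>, both become nonzero univariate polynomials, whose product cannot vanish
  everywhere. Later cancellations of polynomial functions rest on this.\<close>

lemma PF_no_zero_divisors:
  assumes f: "PF k f" and g: "PF k g" and fg: "\<And>x. f x * g x = 0"
  shows "(\<forall>x. f x = 0) \<or> (\<forall>x. g x = 0)"
proof (rule ccontr)
  assume "\<not> ?thesis"
  then obtain a b where ab: "f a \<noteq> 0" "g b \<noteq> 0" by auto
  obtain P Q where P: "\<forall>t. f (\<lambda>i. a i + t * (b i - a i)) = poly P t"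
    and Q: "\<forall>t. g (\<lambda>i. a i + t * (b i - a i)) = poly Q t"
    using mpf_line f g unfolding PF_def by metis
  have "poly P 0 = f a" using P[rule_format, of 0] by simp
  moreover have "poly Q 1 = g b" using Q[rule_format, of 1] by simp
  ultimately have "P * Q \<noteq> 0" using ab by auto
  moreover have "poly (P * Q) t = 0" for t using fg P Q by (metis poly_mult)
  ultimately show False using poly_all_0_iff_0 by blast
qed

section \<open>Slices: polynomial functions as univariate polynomials in one coordinate\<close>

lemma mpf_slice:
  assumes "mpf k N f"
  shows "\<exists>c. (\<forall>i. mpf k N (c i)) \<and> (\<forall>x t. f (x(j := t)) = (\<Sum>i\<le>N. c i x * t ^ i))
           \<and> (\<forall>i x t. c i (x(j := t)) = c i x)"
  using assms
proof induction
  case (monom e a)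
  show ?case
  proof (cases "j < k")
    case False
    have "a * (\<Prod>i<k. (x(j := t)) i ^ e i) = a * (\<Prod>i<k. x i ^ e i)" for x :: "nat \<Rightarrow> real" and t
      using False by (intro arg_cong[where f="\<lambda>z. a * z"] prod.cong) auto
    then show ?thesis
    proof (intro exI[of _ "\<lambda>i x. if i = 0 then a * (\<Prod>i<k. x i ^ e i) else 0"] conjI allI)
      show "mpf k N (\<lambda>x. if i = 0 then a * (\<Prod>i<k. x i ^ e i) else 0)" for i :: nat
        using monom by (cases "i = 0") (auto intro: mpf_const mpf.monom)
    qed (simp_all add: if_distrib[of "\<lambda>z. z * _"] cong: if_cong)
  next
    case True
    define m where "m = (\<lambda>x::nat\<Rightarrow>real. a * (\<Prod>i<k. x i ^ (e(j := 0)) i))"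
    have m: "mpf k N m" unfolding m_def using monom by (intro mpf.monom) auto
    have m_upd: "m (x(j := t)) = m x" for x t
      unfolding m_def by (intro arg_cong[where f="\<lambda>z. a * z"] prod.cong) auto
    have eq: "a * (\<Prod>i<k. (x(j := t)) i ^ e i) = m x * t ^ e j" for x :: "nat \<Rightarrow> real" and t
    proof -
      have k: "{..<k} = insert j ({..<k} - {j})" using True by auto
      have "(\<Prod>i<k. (x(j := t)) i ^ e i) = t ^ e j * (\<Prod>i\<in>{..<k} - {j}. x i ^ e i)"
        by (subst k, subst prod.insert) (auto intro: prod.cong)
      moreover have "(\<Prod>i<k. x i ^ (e(j := 0)) i) = (\<Prod>i\<in>{..<k} - {j}. x i ^ e i)"
        by (subst k, subst prod.insert) (auto intro: prod.cong)
      ultimately show ?thesis unfolding m_def by simp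
    qed
    show ?thesis
    proof (intro exI[of _ "\<lambda>i x. if i = e j then m x else 0"] conjI allI)
      show "mpf k N (\<lambda>x. if i = e j then m x else 0)" for i
        using m by (cases "i = e j") (auto intro: mpf_const)
    qed (use monom[OF True] in \<open>simp_all add: eq m_upd if_distrib[of "\<lambda>z. z * _"] del: fun_upd_apply cong: if_cong\<close>)
  qed
next
  case (add f g)
  then obtain c c' where c: "\<forall>i. mpf k N (c i)" "\<forall>x t. f (x(j := t)) = (\<Sum>i\<le>N. c i x * t ^ i)"
      "\<forall>i x t. c i (x(j := t)) = c i x"
    and c': "\<forall>i. mpf k N (c' i)" "\<forall>x t. g (x(j := t)) = (\<Sum>i\<le>N. c' i x * t ^ i)"
      "\<forall>i x t. c' i (x(j := t)) = c' i x" by blast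
  show ?case
    by (rule exI[of _ "\<lambda>i x. c i x + c' i x"])
       (use c c' in \<open>auto intro: mpf.add simp: distrib_right sum.distrib simp del: fun_upd_apply\<close>)
qed

text \<open>Freezing all coordinates but \<open>j\<close> gives an element of
  \<open>real poly\<close>, so that degree, division and \<open>pderiv\<close> become
  available.\<close>

definition slice :: "nat \<Rightarrow> ((nat \<Rightarrow> real) \<Rightarrow> real) \<Rightarrow> (nat \<Rightarrow> real) \<Rightarrow> real poly" where
  "slice j f x = (THE P. \<forall>t. poly P t = f (x(j := t)))"

lemma slice_eqI:
  assumes "\<And>t. poly P t = f (x(j := t))"
  shows "slice j f x = P"
  unfolding slice_def
proof (rule the_equality)
  fix Q assume "\<forall>t. poly Q t = f (x(j := t))"
  with assms have "poly Q = poly P" by auto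
  then show "Q = P" by (simp add: poly_eq_poly_eq_iff)
qed (use assms in auto)

lemma slice_expand:
  assumes "mpf k N f"
  obtains c where "\<And>i. mpf k N (c i)" "\<And>i x t. c i (x(j := t)) = c i x"
    "\<And>x. slice j f x = (\<Sum>i\<le>N. monom (c i x) i)"
proof -
  obtain c where c: "\<forall>i. mpf k N (c i)" "\<forall>x t. f (x(j := t)) = (\<Sum>i\<le>N. c i x * t ^ i)"
      "\<forall>i x t. c i (x(j := t)) = c i x" using mpf_slice[OF assms] by blast
  have "slice j f x = (\<Sum>i\<le>N. monom (c i x) i)" for x
    by (rule slice_eqI) (simp add: poly_sum poly_monom c(2))
  with c show ?thesis using that by blast
qed

lemma poly_slice:
  assumes "PF k f" shows "poly (slice j f x) t = f (x(j := t))"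
proof -
  obtain N where N: "mpf k N f" using assms PF_def by blast
  obtain c where c: "\<forall>i. mpf k N (c i)" "\<forall>x t. f (x(j := t)) = (\<Sum>i\<le>N. c i x * t ^ i)"
    using mpf_slice[OF N] by blast
  have "slice j f x = (\<Sum>i\<le>N. monom (c i x) i)"
    by (rule slice_eqI) (simp add: poly_sum poly_monom c(2))
  then show ?thesis using c(2) by (simp add: poly_sum poly_monom)
qed

lemma poly_slice_self: "PF k f \<Longrightarrow> poly (slice j f x) (x j) = f x"
  by (simp add: poly_slice)

lemma degree_slice:
  assumes "mpf k N f" shows "degree (slice j f x) \<le> N"
proof -
  obtain c where "\<And>x. slice j f x = (\<Sum>i\<le>N. monom (c i x) i)"
    using slice_expand[OF assms] by metis
  then show ?thesis by (auto intro!: degree_sum_le order_trans[OF degree_monom_le])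
qed

lemma slice_upd [simp]: "slice j f (x(j := t)) = slice j f x"
  unfolding slice_def by simp

text \<open>The coefficients of a slice are polynomial functions and \<open>T\<close> acts on the
  monomials only. Applied to \<open>pderiv\<close> and to quotient and remainder modulo a fixed
  polynomial.\<close>

lemma PF_linear_slice:
  assumes f: "PF k f" and T: "\<And>p q. T (p + q) = T p + T q" "\<And>c p. T (smult c p) = smult c (T p)"
    and j: "j < k"
  shows "PF k (\<lambda>x. poly (T (slice j f x)) (x j))"
proof -
  obtain N where N: "mpf k N f" using f PF_def by blast
  obtain c where c: "\<And>i. mpf k N (c i)" "\<And>x. slice j f x = (\<Sum>i\<le>N. monom (c i x) i)"
    using slice_expand[OF N] by metis
  have T0: "T 0 = 0" using T(2)[of 0 0] by simp
  have Tsum: "T (\<Sum>i\<in>I. p i) = (\<Sum>i\<in>I. T (p i))" for I :: "nat set" and p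
    by (induction I rule: infinite_finite_induct) (auto simp: T0 T(1))
  have "T (slice j f x) = (\<Sum>i\<le>N. smult (c i x) (T (monom 1 i)))" for x
    by (simp add: c(2) Tsum flip: T(2)) (simp add: smult_monom)
  then have "(\<lambda>x. poly (T (slice j f x)) (x j)) = (\<lambda>x. \<Sum>i\<le>N. c i x * poly (T (monom 1 i)) (x j))"
    by (simp add: poly_sum)
  moreover have "PF k (\<lambda>x. \<Sum>i\<le>N. c i x * poly (T (monom 1 i)) (x j))"
    by (intro PF_sum PF_mult PF_poly PF_var j) (use c(1) PF_def in blast)
  ultimately show ?thesis by simp
qed

text \<open>Algebraic rather than analytic, so that polynomiality is immediate;
  \<open>DERIV_pd\<close> recovers the usual derivative.\<close>

definition pd :: "nat \<Rightarrow> ((nat \<Rightarrow> real) \<Rightarrow> real) \<Rightarrow> (nat \<Rightarrow> real) \<Rightarrow> real" where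
  "pd j f x = poly (pderiv (slice j f x)) (x j)"

lemma PF_pd: "PF k f \<Longrightarrow> j < k \<Longrightarrow> PF k (pd j f)"
  using PF_linear_slice[of k f pderiv j] by (simp add: pd_def[abs_def] pderiv_add pderiv_smult)

lemma slice_pd:
  assumes "PF k f" shows "slice j (pd j f) x = pderiv (slice j f x)"
  by (rule slice_eqI) (simp add: pd_def)

lemma DERIV_pd:
  assumes "PF k f" shows "((\<lambda>t. f (x(j := t))) has_real_derivative pd j f (x(j := s))) (at s)"
  using poly_DERIV[of "slice j f x" s] by (simp add: pd_def poly_slice[OF assms] slice_upd)

lemma pd_eqI:
  assumes "PF k f" "\<And>x. ((\<lambda>t. f (x(j := t))) has_real_derivative g x) (at (x j))"
  shows "pd j f x = g x"
  using DERIV_unique[OF DERIV_pd[OF assms(1), where x=x and j=j and s="x j"] assms(2)[of x]] by simp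

section \<open>Algebraic dependence and generic finiteness\<close>

lemma homogeneous_system:
  fixes M :: "'a \<Rightarrow> 'b \<Rightarrow> real"
  assumes "finite J" "finite I" "card J < card I"
  shows "\<exists>c. (\<exists>i\<in>I. c i \<noteq> 0) \<and> (\<forall>j\<in>J. (\<Sum>i\<in>I. c i * M i j) = 0)"
  using assms
proof (induction J arbitrary: I M rule: finite_induct)
  case empty
  then obtain i where "i \<in> I" by (metis card_gt_0_iff card.empty ex_in_conv)
  then show ?case by (intro exI[of _ "\<lambda>_. 1"]) auto
next
  case (insert j J)
  show ?case
  proof (cases "\<forall>i\<in>I. M i j = 0")
    case True
    have "card J < card I" using insert by simp
    with insert.IH[OF insert.prems(1), of M] True show ?thesis by auto
  next
    case False
    \<comment> \<open>Pivot: equation \<open>j\<close> is solved for the unknown \<open>k\<close>,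
      and the other equations are rewritten in the remaining unknowns.\<close>
    then obtain k where k: "k \<in> I" "M k j \<noteq> 0" by auto
    define I' where "I' = I - {k}"
    have I': "I = insert k I'" "k \<notin> I'" "finite I'" using k insert.prems unfolding I'_def by auto
    have "card J < card I'" using insert I' by simp
    from insert.IH[OF I'(3) this, of "\<lambda>i l. M i l - M i j / M k j * M k l"]
    obtain c where c: "\<exists>i\<in>I'. c i \<noteq> 0"
      "\<forall>l\<in>J. (\<Sum>i\<in>I'. c i * (M i l - M i j / M k j * M k l)) = 0" by blast
    define c' where "c' = c(k := - (\<Sum>i\<in>I'. c i * M i j) / M k j)"
    have sum: "(\<Sum>i\<in>I. c' i * M i l) = (\<Sum>i\<in>I'. c i * (M i l - M i j / M k j * M k l))" for l
    proof -
      have "(\<Sum>i\<in>I'. c' i * M i l) = (\<Sum>i\<in>I'. c i * M i l)"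
        using I' by (intro sum.cong) (auto simp: c'_def)
      moreover have "(\<Sum>i\<in>I'. c i * (M i l - M i j / M k j * M k l))
          = (\<Sum>i\<in>I'. c i * M i l) - (\<Sum>i\<in>I'. c i * M i j) * M k l / M k j"
        by (simp add: right_diff_distrib sum_subtractf sum_distrib_left sum_divide_distrib mult_ac)
      ultimately show ?thesis using I' by (simp add: c'_def)
    qed
    have "(\<Sum>i\<in>I. c' i * M i j) = 0" using k by (simp add: sum)
    moreover have "\<exists>i\<in>I. c' i \<noteq> 0" using c(1) I' by (auto simp: c'_def)
    ultimately show ?thesis using c(2) sum by (intro exI[of _ c']) auto
  qed
qed

text \<open>Extensional functions, so that exponent vectors agreeing below \<open>k\<close> are
  equal and can be counted.\<close>

definition expo :: "nat \<Rightarrow> nat \<Rightarrow> (nat \<Rightarrow> nat) set" where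
  "expo k N = PiE {..<k} (\<lambda>_. {..N})"

lemma finite_expo [simp]: "finite (expo k N)"
  unfolding expo_def by (intro finite_PiE) auto

lemma card_expo: "card (expo k N) = (N + 1) ^ k"
  unfolding expo_def by (simp add: card_PiE)

lemma mpf_normal_form:
  assumes "mpf k N f"
  shows "\<exists>c. \<forall>x. f x = (\<Sum>e\<in>expo k N. c e * (\<Prod>i<k. x i ^ e i))"
  using assms
proof induction
  case (monom e a)
  define e' where "e' = restrict e {..<k}"
  have e': "e' \<in> expo k N" using monom unfolding expo_def e'_def by auto
  have "(\<Prod>i<k. x i ^ e i) = (\<Prod>i<k. x i ^ e' i)" for x :: "nat \<Rightarrow> real"
    unfolding e'_def by (intro prod.cong) auto
  then show ?case using e'
    by (intro exI[of _ "\<lambda>e. if e = e' then a else 0"])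
       (simp add: if_distrib[of "\<lambda>z. z * _"] cong: if_cong)
next
  case (add f g)
  then obtain c c' where "\<forall>x. f x = (\<Sum>e\<in>expo k N. c e * (\<Prod>i<k. x i ^ e i))"
    "\<forall>x. g x = (\<Sum>e\<in>expo k N. c' e * (\<Prod>i<k. x i ^ e i))" by blast
  then show ?case
    by (intro exI[of _ "\<lambda>e. c e + c' e"]) (simp add: distrib_right sum.distrib)
qed

lemma mpf_linearly_dependent:
  assumes "finite I" "(N + 1) ^ k < card I" "\<And>i. i \<in> I \<Longrightarrow> mpf k N (h i)"
  shows "\<exists>c. (\<exists>i\<in>I. c i \<noteq> 0) \<and> (\<forall>x. (\<Sum>i\<in>I. c i * h i x) = 0)"
proof -
  have "\<forall>i\<in>I. \<exists>c. \<forall>x. h i x = (\<Sum>e\<in>expo k N. c e * (\<Prod>j<k. x j ^ e j))"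
    using mpf_normal_form[OF assms(3)] by simp
  from bchoice[OF this] obtain M where
    M: "\<And>i x. i \<in> I \<Longrightarrow> h i x = (\<Sum>e\<in>expo k N. M i e * (\<Prod>j<k. x j ^ e j))"
    by blast
  obtain c where c: "\<exists>i\<in>I. c i \<noteq> 0" "\<forall>e\<in>expo k N. (\<Sum>i\<in>I. c i * M i e) = 0"
    using homogeneous_system[of "expo k N" I M] assms(1,2) by (auto simp: card_expo)
  have "(\<Sum>i\<in>I. c i * h i x) = 0" for x
  proof -
    have "(\<Sum>i\<in>I. c i * h i x) = (\<Sum>i\<in>I. \<Sum>e\<in>expo k N. c i * M i e * (\<Prod>j<k. x j ^ e j))"
      by (intro sum.cong) (auto simp: M sum_distrib_left mult.assoc)
    also have "\<dots> = (\<Sum>e\<in>expo k N. (\<Sum>i\<in>I. c i * M i e) * (\<Prod>j<k. x j ^ e j))"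
      by (subst sum.swap) (simp add: sum_distrib_right)
    also have "\<dots> = 0" using c(2) by simp
    finally show ?thesis .
  qed
  with c(1) show ?thesis by blast
qed

text \<open>The Jacobian matrix of \<open>\<theta>\<close> has a nonzero left kernel vector with polynomial entries.\<close>

definition rank_deficient :: "nat \<Rightarrow> nat \<Rightarrow> (nat \<Rightarrow> (nat \<Rightarrow> real) \<Rightarrow> real) \<Rightarrow> bool" where
  "rank_deficient k l \<theta> \<longleftrightarrow>
     (\<exists>p. (\<forall>i<l. PF k (p i)) \<and> (\<exists>i<l. \<exists>x. p i x \<noteq> 0)
        \<and> (\<forall>j<k. \<forall>x. (\<Sum>i<l. p i x * pd j (\<theta> i) x) = 0))"

text \<open>Differentiating a relation P(\<theta>) = 0 in every coordinate shows that the partial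
  derivatives of P, evaluated at \<theta>, form a left kernel vector of the Jacobian. If all of them
  vanish, one is a relation of lower total degree and induction applies; characteristic 0 keeps its
  coefficients nonzero.\<close>

lemma algebraically_dependent_imp_rank_deficient:
  assumes \<theta>: "\<And>i. i < l \<Longrightarrow> PF k (\<theta> i)"
    and "finite F" "F \<noteq> {}" "F \<subseteq> extensional {..<l}" "\<And>e. e \<in> F \<Longrightarrow> c e \<noteq> 0"
    and "\<And>e. e \<in> F \<Longrightarrow> (\<Sum>i<l. e i) \<le> D"
    and "\<And>x. (\<Sum>e\<in>F. c e * (\<Prod>i<l. \<theta> i x ^ e i)) = 0"
  shows "rank_deficient k l \<theta>"
  using assms(2-)
proof (induction D arbitrary: F c)
  case (0 F c)
  from 0(2) obtain e0 where e0: "e0 \<in> F" by blast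
  have zero: "e i = 0" if "e \<in> F" "i < l" for e i using 0(5)[OF that(1)] that(2) by simp
  have "e = e0" if "e \<in> F" for e
    using zero[OF that] zero[OF e0] that e0 0(3) by (intro extensionalityI[of e "{..<l}"]) auto
  then have "F = {e0}" using e0 by blast
  with 0(6) zero[OF e0] 0(4)[OF e0] show ?case by simp
next
  case (Suc D F c)
  define p where "p = (\<lambda>i x. \<Sum>e\<in>F. c e * (real (e i) * \<theta> i x ^ (e i - 1) * (\<Prod>m\<in>{..<l} - {i}. \<theta> m x ^ e m)))"
  have PFp: "PF k (p i)" if "i < l" for i
    unfolding p_def
  proof (intro PF_sum PF_mult PF_const PF_power \<theta> that)
    fix e
    have "finite I \<Longrightarrow> I \<subseteq> {..<l} \<Longrightarrow> PF k (\<lambda>x. \<Prod>m\<in>I. \<theta> m x ^ e m)" for I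
      by (induction I rule: finite_induct) (auto intro!: PF_mult PF_power \<theta>)
    then show "PF k (\<lambda>x. \<Prod>m\<in>{..<l} - {i}. \<theta> m x ^ e m)" by auto
  qed
  have chain: "(\<Sum>i<l. p i x * pd j (\<theta> i) x) = 0" if "j < k" for j x
  proof -
    let ?u = "\<lambda>t. x(j := t)"
    let ?E = "(\<Sum>e\<in>F. c e * (\<Sum>i<l. (real (e i) * \<theta> i x ^ (e i - 1) * pd j (\<theta> i) x)
            * (\<Prod>m\<in>{..<l} - {i}. \<theta> m x ^ e m)))"
    have "((\<lambda>t. \<Sum>e\<in>F. c e * (\<Prod>i<l. \<theta> i (?u t) ^ e i)) has_real_derivative
        ?E) (at (x j))"
    proof (intro DERIV_sum DERIV_cmult)
      fix e assume "e \<in> F"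
      have d: "((\<lambda>t. \<theta> i (?u t)) has_real_derivative pd j (\<theta> i) x) (at (x j))" if "i < l" for i
        using DERIV_pd[OF \<theta>[OF that], of x j "x j"] by simp
      have "((\<lambda>t. \<theta> i (?u t) ^ e i) has_real_derivative
           real (e i) * \<theta> i x ^ (e i - 1) * pd j (\<theta> i) x) (at (x j))" if "i < l" for i
        using DERIV_power[OF d[OF that], of "e i"] by (simp add: mult_ac)
      then show "((\<lambda>t. \<Prod>i<l. \<theta> i (?u t) ^ e i) has_real_derivative
          (\<Sum>i<l. (real (e i) * \<theta> i x ^ (e i - 1) * pd j (\<theta> i) x)
            * (\<Prod>m\<in>{..<l} - {i}. \<theta> m x ^ e m))) (at (x j))"
        using has_field_derivative_prod[of "{..<l}" "\<lambda>i t. \<theta> i (?u t) ^ e i"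
            "\<lambda>i. real (e i) * \<theta> i x ^ (e i - 1) * pd j (\<theta> i) x" "x j"] by simp
    qed
    then have "((\<lambda>t. 0) has_real_derivative ?E) (at (x j))"
      by (simp only: Suc.prems(6))
    then have "?E = 0"
      by (rule DERIV_unique[OF _ DERIV_const])
    also have "?E = (\<Sum>i<l. p i x * pd j (\<theta> i) x)"
      unfolding p_def sum_distrib_left sum_distrib_right
      by (subst sum.swap) (simp add: mult_ac)
    finally show ?thesis .
  qed
  show ?case
  proof (cases "\<exists>i<l. \<exists>x. p i x \<noteq> 0")
    case True
    then show ?thesis unfolding rank_deficient_def using PFp chain by blast
  next
    case False
    show ?thesis
    proof (cases "\<exists>e\<in>F. \<exists>i<l. e i > 0")
      case True
      then obtain e1 i where i: "e1 \<in> F" "i < l" "e1 i > 0" by blast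
      \<comment> \<open>The partial derivative of the relation in its \<open>i\<close>-th argument:
        monomials with \<open>e i > 0\<close> survive, with exponents shifted by \<open>down\<close>
        and coefficients \<open>c'\<close>.\<close>
      define F0 where "F0 = {e \<in> F. e i > 0}"
      define down where "down = (\<lambda>e::nat\<Rightarrow>nat. e(i := e i - 1))"
      define c' where "c' = (\<lambda>e. c (e(i := Suc (e i))) * real (Suc (e i)))"
      have up: "(down e)(i := Suc (down e i)) = e" if "e \<in> F0" for e
        using that unfolding down_def F0_def by auto
      have inj: "inj_on down F0" by (rule inj_on_inverseI[of _ "\<lambda>e. e(i := Suc (e i))"]) (rule up)
      have F0F: "F0 \<subseteq> F" unfolding F0_def by auto
      show ?thesis
      proof (rule Suc.IH)
        show "finite (down ` F0)" "down ` F0 \<noteq> {}" using Suc.prems(1) i unfolding F0_def by auto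
        show "down ` F0 \<subseteq> extensional {..<l}"
          using F0F Suc.prems(3) i(2) unfolding down_def extensional_def by auto
        show "c' e \<noteq> 0" if "e \<in> down ` F0" for e
          using that up F0F Suc.prems(4) unfolding c'_def by auto
        show "(\<Sum>m<l. e m) \<le> D" if "e \<in> down ` F0" for e
        proof -
          from that obtain e' where e': "e' \<in> F0" "e = down e'" by blast
          have "(\<Sum>m<l. e' m) = e' i + (\<Sum>m\<in>{..<l} - {i}. e' m)"
            using i(2) by (simp add: sum.remove)
          moreover have "(\<Sum>m<l. e m) = e i + (\<Sum>m\<in>{..<l} - {i}. e' m)"
            using i(2) e'(2) by (simp add: sum.remove down_def)
          moreover have "(\<Sum>m<l. e' m) \<le> Suc D" "e' i > 0" "e i = e' i - 1"
            using e' Suc.prems(5) F0F unfolding F0_def down_def by auto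
          ultimately show ?thesis by linarith
        qed
        show "(\<Sum>e\<in>down ` F0. c' e * (\<Prod>m<l. \<theta> m x ^ e m)) = 0" for x
        proof -
          have "(\<Sum>e\<in>down ` F0. c' e * (\<Prod>m<l. \<theta> m x ^ e m))
              = (\<Sum>e\<in>F0. c' (down e) * (\<Prod>m<l. \<theta> m x ^ down e m))"
            by (simp add: sum.reindex[OF inj])
          also have "\<dots> = (\<Sum>e\<in>F0. c e * (real (e i) * \<theta> i x ^ (e i - 1) * (\<Prod>m\<in>{..<l} - {i}. \<theta> m x ^ e m)))"
          proof (intro sum.cong refl)
            fix e assume e: "e \<in> F0"
            have "(\<Prod>m<l. \<theta> m x ^ down e m) = \<theta> i x ^ (e i - 1) * (\<Prod>m\<in>{..<l} - {i}. \<theta> m x ^ e m)"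
              using i(2) by (simp add: prod.remove down_def)
            moreover have "c' (down e) = c e * real (e i)"
              unfolding c'_def using up[OF e] e unfolding down_def F0_def by auto
            ultimately show "c' (down e) * (\<Prod>m<l. \<theta> m x ^ down e m)
              = c e * (real (e i) * \<theta> i x ^ (e i - 1) * (\<Prod>m\<in>{..<l} - {i}. \<theta> m x ^ e m))" by simp
          qed
          also have "\<dots> = p i x"
            unfolding p_def F0_def using Suc.prems(1) by (intro sum.mono_neutral_left) auto
          also have "\<dots> = 0" using False i(2) by blast
          finally show ?thesis .
        qed
      qed
    next
      case False
      have "(\<Sum>i<l. e i) \<le> D" if "e \<in> F" for e
        using False that by (subst sum.neutral) auto
      with Suc show ?thesis by blast
    qed
  qed
qed

text \<open>The relation is found by counting dimensions: the functions
  \<open>(\<Prod>i<k. \<theta> i ^ e i) * x j ^ m\<close> with all exponents at most \<open>N\<close> outnumber the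
  monomials of the space they live in once \<open>N \<ge> (k * d + 1) ^ k\<close>.\<close>

lemma coordinate_relation:
  assumes \<theta>: "\<And>i. i < k \<Longrightarrow> mpf k d (\<theta> i)" and nd: "\<not> rank_deficient k k \<theta>" and j: "j < k"
    and N: "N = (k * d + 1) ^ k"
  shows "\<exists>\<Delta>. mpf k (k * (N * d)) \<Delta> \<and> (\<exists>x. \<Delta> x \<noteq> 0) \<and>
      (\<forall>\<tau>. \<exists>S. finite S \<and> card S \<le> N \<and> (\<forall>x. (\<forall>i<k. \<theta> i x = \<tau> i) \<and> \<Delta> x \<noteq> 0 \<longrightarrow> x j \<in> S))"
proof -
  define h where "h = (\<lambda>(e, m) x. (\<Prod>i<k. \<theta> i x ^ e i) * x j ^ m)"
  have \<theta>e: "mpf k (k * (N * d)) (\<lambda>x. \<Prod>i<k. \<theta> i x ^ e i)" if "e \<in> expo k N" for e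
  proof -
    have "mpf k N (\<lambda>x. 1 * (\<Prod>i<k. x i ^ e i))"
      using that by (intro mpf.monom) (auto simp: expo_def)
    from mpf_compose[OF this \<theta>] show ?thesis by simp
  qed
  have h: "mpf k (k * (N * d) + N) (h em)" if em_in: "em \<in> expo k N \<times> {..N}" for em
  proof -
    obtain e m where em: "em = (e, m)" "e \<in> expo k N" "m \<le> N" using em_in by (cases em) auto
    have "mpf k N (\<lambda>x. x j ^ m)"
      using mpf_mono[OF mpf_power[OF mpf_var[OF j order_refl]], of m N] em by simp
    then show ?thesis unfolding h_def em(1) using mpf_mult[OF \<theta>e[OF em(2)]] by simp
  qed
  have "k * (N * d) + N + 1 \<le> (k * d + 1) * (N + 1)" by (simp add: algebra_simps)
  then have "(k * (N * d) + N + 1) ^ k \<le> ((k * d + 1) * (N + 1)) ^ k" by (rule power_mono) simp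
  also have "\<dots> = (N + 1) ^ k * N" by (simp only: power_mult_distrib N mult.commute)
  also have "\<dots> < (N + 1) ^ k * (N + 1)" by simp
  also have "\<dots> = card (expo k N \<times> {..N})" by (simp add: card_expo card_cartesian_product)
  finally obtain c where c: "\<exists>em\<in>expo k N \<times> {..N}. c em \<noteq> 0"
    "\<forall>x. (\<Sum>em\<in>expo k N \<times> {..N}. c em * h em x) = 0"
    using mpf_linearly_dependent[of "expo k N \<times> {..N}" "k * (N * d) + N" k h] h by auto
  then obtain e0 m0 where m0: "e0 \<in> expo k N" "m0 \<le> N" "c (e0, m0) \<noteq> 0" by auto
  define q where "q = (\<lambda>m \<tau>. \<Sum>e\<in>expo k N. c (e, m) * (\<Prod>i<k. (\<tau> i :: real) ^ e i))"
  \<comment> \<open>The coefficient of \<open>x j ^ m0\<close> in the relation, as a function of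
    \<open>x\<close>. If it vanished identically, the components of \<open>\<theta>\<close> would be
    algebraically dependent.\<close>
  define \<Delta> where "\<Delta> = (\<lambda>x. q m0 (\<lambda>i. \<theta> i x))"
  have \<Delta>1: "mpf k (k * (N * d)) \<Delta>"
    unfolding \<Delta>_def q_def using \<theta>e by (auto intro!: mpf_sum mpf_scale)
  have \<Delta>2: "\<exists>x. \<Delta> x \<noteq> 0"
  proof (rule ccontr)
    assume "\<not> ?thesis"
    then have z: "q m0 (\<lambda>i. \<theta> i x) = 0" for x unfolding \<Delta>_def by simp
    let ?F = "{e \<in> expo k N. c (e, m0) \<noteq> 0}"
    have "rank_deficient k k \<theta>"
    proof (rule algebraically_dependent_imp_rank_deficient)
      show "PF k (\<theta> i)" if "i < k" for i using \<theta>[OF that] PF_def by blast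
      show "finite ?F" "?F \<noteq> {}" using m0 by auto
      show "?F \<subseteq> extensional {..<k}" by (auto simp: expo_def PiE_def)
      show "(\<Sum>i<k. e i) \<le> k * N" if "e \<in> ?F" for e
        using that sum_bounded_above[of "{..<k}" e N] by (auto simp: expo_def)
      show "c (e, m0) \<noteq> 0" if "e \<in> ?F" for e using that by simp
      show "(\<Sum>e\<in>?F. c (e, m0) * (\<Prod>i<k. \<theta> i x ^ e i)) = 0" for x
        using z[of x] unfolding q_def by (subst sum.mono_neutral_left[of "expo k N"]) auto
    qed
    with nd show False by simp
  qed
  have "\<exists>S. finite S \<and> card S \<le> N \<and> (\<forall>x. (\<forall>i<k. \<theta> i x = \<tau> i) \<and> \<Delta> x \<noteq> 0 \<longrightarrow> x j \<in> S)" for \<tau>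
  proof (cases "\<exists>x. (\<forall>i<k. \<theta> i x = \<tau> i) \<and> \<Delta> x \<noteq> 0")
    case False
    then show ?thesis by (intro exI[of _ "{}"]) auto
  next
    case True
    \<comment> \<open>On the fibre over \<open>\<tau>\<close> the coefficients of the relation are
      constants, so \<open>x j\<close> is a root of one polynomial of degree at most
      \<open>N\<close>; a fibre point with \<open>\<Delta> x \<noteq> 0\<close> shows that it is not
      the zero polynomial.\<close>
    define P where "P = (\<Sum>m\<le>N. monom (q m \<tau>) m)"
    have qq: "q m (\<lambda>i. \<theta> i x) = q m \<tau>" if "\<forall>i<k. \<theta> i x = \<tau> i" for m x
      unfolding q_def using that by (intro sum.cong arg_cong2[where f="(*)"] prod.cong) auto
    from True have "q m0 \<tau> \<noteq> 0" using qq unfolding \<Delta>_def by metis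
    moreover have "coeff P m0 = q m0 \<tau>" using m0(2) by (simp add: P_def coeff_sum)
    ultimately have P0: "P \<noteq> 0" by auto
    have degP: "degree P \<le> N" unfolding P_def
      by (auto intro!: degree_sum_le order_trans[OF degree_monom_le])
    have "poly P (x j) = 0" if "\<forall>i<k. \<theta> i x = \<tau> i" for x
    proof -
      have "0 = (\<Sum>em\<in>expo k N \<times> {..N}. c em * h em x)" using c(2) by simp
      also have "\<dots> = (\<Sum>m\<le>N. \<Sum>e\<in>expo k N. c (e, m) * h (e, m) x)"
        by (subst sum.swap) (simp add: sum.cartesian_product)
      also have "\<dots> = (\<Sum>m\<le>N. q m (\<lambda>i. \<theta> i x) * x j ^ m)"
        by (simp add: h_def q_def sum_distrib_right mult.assoc)
      also have "\<dots> = poly P (x j)" by (simp add: P_def poly_sum poly_monom qq[OF that])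
      finally show ?thesis by simp
    qed
    then show ?thesis
      using P0 degP card_poly_roots_bound[of P] poly_roots_finite[OF P0]
      by (intro exI[of _ "{t. poly P t = 0}"]) auto
  qed
  with \<Delta>1 \<Delta>2 show ?thesis by blast
qed

text \<open>The product of the \<open>k\<close> exceptional polynomials serves all coordinates at
  once, and it is nonzero because there are no zero divisors. Off its zeros each fibre lies in a box
  with at most \<open>N ^ k\<close> points.\<close>

lemma generic_finiteness:
  assumes \<theta>: "\<And>i. i < k \<Longrightarrow> mpf k d (\<theta> i)" and nd: "\<not> rank_deficient k k \<theta>"
    and N: "N = (k * d + 1) ^ k"
  shows "\<exists>\<Delta>. mpf k (k * (k * (N * d))) \<Delta> \<and> (\<exists>x. \<Delta> x \<noteq> 0) \<and>
      (\<forall>\<tau>. \<forall>j<k. \<exists>S. finite S \<and> card S \<le> N \<and> (\<forall>x. (\<forall>i<k. \<theta> i x = \<tau> i) \<and> \<Delta> x \<noteq> 0 \<longrightarrow> x j \<in> S))"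
proof -
  define Q where "Q = (\<lambda>j \<Delta>. mpf k (k * (N * d)) \<Delta> \<and> (\<exists>x. \<Delta> x \<noteq> 0) \<and>
      (\<forall>\<tau>. \<exists>S. finite S \<and> card S \<le> N \<and> (\<forall>x. (\<forall>i<k. \<theta> i x = \<tau> i) \<and> \<Delta> x \<noteq> 0 \<longrightarrow> x j \<in> S)))"
  have "\<exists>\<Delta>. Q j \<Delta>" if "j < k" for j
    unfolding Q_def using \<theta> nd that N by (rule coordinate_relation)
  then have "\<forall>j. \<exists>\<Delta>. j < k \<longrightarrow> Q j \<Delta>" by simp
  from choice[OF this] obtain \<Delta> where Q: "\<And>j. j < k \<Longrightarrow> Q j (\<Delta> j)" by blast
  have \<Delta>: "\<And>j. j < k \<Longrightarrow> mpf k (k * (N * d)) (\<Delta> j)" "\<And>j. j < k \<Longrightarrow> \<exists>x. \<Delta> j x \<noteq> 0"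
    and fib: "\<And>j \<tau>. j < k \<Longrightarrow> \<exists>S. finite S \<and> card S \<le> N \<and>
        (\<forall>x. (\<forall>i<k. \<theta> i x = \<tau> i) \<and> \<Delta> j x \<noteq> 0 \<longrightarrow> x j \<in> S)"
    using Q unfolding Q_def by simp_all
  have "\<exists>x. (\<Prod>j\<in>J. \<Delta> j x) \<noteq> 0" if "finite J" "J \<subseteq> {..<k}" for J
    using that
  proof (induction J rule: finite_induct)
    case (insert j J)
    have "PF k (\<Delta> j)" using \<Delta>(1)[of j] insert.prems unfolding PF_def by auto
    moreover have "mpf k (card J * (k * (N * d))) (\<lambda>x. \<Prod>j\<in>J. \<Delta> j x)"
      using insert by (intro mpf_prod \<Delta>(1)) auto
    then have "PF k (\<lambda>x. \<Prod>j\<in>J. \<Delta> j x)" unfolding PF_def by blast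
    ultimately have *: "(\<forall>x. \<Delta> j x = 0) \<or> (\<forall>x. (\<Prod>j\<in>J. \<Delta> j x) = 0)"
      if "\<And>x. \<Delta> j x * (\<Prod>j\<in>J. \<Delta> j x) = 0" using PF_no_zero_divisors that by blast
    have "\<exists>x. \<Delta> j x \<noteq> 0" "\<exists>x. (\<Prod>j\<in>J. \<Delta> j x) \<noteq> 0" using \<Delta>(2) insert by auto
    with * insert.hyps show ?case by (metis prod.insert)
  qed simp
  then obtain x where "(\<Prod>j<k. \<Delta> j x) \<noteq> 0" by blast
  moreover have "mpf k (k * (k * (N * d))) (\<lambda>x. \<Prod>j<k. \<Delta> j x)"
    using mpf_prod[of "{..<k}" k "k * (N * d)" \<Delta>] \<Delta>(1) by simp
  moreover have "\<exists>S. finite S \<and> card S \<le> N \<and>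
      (\<forall>x. (\<forall>i<k. \<theta> i x = \<tau> i) \<and> (\<Prod>j<k. \<Delta> j x) \<noteq> 0 \<longrightarrow> x j \<in> S)" if "j < k" for j \<tau>
    using fib[OF that, of \<tau>] that by auto
  ultimately show ?thesis by (intro exI[of _ "\<lambda>x. \<Prod>j<k. \<Delta> j x"]) blast
qed

section \<open>Proximity counting\<close>

lemma card_le_fibres:
  assumes "finite A" "f ` S \<subseteq> A" "\<And>a. a \<in> A \<Longrightarrow> finite {x \<in> S. f x = a} \<and> card {x \<in> S. f x = a} \<le> n"
  shows "finite S \<and> card S \<le> n * card A"
proof -
  have S: "S = (\<Union>a\<in>A. {x \<in> S. f x = a})" using assms(2) by auto
  have "finite (\<Union>a\<in>A. {x \<in> S. f x = a})" using assms by blast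
  moreover have "card (\<Union>a\<in>A. {x \<in> S. f x = a}) \<le> (\<Sum>a\<in>A. card {x \<in> S. f x = a})"
    by (rule card_UN_le[OF assms(1)])
  moreover have "(\<Sum>a\<in>A. card {x \<in> S. f x = a}) \<le> n * card A"
    using sum_bounded_above[of A "\<lambda>a. card {x \<in> S. f x = a}" n] assms(3) by (simp add: mult.commute)
  ultimately show ?thesis using S by (metis le_trans)
qed

text \<open>One step of a Schwartz-Zippel count: over base points outside \<open>B\<close> a fibre
  consists of few zeros, over the exceptional ones it is bounded trivially by
  \<open>s\<close>.\<close>

lemma card_fibres_exceptional:
  assumes A: "finite A" and W: "W \<subseteq> Sigma A V" and V: "\<And>a. a \<in> A \<Longrightarrow> finite (V a) \<and> card (V a) \<le> s"
    and B: "B \<subseteq> A" and M: "\<And>a. a \<in> A - B \<Longrightarrow> finite {t. (a, t) \<in> W} \<and> card {t. (a, t) \<in> W} \<le> M"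
  shows "finite W \<and> card W \<le> M * card A + s * card B"
proof -
  have WV: "{t. (a, t) \<in> W} \<subseteq> V a" if "a \<in> A" for a using W by auto
  have fin: "finite {t. (a, t) \<in> W}" if "a \<in> A" for a using WV[OF that] V[OF that] finite_subset by blast
  have eq: "W = (SIGMA a:A. {t. (a, t) \<in> W})" using W by auto
  have "card W = (\<Sum>a\<in>A. card {t. (a, t) \<in> W})" by (subst eq) (use A fin in simp)
  also have "\<dots> = (\<Sum>a\<in>A - B. card {t. (a, t) \<in> W}) + (\<Sum>a\<in>B. card {t. (a, t) \<in> W})"
    by (rule sum.subset_diff[OF B A])
  also have "\<dots> \<le> (\<Sum>a\<in>A - B. M) + (\<Sum>a\<in>B. s)"
  proof (intro add_mono sum_mono)
    show "card {t. (a, t) \<in> W} \<le> M" if "a \<in> A - B" for a using M[OF that] by blast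
    show "card {t. (a, t) \<in> W} \<le> s" if "a \<in> B" for a
      using V[of a] WV[of a] B that card_mono[of "V a" "{t. (a, t) \<in> W}"] by fastforce
  qed
  also have "\<dots> \<le> M * card A + s * card B"
    using card_mono[of A "A - B"] A by (simp only: sum_constant mult.commute finite_Diff Diff_subset add_mono mult_le_mono2 order_refl of_nat_id)
  finally have "card W \<le> M * card A + s * card B" .
  moreover have "finite W" by (subst eq) (use A fin in auto)
  ultimately show ?thesis by blast
qed

section \<open>Blocks of consecutive elements and their boundaries\<close>

definition rank :: "real set \<Rightarrow> real \<Rightarrow> nat" where
  "rank S x = card {s \<in> S. s < x}"

definition block :: "real set \<Rightarrow> nat \<Rightarrow> real \<Rightarrow> nat" where
  "block S w x = rank S x div w"

lemma rank_mono: "finite S \<Longrightarrow> x \<le> y \<Longrightarrow> rank S x \<le> rank S y"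
  unfolding rank_def by (rule card_mono) auto

lemma rank_strict_mono: "finite S \<Longrightarrow> x \<in> S \<Longrightarrow> x < y \<Longrightarrow> rank S x < rank S y"
  unfolding rank_def by (rule psubset_card_mono) auto

lemma rank_less_card: "finite S \<Longrightarrow> x \<in> S \<Longrightarrow> rank S x < card S"
  unfolding rank_def by (rule psubset_card_mono) auto

lemma rank_le_card: "finite S \<Longrightarrow> rank S x \<le> card S"
  unfolding rank_def by (rule card_mono) auto

lemma inj_on_rank: "finite S \<Longrightarrow> inj_on (rank S) S"
  by (metis inj_onI linorder_neqE nat_neq_iff rank_strict_mono)

lemma rank_image:
  assumes "finite S" shows "rank S ` S = {..<card S}"
  by (rule card_subset_eq) (use assms in \<open>auto simp: rank_less_card card_image inj_on_rank\<close>)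

lemma block_mono: "finite S \<Longrightarrow> x \<le> y \<Longrightarrow> block S w x \<le> block S w y"
  unfolding block_def by (intro div_le_mono rank_mono)

lemma block_le: "finite S \<Longrightarrow> block S w x \<le> card S div w"
  unfolding block_def by (intro div_le_mono rank_le_card)

lemma card_block:
  assumes "finite S" "w > 0" shows "card {y \<in> S. block S w y = b} \<le> w"
proof -
  have "rank S ` {y \<in> S. block S w y = b} \<subseteq> {b * w..<b * w + w}"
  proof clarify
    fix y assume "y \<in> S" "b = block S w y"
    moreover have "rank S y = rank S y div w * w + rank S y mod w" by simp
    ultimately show "rank S y \<in> {block S w y * w..<block S w y * w + w}"
      using mod_less_divisor[OF assms(2), of "rank S y"] unfolding block_def atLeastLessThan_iff by linarith
  qed
  then have "card (rank S ` {y \<in> S. block S w y = b}) \<le> card {b * w..<b * w + w}"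
    by (intro card_mono) auto
  moreover have "inj_on (rank S) {y \<in> S. block S w y = b}"
    using inj_on_rank[OF assms(1)] by (rule inj_on_subset) auto
  ultimately show ?thesis by (simp add: card_image)
qed

definition near :: "real set \<Rightarrow> nat \<Rightarrow> (real \<times> real) set" where
  "near S w = {(x, y). x \<in> S \<and> y \<in> S \<and> block S w x = block S w y}"

lemma card_near:
  assumes "finite S" "w > 0" shows "finite (near S w) \<and> card (near S w) \<le> w * card S"
proof (rule card_le_fibres[of S fst])
  fix a assume "a \<in> S"
  have "{p \<in> near S w. fst p = a} \<subseteq> Pair a ` {y \<in> S. block S w y = block S w a}"
    unfolding near_def by auto
  moreover have "finite (Pair a ` {y \<in> S. block S w y = block S w a})" using assms by simp
  moreover have "card (Pair a ` {y \<in> S. block S w y = block S w a}) \<le> w"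
    using card_block[OF assms, of "block S w a"] by (simp add: card_image inj_on_def)
  ultimately show "finite {p \<in> near S w. fst p = a} \<and> card {p \<in> near S w. fst p = a} \<le> w"
    by (meson card_mono finite_subset le_trans)
qed (use assms in \<open>auto simp: near_def\<close>)

text \<open>The last element of every complete block. As \<open>rank\<close> counts the elements
  strictly below, the block index jumps just after such an element, not at it.\<close>

definition cuts :: "real set \<Rightarrow> nat \<Rightarrow> real set" where
  "cuts S w = {c \<in> S. w dvd Suc (rank S c)}"

lemma card_cuts:
  assumes "finite S" "w > 0" shows "card (cuts S w) \<le> card S div w"
proof -
  have "inj_on (\<lambda>c. Suc (rank S c) div w) (cuts S w)"
  proof (rule inj_onI)
    fix x y assume *: "x \<in> cuts S w" "y \<in> cuts S w" "Suc (rank S x) div w = Suc (rank S y) div w"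
    then have "Suc (rank S x) = Suc (rank S y)" unfolding cuts_def
      by (metis (no_types, lifting) dvd_div_mult_self mem_Collect_eq)
    with * inj_on_rank[OF assms(1)] show "x = y" unfolding cuts_def by (auto dest: inj_onD)
  qed
  moreover have "(\<lambda>c. Suc (rank S c) div w) ` cuts S w \<subseteq> {1..card S div w}"
  proof clarify
    fix c assume c: "c \<in> cuts S w"
    then have "w \<le> Suc (rank S c)" unfolding cuts_def by (auto dest: dvd_imp_le)
    then have "1 \<le> Suc (rank S c) div w" using assms(2) by (metis div_le_mono div_self less_numeral_extra(3))
    moreover have "Suc (rank S c) \<le> card S" using c rank_less_card[OF assms(1)] unfolding cuts_def by (simp add: Suc_le_eq)
    ultimately show "Suc (rank S c) div w \<in> {1..card S div w}" by (simp add: div_le_mono)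
  qed
  ultimately show ?thesis using card_inj_on_le[of _ _ "{1..card S div w}"] by fastforce
qed

lemma cut_between:
  assumes S: "finite S" "w > 0" and xy: "x < y" "block S w x \<noteq> block S w y"
  shows "\<exists>c\<in>cuts S w. x \<le> c \<and> c < y"
proof -
  define b where "b = block S w y"
  have "block S w x < b" using block_mono[OF S(1), of x y w] xy unfolding b_def by simp
  then have x: "rank S x < b * w" unfolding block_def using S(2) by (simp add: div_less_iff_less_mult)
  have y: "b * w \<le> rank S y" unfolding b_def block_def by simp
  have "b * w - 1 < card S" using x y rank_le_card[OF S(1), of y] by linarith
  \<comment> \<open>Rank \<open>b * w - 1\<close> belongs to the last element before block
    \<open>b\<close>; the subtraction does not truncate because
    \<open>rank S x < b * w\<close>.\<close>
  then obtain c where c: "c \<in> S" "rank S c = b * w - 1" using rank_image[OF S(1)] by (metis imageE lessThan_iff)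
  have "Suc (rank S c) = b * w" using c x by simp
  then have "c \<in> cuts S w" unfolding cuts_def using c by simp
  moreover have "\<not> c < x" using rank_strict_mono[OF S(1) c(1), of x] c x by auto
  moreover have "\<not> y \<le> c" using rank_mono[OF S(1), of y c] c x y by auto
  ultimately show ?thesis by (intro bexI[of _ c]) auto
qed

text \<open>A polynomial of degree \<open>d\<close> crosses each cut of \<open>D\<close> at most \<open>d\<close> times, so its graph meets
  few cells of the grid of blocks.\<close>

lemma few_cells:
  fixes g :: "real poly"
  assumes X: "finite X" "s > 0" and D: "finite D" "w > 0"
  obtains \<nu> where "\<And>x. \<nu> x \<le> card X div s + 2 * (degree g * (card D div w)) + 1"
    and "\<And>x y. \<nu> x = \<nu> y \<Longrightarrow> block X s x = block X s y \<and> block D w (poly g x) = block D w (poly g y)"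
proof (cases "degree g = 0")
  \<comment> \<open>A constant may lie on a cut, and then the crossing set \<open>R\<close> below
    would be the whole line; but a constant stays in one block of \<open>D\<close> anyway.\<close>
  case True
  then obtain a where "g = [:a:]" by (rule degree_eq_zeroE)
  then show ?thesis using block_le[OF X(1)] by (intro that[of "block X s"]) (auto simp: le_SucI)
next
  case False
  define R where "R = {x. poly g x \<in> cuts D w}"
  have finC: "finite (cuts D w)" using D(1) unfolding cuts_def by simp
  have "finite R \<and> card R \<le> degree g * card (cuts D w)"
  proof (rule card_le_fibres[OF finC, of "poly g"])
    fix a
    have nz: "g - [:a:] \<noteq> 0" using False by (metis degree_pCons_0 eq_iff_diff_eq_0)
    have "{x \<in> R. poly g x = a} \<subseteq> {x. poly (g - [:a:]) x = 0}" by auto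
    moreover have "card {x. poly (g - [:a:]) x = 0} \<le> degree g"
      using card_poly_roots_bound[OF nz] degree_diff_le_max[of g "[:a:]"] by simp
    ultimately show "finite {x \<in> R. poly g x = a} \<and> card {x \<in> R. poly g x = a} \<le> degree g"
      using poly_roots_finite[OF nz] by (meson card_mono finite_subset le_trans)
  qed (auto simp: R_def)
  then have R: "finite R" "card R \<le> degree g * (card D div w)"
    using card_cuts[OF D] by (auto intro: le_trans mult_le_mono2)
  \<comment> \<open>The last two summands number the points of \<open>R\<close> and the gaps between
    them from left to right, with odd values for the points. They and the block index are both
    monotone, so equal sums force the same block of \<open>X\<close> and no point of
    \<open>R\<close> in between.\<close>
  define \<nu> where "\<nu> = (\<lambda>x. block X s x + 2 * rank R x + (if x \<in> R then 1 else 0))"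
  have key: "block X s x = block X s y \<and> block D w (poly g x) = block D w (poly g y)"
    if eq: "\<nu> x = \<nu> y" and less: "x < y" for x y
  proof -
    have *: "block X s x \<le> block X s y" "rank R x \<le> rank R y"
      using block_mono[OF X(1)] rank_mono[OF R(1)] less by auto
    have xR: "x \<notin> R"
    proof
      assume "x \<in> R"
      with rank_strict_mono[OF R(1) this less] * eq show False unfolding \<nu>_def by (auto split: if_splits)
    qed
    with * eq have b: "block X s x = block X s y" "rank R x = rank R y" "y \<notin> R"
      unfolding \<nu>_def by (auto split: if_splits)
    have noR: "z \<notin> R" if z: "x \<le> z" "z \<le> y" for z
    proof
      assume zR: "z \<in> R"
      then have "x < z" "z < y" using xR b(3) z by (auto simp: less_le)
      with rank_mono[OF R(1), of x z] rank_strict_mono[OF R(1) zR, of y] b(2) show False by simp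
    qed
    have "block D w (poly g x) = block D w (poly g y)"
    proof (rule ccontr)
      assume ne: "\<not> ?thesis"
      have cont: "continuous_on {x..y} (poly g)" by (intro continuous_intros)
      have "\<exists>z. x \<le> z \<and> z \<le> y \<and> poly g z \<in> cuts D w"
      proof (cases "poly g x < poly g y")
        case True
        from cut_between[OF D True ne] obtain c where "c \<in> cuts D w" "poly g x \<le> c" "c < poly g y" by blast
        with IVT'[of "poly g" x c y] cont less show ?thesis by force
      next
        case False
        with ne have "poly g y < poly g x" by (metis linorder_neqE_linordered_idom)
        from cut_between[OF D this] ne obtain c where "c \<in> cuts D w" "poly g y \<le> c" "c < poly g x" by metis
        with IVT2'[of "poly g" y c x] cont less show ?thesis by force
      qed
      with noR show False unfolding R_def by auto
    qed
    with b show ?thesis by simp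
  qed
  show ?thesis
  proof (rule that[of \<nu>])
    show "\<nu> x \<le> card X div s + 2 * (degree g * (card D div w)) + 1" for x
      using block_le[OF X(1), of s x] rank_le_card[OF R(1), of x] R(2) unfolding \<nu>_def by simp
    show "block X s x = block X s y \<and> block D w (poly g x) = block D w (poly g y)" if "\<nu> x = \<nu> y" for x y
      using key[of x y] key[of y x] that by (metis linorder_neqE_linordered_idom)
  qed
qed

lemma sum_squared_le_card: "(\<Sum>i\<in>I. f i)\<^sup>2 \<le> card I * (\<Sum>i\<in>I. (f i)\<^sup>2)" for f :: "'a \<Rightarrow> nat"
proof -
  have "(\<Sum>i\<in>I. f i)\<^sup>2 = (\<Sum>i\<in>I. \<Sum>j\<in>I. f i * f j)"
    unfolding power2_eq_square by (rule sum_product)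
  then have "2 * (\<Sum>i\<in>I. f i)\<^sup>2 = (\<Sum>i\<in>I. \<Sum>j\<in>I. 2 * (f i * f j))"
    by (simp only: sum_distrib_left[symmetric])
  also have "\<dots> \<le> (\<Sum>i\<in>I. \<Sum>j\<in>I. (f i)\<^sup>2 + (f j)\<^sup>2)"
  proof (intro sum_mono)
    fix i j
    have "0 \<le> (int (f i) - int (f j))\<^sup>2" by simp
    then have "int (2 * (f i * f j)) \<le> int ((f i)\<^sup>2 + (f j)\<^sup>2)"
      by (simp add: power2_eq_square algebra_simps)
    then show "2 * (f i * f j) \<le> (f i)\<^sup>2 + (f j)\<^sup>2" by linarith
  qed
  also have "\<dots> = 2 * (card I * (\<Sum>i\<in>I. (f i)\<^sup>2))"
    by (simp add: sum.distrib flip: sum_distrib_left)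
  finally show ?thesis by simp
qed

lemma card_colliding_pairs:
  fixes \<nu> :: "'a \<Rightarrow> nat"
  assumes "finite H" "\<And>x. x \<in> H \<Longrightarrow> \<nu> x < W"
  shows "(card H)\<^sup>2 \<le> W * card {(x, y). x \<in> H \<and> y \<in> H \<and> \<nu> x = \<nu> y}"
proof -
  define F where "F = (\<lambda>v. {x \<in> H. \<nu> x = v})"
  have fin: "finite (F v)" for v unfolding F_def using assms(1) by simp
  have "H = (\<Union>v<W. F v)" using assms(2) unfolding F_def by auto
  then have "card H = (\<Sum>v<W. card (F v))"
    by (simp only:) (rule card_UN_disjoint, use fin in \<open>auto simp: F_def\<close>)
  moreover have "{(x, y). x \<in> H \<and> y \<in> H \<and> \<nu> x = \<nu> y} = (\<Union>v<W. F v \<times> F v)"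
    using assms(2) unfolding F_def by auto
  then have "card {(x, y). x \<in> H \<and> y \<in> H \<and> \<nu> x = \<nu> y} = (\<Sum>v<W. card (F v \<times> F v))"
    by (simp only:) (rule card_UN_disjoint, use fin in \<open>auto simp: F_def\<close>)
  ultimately show ?thesis
    using sum_squared_le_card[of "\<lambda>v. card (F v)" "{..<W}"]
    by (simp add: card_cartesian_product power2_eq_square)
qed

text \<open>Cauchy-Schwarz twice: for fixed \<open>p\<close> the hits fall into few cells, hence
  many pairs share one; then the hits are summed over \<open>p\<close>. The final \<open>+ 2\<close>
  exceeds the constant of \<open>few_cells\<close> by one, since values starting at 0 are
  counted.\<close>

lemma proximity:
  fixes g :: "'p \<Rightarrow> real poly"
  assumes X: "finite X" "s > 0" and D: "finite D" "w > 0" and P: "finite P"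
    and d: "\<And>p. p \<in> P \<Longrightarrow> degree (g p) \<le> d"
  shows "(card {(x, p). x \<in> X \<and> p \<in> P \<and> poly (g p) x \<in> D})\<^sup>2
     \<le> card P * (card X div s + 2 * (d * (card D div w)) + 2)
        * card {(x, y, p). (x, y) \<in> near X s \<and> p \<in> P \<and> (poly (g p) x, poly (g p) y) \<in> near D w}"
proof -
  define W where "W = card X div s + 2 * (d * (card D div w)) + 2"
  define H where "H = (\<lambda>p. {x \<in> X. poly (g p) x \<in> D})"
  define Q where "Q = (\<lambda>p. {(x, y). (x, y) \<in> near X s \<and> (poly (g p) x, poly (g p) y) \<in> near D w})"
  have finH: "finite (H p)" for p unfolding H_def using X by simp
  have finQ: "finite (Q p)" for p
    using card_near[OF X] unfolding Q_def by (auto intro: finite_subset[of _ "near X s"])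
  have one: "(card (H p))\<^sup>2 \<le> W * card (Q p)" if p: "p \<in> P" for p
  proof -
    obtain \<nu> where \<nu>: "\<And>x. \<nu> x \<le> card X div s + 2 * (degree (g p) * (card D div w)) + 1"
      "\<And>x y. \<nu> x = \<nu> y \<Longrightarrow> block X s x = block X s y \<and> block D w (poly (g p) x) = block D w (poly (g p) y)"
      using few_cells[OF X D, of "g p"] by blast
    have "\<nu> x < W" for x
      using \<nu>(1)[of x] mult_le_mono1[OF d[OF p], of "card D div w"] unfolding W_def by linarith
    then have "(card (H p))\<^sup>2 \<le> W * card {(x, y). x \<in> H p \<and> y \<in> H p \<and> \<nu> x = \<nu> y}"
      by (intro card_colliding_pairs finH) auto
    also have "card {(x, y). x \<in> H p \<and> y \<in> H p \<and> \<nu> x = \<nu> y} \<le> card (Q p)"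
    proof (rule card_mono[OF finQ], clarify)
      fix x y assume xy: "x \<in> H p" "y \<in> H p" "\<nu> x = \<nu> y"
      from \<nu>(2)[OF xy(3)] xy(1,2) show "(x, y) \<in> Q p" unfolding Q_def near_def H_def by simp
    qed
    finally show ?thesis by simp
  qed
  have "card {(x, p). x \<in> X \<and> p \<in> P \<and> poly (g p) x \<in> D} = card (SIGMA p:P. H p)"
    by (rule bij_betw_same_card[of prod.swap]) (auto simp: bij_betw_def inj_on_def H_def image_iff)
  also have "\<dots> = (\<Sum>p\<in>P. card (H p))" using P finH by simp
  finally have "(card {(x, p). x \<in> X \<and> p \<in> P \<and> poly (g p) x \<in> D})\<^sup>2 \<le> card P * (\<Sum>p\<in>P. (card (H p))\<^sup>2)"
    using sum_squared_le_card[of "\<lambda>p. card (H p)" P] by simp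
  also have "\<dots> \<le> card P * (\<Sum>p\<in>P. W * card (Q p))" by (intro mult_le_mono2 sum_mono one)
  also have "(\<Sum>p\<in>P. W * card (Q p)) = W * card (SIGMA p:P. Q p)"
    using P finQ by (simp add: sum_distrib_left)
  also have "card (SIGMA p:P. Q p)
      = card {(x, y, p). (x, y) \<in> near X s \<and> p \<in> P \<and> (poly (g p) x, poly (g p) y) \<in> near D w}"
    by (rule bij_betw_same_card[of "\<lambda>(p, x, y). (x, y, p)"])
       (auto simp: bij_betw_def inj_on_def Q_def image_iff)
  finally show ?thesis unfolding W_def by (simp only: mult.assoc)
qed

section \<open>Zeros over near pairs and generic fibres\<close>

lemma mpf_cong:
  assumes "mpf k N f" "\<And>i. i < k \<Longrightarrow> x i = y i" shows "f x = f y"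
  using assms by induction (auto intro!: prod.cong)

lemma card_zeros_slice:
  assumes "mpf k N f" "f (x(j := t)) \<noteq> 0"
  shows "finite {v. f (x(j := v)) = 0} \<and> card {v. f (x(j := v)) = 0} \<le> N"
proof -
  have PF: "PF k f" using assms(1) PF_def by blast
  have "{v. f (x(j := v)) = 0} = {v. poly (slice j f x) v = 0}" by (simp add: poly_slice[OF PF])
  moreover have nz: "slice j f x \<noteq> 0" using poly_slice[OF PF, of j x t] assms(2) by auto
  ultimately show ?thesis
    using poly_roots_finite[OF nz] card_poly_roots_bound[OF nz] degree_slice[OF assms(1), of j x] by simp
qed

definition vec4 :: "real \<times> real \<times> real \<times> real \<Rightarrow> nat \<Rightarrow> real" where
  "vec4 = (\<lambda>(a, b, c, e). (\<lambda>_. 0)(0 := a, 1 := b, 2 := c, 3 := e))"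

lemma vec4_simps [simp]:
  "vec4 (a, b, c, e) 0 = a" "vec4 (a, b, c, e) (Suc 0) = b" "vec4 (a, b, c, e) 2 = c" "vec4 (a, b, c, e) 3 = e"
  by (simp_all add: vec4_def)

lemma vec4_upd:
  "(vec4 (a, b, c, e))(0 := t) = vec4 (t, b, c, e)" "(vec4 (a, b, c, e))(Suc 0 := t) = vec4 (a, t, c, e)"
  "(vec4 (a, b, c, e))(2 := t) = vec4 (a, b, t, e)" "(vec4 (a, b, c, e))(3 := t) = vec4 (a, b, c, t)"
  by (auto simp: vec4_def)

lemma vec4_cover: "mpf 4 N f \<Longrightarrow> f (vec4 (x 0, x 1, x 2, x 3)) = f x"
  by (rule mpf_cong[of 4 N]) (auto simp: vec4_def less_Suc_eq numeral_eq_Suc)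

lemma finite_card_le_image:
  assumes "A \<subseteq> h ` B" "finite B" "card B \<le> n" shows "finite A \<and> card A \<le> n"
  using assms by (meson card_image_le card_mono finite_imageI finite_subset le_trans)

text \<open>Schwartz-Zippel for a set that is not a grid: \<open>v\<close> ranges only over the at
  most \<open>s\<close> partners of \<open>u\<close>. Starting from a point where
  \<open>\<Delta>\<close> does not vanish, the coordinates are released in the order
  \<open>u\<close>, \<open>z\<close>, \<open>y\<close>, \<open>v\<close>. With \<open>v\<close>
  last, the factor \<open>s\<close> is paid only for the exceptional triples.\<close>

lemma card_zeros_restricted:
  assumes \<Delta>: "mpf 4 M \<Delta>" "\<Delta> x0 \<noteq> 0" and XYZ: "finite X" "finite Y" "finite Z"
    and NP: "NP \<subseteq> X \<times> X" and s: "\<And>u. u \<in> X \<Longrightarrow> card {v. (u, v) \<in> NP} \<le> s"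
  shows "card {(u, v, y, z). (u, v) \<in> NP \<and> y \<in> Y \<and> z \<in> Z \<and> \<Delta> (vec4 (u, v, y, z)) = 0}
    \<le> M * (card X * card Y * card Z + s * (card X * card Y + card X * card Z + card Y * card Z))"
proof -
  define a where "a = x0 0" define b where "b = x0 1" define c where "c = x0 2" define e where "e = x0 3"
  define F where "F = (\<lambda>u v y z. \<Delta> (vec4 (u, v, y, z)))"
  have nz: "F a b c e \<noteq> 0" using vec4_cover[OF \<Delta>(1), of x0] \<Delta>(2) unfolding F_def a_def b_def c_def e_def by simp
  have r0: "finite {t. F t v y z = 0} \<and> card {t. F t v y z = 0} \<le> M" if "F t' v y z \<noteq> 0" for t' v y z
    using card_zeros_slice[OF \<Delta>(1), of "vec4 (0, v, y, z)" 0 t'] that unfolding F_def by (simp add: vec4_upd)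
  have r1: "finite {t. F u t y z = 0} \<and> card {t. F u t y z = 0} \<le> M" if "F u t' y z \<noteq> 0" for t' u y z
    using card_zeros_slice[OF \<Delta>(1), of "vec4 (u, 0, y, z)" 1 t'] that unfolding F_def by (simp add: vec4_upd)
  have r2: "finite {t. F u v t z = 0} \<and> card {t. F u v t z = 0} \<le> M" if "F u v t' z \<noteq> 0" for t' u v z
    using card_zeros_slice[OF \<Delta>(1), of "vec4 (u, v, 0, z)" 2 t'] that unfolding F_def by (simp add: vec4_upd)
  have r3: "finite {t. F u v y t = 0} \<and> card {t. F u v y t = 0} \<le> M" if "F u v y t' \<noteq> 0" for t' u v y
    using card_zeros_slice[OF \<Delta>(1), of "vec4 (u, v, y, 0)" 3 t'] that unfolding F_def by (simp add: vec4_upd)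
  define Z1 where "Z1 = {u \<in> X. F u b c e = 0}"
  define Z2 where "Z2 = {(u, z). u \<in> X \<and> z \<in> Z \<and> F u b c z = 0}"
  define Z3 where "Z3 = {((u, z), y). u \<in> X \<and> z \<in> Z \<and> y \<in> Y \<and> F u b y z = 0}"
  define Z4 where "Z4 = {(((u, z), y), v). (u, v) \<in> NP \<and> y \<in> Y \<and> z \<in> Z \<and> F u v y z = 0}"
  have "Z1 \<subseteq> {t. F t b c e = 0}" unfolding Z1_def by auto
  then have Z1: "card Z1 \<le> M" using r0[OF nz] by (meson card_mono le_trans)
  have Z2: "finite Z2 \<and> card Z2 \<le> M * card X + card Z * card Z1"
  proof (rule card_fibres_exceptional[of X Z2 "\<lambda>_. Z"])
    show "finite {z. (u, z) \<in> Z2} \<and> card {z. (u, z) \<in> Z2} \<le> M" if "u \<in> X - Z1" for u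
      by (rule finite_card_le_image[of _ id "{t. F u b c t = 0}"]) (use r3[of u b c e] that in \<open>auto simp: Z1_def Z2_def\<close>)
  qed (use XYZ in \<open>auto simp: Z1_def Z2_def\<close>)
  have Z3: "finite Z3 \<and> card Z3 \<le> M * card (X \<times> Z) + card Y * card Z2"
  proof (rule card_fibres_exceptional[of _ Z3 "\<lambda>_. Y"])
    show "finite {y. (p, y) \<in> Z3} \<and> card {y. (p, y) \<in> Z3} \<le> M" if p: "p \<in> X \<times> Z - Z2" for p
    proof -
      have "F (fst p) b c (snd p) \<noteq> 0" using p by (auto simp: Z2_def)
      note r2 = r2[OF this]
      show ?thesis by (rule finite_card_le_image[OF _ conjunct1[OF r2] conjunct2[OF r2], of _ id]) (auto simp: Z3_def)
    qed
  qed (use XYZ in \<open>auto simp: Z2_def Z3_def\<close>)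
  have "finite Z4 \<and> card Z4 \<le> M * card ((X \<times> Z) \<times> Y) + s * card Z3"
  proof (rule card_fibres_exceptional[of _ Z4 "\<lambda>p. {v. (fst (fst p), v) \<in> NP}"])
    show "finite {v. (fst (fst p), v) \<in> NP} \<and> card {v. (fst (fst p), v) \<in> NP} \<le> s" if "p \<in> (X \<times> Z) \<times> Y" for p
      using s[of "fst (fst p)"] finite_subset[of "{v. (fst (fst p), v) \<in> NP}" X] NP XYZ(1) that by auto
    show "finite {v. (p, v) \<in> Z4} \<and> card {v. (p, v) \<in> Z4} \<le> M" if p: "p \<in> (X \<times> Z) \<times> Y - Z3" for p
    proof -
      have "F (fst (fst p)) b (snd p) (snd (fst p)) \<noteq> 0" using p by (auto simp: Z3_def)
      note r1 = r1[OF this]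
      show ?thesis by (rule finite_card_le_image[OF _ conjunct1[OF r1] conjunct2[OF r1], of _ id]) (auto simp: Z4_def)
    qed
  qed (use XYZ NP in \<open>auto simp: Z3_def Z4_def\<close>)
  moreover have "card Z2 \<le> M * card X + card Z * M"
    using Z2 Z1 by (meson add_left_mono le_trans mult_le_mono2)
  then have "s * card Z3 \<le> s * (M * card (X \<times> Z) + card Y * (M * card X + card Z * M))"
    using Z3 by (meson add_left_mono le_trans mult_le_mono2)
  ultimately have "card Z4 \<le> M * card ((X \<times> Z) \<times> Y) + s * (M * card (X \<times> Z) + card Y * (M * card X + card Z * M))"
    by linarith
  moreover have "card {(u, v, y, z). (u, v) \<in> NP \<and> y \<in> Y \<and> z \<in> Z \<and> F u v y z = 0} = card Z4"
    by (rule bij_betw_same_card[of "\<lambda>(u, v, y, z). (((u, z), y), v)"])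
       (auto simp: bij_betw_def inj_on_def image_iff Z4_def)
  ultimately show ?thesis unfolding F_def by (simp add: card_cartesian_product algebra_simps)
qed

text \<open>Off the zeros of \<open>\<Delta>\<close> a fibre lies in a product of four sets of size
  at most \<open>N\<close>, which gives \<open>N ^ 4\<close>. The rest of \<open>T\<close> is
  charged to the zeros, where \<open>16 * N * d\<close> bounds the degree of \<open>\<Delta>\<close>
  in each variable.\<close>

lemma card_generic_fibres:
  assumes \<theta>: "\<And>i. i < 4 \<Longrightarrow> mpf 4 d (\<theta> i)" and nd: "\<not> rank_deficient 4 4 \<theta>"
    and N: "N = (4 * d + 1) ^ 4"
    and XYZ: "finite X" "finite Y" "finite Z"
    and NP: "NP \<subseteq> X \<times> X" and s: "\<And>u. u \<in> X \<Longrightarrow> card {v. (u, v) \<in> NP} \<le> s"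
    and T: "T \<subseteq> {(u, v, y, z). (u, v) \<in> NP \<and> y \<in> Y \<and> z \<in> Z}"
    and V: "finite V" "\<And>q. q \<in> T \<Longrightarrow> (\<theta> 0 (vec4 q), \<theta> 1 (vec4 q), \<theta> 2 (vec4 q), \<theta> 3 (vec4 q)) \<in> V"
  shows "card T \<le> N ^ 4 * card V
    + 16 * N * d * (card X * card Y * card Z + s * (card X * card Y + card X * card Z + card Y * card Z))"
proof -
  from generic_finiteness[OF \<theta> nd N] obtain \<Delta> where
    \<Delta>: "mpf 4 (4 * (4 * (N * d))) \<Delta>" "\<exists>x. \<Delta> x \<noteq> 0"
    and fib: "\<forall>\<tau>. \<forall>j<4. \<exists>S. finite S \<and> card S \<le> N \<and> (\<forall>x. (\<forall>i<4. \<theta> i x = \<tau> i) \<and> \<Delta> x \<noteq> 0 \<longrightarrow> x j \<in> S)"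
    by blast
  obtain x0 where x0: "\<Delta> x0 \<noteq> 0" using \<Delta>(2) by blast
  define B where "B = {(u, v, y, z). (u, v) \<in> NP \<and> y \<in> Y \<and> z \<in> Z \<and> \<Delta> (vec4 (u, v, y, z)) = 0}"
  have "B \<subseteq> X \<times> X \<times> Y \<times> Z" using NP unfolding B_def by auto
  then have finB: "finite B" using XYZ by (meson finite_SigmaI finite_subset)
  have cardB: "card B \<le> 16 * N * d * (card X * card Y * card Z + s * (card X * card Y + card X * card Z + card Y * card Z))"
    using card_zeros_restricted[OF \<Delta>(1) x0 XYZ NP s] unfolding B_def by (simp add: mult_ac)
  define \<phi> where "\<phi> = (\<lambda>q. (\<theta> 0 (vec4 q), \<theta> 1 (vec4 q), \<theta> 2 (vec4 q), \<theta> 3 (vec4 q)))"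
  have "finite (T - B) \<and> card (T - B) \<le> N ^ 4 * card V"
  proof (rule card_le_fibres[OF V(1), of \<phi>])
    show "\<phi> ` (T - B) \<subseteq> V" using V(2) unfolding \<phi>_def by auto
    fix \<tau> assume "\<tau> \<in> V"
    obtain t0 t1 t2 t3 where \<tau>: "\<tau> = (t0, t1, t2, t3)" by (cases \<tau>)
    have "\<forall>j. \<exists>S. j < 4 \<longrightarrow> finite S \<and> card S \<le> N \<and> (\<forall>x. (\<forall>i<4. \<theta> i x = vec4 \<tau> i) \<and> \<Delta> x \<noteq> 0 \<longrightarrow> x j \<in> S)"
      using fib[rule_format] by simp
    from choice[OF this] obtain S where
      S0: "\<forall>j. j < 4 \<longrightarrow> finite (S j) \<and> card (S j) \<le> N \<and> (\<forall>x. (\<forall>i<4. \<theta> i x = vec4 \<tau> i) \<and> \<Delta> x \<noteq> 0 \<longrightarrow> x j \<in> S j)"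
      by blast
    have S: "\<And>j. j < 4 \<Longrightarrow> finite (S j) \<and> card (S j) \<le> N"
      "\<And>j x. j < 4 \<Longrightarrow> (\<forall>i<4. \<theta> i x = vec4 \<tau> i) \<Longrightarrow> \<Delta> x \<noteq> 0 \<Longrightarrow> x j \<in> S j"
      using S0 by simp_all
    let ?P = "S 0 \<times> S 1 \<times> S 2 \<times> S 3"
    have "{q \<in> T - B. \<phi> q = \<tau>} \<subseteq> ?P"
    proof
      fix q assume qT: "q \<in> {q \<in> T - B. \<phi> q = \<tau>}"
      obtain u v y z where quvyz: "q = (u, v, y, z)" by (cases q)
      with qT have q: "(u, v, y, z) \<in> T" "(u, v, y, z) \<notin> B" "\<tau> = \<phi> (u, v, y, z)" by auto
      have "\<theta> i (vec4 (u, v, y, z)) = vec4 \<tau> i" if "i < 4" for i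
      proof -
        from that have "i = 0 \<or> i = 1 \<or> i = 2 \<or> i = 3" by auto
        then show ?thesis unfolding q(3) \<phi>_def by auto
      qed
      moreover have "\<Delta> (vec4 (u, v, y, z)) \<noteq> 0" using q(1,2) T unfolding B_def by auto
      ultimately have "vec4 (u, v, y, z) j \<in> S j" if "j < 4" for j using S(2)[OF that] by blast
      from this[of 0] this[of 1] this[of 2] this[of 3] show "q \<in> ?P" by (simp add: quvyz)
    qed
    moreover have "finite ?P" using S(1) by simp
    moreover have "card ?P \<le> N ^ 4"
    proof -
      have "card ?P = card (S 0) * (card (S 1) * (card (S 2) * card (S 3)))" by (simp only: card_cartesian_product)
      also have "\<dots> \<le> N * (N * (N * N))" using S(1)[of 0] S(1)[of 1] S(1)[of 2] S(1)[of 3] by (intro mult_le_mono) auto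
      finally show ?thesis by (simp add: numeral_eq_Suc)
    qed
    ultimately show "finite {q \<in> T - B. \<phi> q = \<tau>} \<and> card {q \<in> T - B. \<phi> q = \<tau>} \<le> N ^ 4"
      by (meson card_mono finite_subset le_trans)
  qed
  note TB = this
  moreover have "card T \<le> card (T - B) + card B"
  proof -
    have "card T \<le> card ((T - B) \<union> B)" using TB finB by (intro card_mono) auto
    also have "\<dots> \<le> card (T - B) + card B" by (rule card_Un_le)
    finally show ?thesis .
  qed
  ultimately show ?thesis using cardB by linarith
qed

section \<open>The two collision maps\<close>

definition polyfun3 :: "nat \<Rightarrow> (real \<Rightarrow> real \<Rightarrow> real \<Rightarrow> real) \<Rightarrow> bool" where
  "polyfun3 d f \<longleftrightarrow> mpf 3 d (\<lambda>x. f (x 0) (x 1) (x 2))"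

lemma polyfun3_compose:
  assumes "polyfun3 d f" "mpf k 1 \<alpha>" "mpf k 1 \<beta>" "mpf k 1 \<gamma>"
  shows "mpf k (3 * d) (\<lambda>x. f (\<alpha> x) (\<beta> x) (\<gamma> x))"
proof -
  let ?\<theta> = "\<lambda>i::nat. if i = 0 then \<alpha> else if i = 1 then \<beta> else \<gamma>"
  have "mpf k (3 * (d * 1)) (\<lambda>x. f (?\<theta> 0 x) (?\<theta> 1 x) (?\<theta> 2 x))"
    using mpf_compose[OF assms(1)[unfolded polyfun3_def], of k 1 ?\<theta>] assms(2-4) by auto
  then show ?thesis by simp
qed

lemma PF_polyfun3:
  assumes "polyfun3 d f" "PF k \<alpha>" "PF k \<beta>" "PF k \<gamma>"
  shows "PF k (\<lambda>x. f (\<alpha> x) (\<beta> x) (\<gamma> x))"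
proof -
  let ?\<theta> = "\<lambda>i::nat. if i = 0 then \<alpha> else if i = 1 then \<beta> else \<gamma>"
  have "PF 3 (\<lambda>x. f (x 0) (x 1) (x 2))" using assms(1) unfolding polyfun3_def PF_def by blast
  from PF_compose[OF this, of k ?\<theta>] show ?thesis using assms(2-4) by auto
qed

lemma polyfun3_permute:
  assumes "polyfun3 d f"
  shows "polyfun3 (3 * d) (\<lambda>x y z. f y x z)" "polyfun3 (3 * d) (\<lambda>x y z. f y z x)"
    "polyfun3 (3 * d) (\<lambda>x y z. f x z y)"
    "polyfun3 (3 * d) (\<lambda>x y z. f z x y)"
  unfolding polyfun3_def by (intro polyfun3_compose[OF assms] mpf_var; simp)+

text \<open>Derivatives of curried functions without reference to coordinates: permuting the
  arguments of \<open>f\<close> then permutes \<open>dx\<close>, \<open>dy\<close>,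
  \<open>dz\<close> by mere unfolding.\<close>

definition slope :: "(real \<Rightarrow> real) \<Rightarrow> real \<Rightarrow> real" where
  "slope h x = (THE D. (h has_real_derivative D) (at x))"

lemma slope_eqI: "(h has_real_derivative D) (at x) \<Longrightarrow> slope h x = D"
  unfolding slope_def by (rule the_equality) (auto dest: DERIV_unique)

definition dx :: "(real \<Rightarrow> real \<Rightarrow> real \<Rightarrow> real) \<Rightarrow> real \<Rightarrow> real \<Rightarrow> real \<Rightarrow> real" where
  "dx f x y z = slope (\<lambda>t. f t y z) x"

definition dy :: "(real \<Rightarrow> real \<Rightarrow> real \<Rightarrow> real) \<Rightarrow> real \<Rightarrow> real \<Rightarrow> real \<Rightarrow> real" where
  "dy f x y z = slope (\<lambda>t. f x t z) y"

definition dz :: "(real \<Rightarrow> real \<Rightarrow> real \<Rightarrow> real) \<Rightarrow> real \<Rightarrow> real \<Rightarrow> real \<Rightarrow> real" where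
  "dz f x y z = slope (\<lambda>t. f x y t) z"

definition vec3 :: "real \<Rightarrow> real \<Rightarrow> real \<Rightarrow> nat \<Rightarrow> real" where
  "vec3 a b c = (\<lambda>_. 0)(0 := a, 1 := b, 2 := c)"

lemma vec3_simps [simp]: "vec3 a b c 0 = a" "vec3 a b c (Suc 0) = b" "vec3 a b c 2 = c"
  by (simp_all add: vec3_def)

lemma partials_eq_pd:
  assumes "polyfun3 d f"
  defines "g \<equiv> (\<lambda>x. f (x 0) (x 1) (x 2))"
  shows "((\<lambda>t. f t y z) has_real_derivative dx f x y z) (at x)" "dx f x y z = pd 0 g (vec3 x y z)"
    "((\<lambda>t. f x t z) has_real_derivative dy f x y z) (at y)" "dy f x y z = pd 1 g (vec3 x y z)"
    "((\<lambda>t. f x y t) has_real_derivative dz f x y z) (at z)" "dz f x y z = pd 2 g (vec3 x y z)"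
proof -
  have g: "PF 3 g" using assms unfolding polyfun3_def PF_def by blast
  have 0: "((\<lambda>t. f t y z) has_real_derivative pd 0 g (vec3 x y z)) (at x)"
    using DERIV_pd[OF g, of "vec3 x y z" 0 x] by (simp add: g_def vec3_def fun_upd_twist)
  then show "dx f x y z = pd 0 g (vec3 x y z)" unfolding dx_def by (rule slope_eqI)
  with 0 show "((\<lambda>t. f t y z) has_real_derivative dx f x y z) (at x)" by simp
  have 1: "((\<lambda>t. f x t z) has_real_derivative pd 1 g (vec3 x y z)) (at y)"
    using DERIV_pd[OF g, of "vec3 x y z" 1 y] by (simp add: g_def vec3_def fun_upd_twist)
  then show "dy f x y z = pd 1 g (vec3 x y z)" unfolding dy_def by (rule slope_eqI)
  with 1 show "((\<lambda>t. f x t z) has_real_derivative dy f x y z) (at y)" by simp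
  have 2: "((\<lambda>t. f x y t) has_real_derivative pd 2 g (vec3 x y z)) (at z)"
    using DERIV_pd[OF g, of "vec3 x y z" 2 z] by (simp add: g_def vec3_def fun_upd_twist)
  then show "dz f x y z = pd 2 g (vec3 x y z)" unfolding dz_def by (rule slope_eqI)
  with 2 show "((\<lambda>t. f x y t) has_real_derivative dz f x y z) (at z)" by simp
qed

lemma polyfun3_partials:
  assumes "polyfun3 d f" shows "\<exists>d. polyfun3 d (dx f)" "\<exists>d. polyfun3 d (dy f)" "\<exists>d. polyfun3 d (dz f)"
proof -
  let ?g = "\<lambda>x. f (x 0) (x 1) (x 2)"
  have PF: "PF 3 ?g" using assms unfolding polyfun3_def PF_def by blast
  have *: "pd j ?g (vec3 (x 0) (x 1) (x 2)) = pd j ?g x" if j: "j < 3" for j x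
  proof -
    obtain N where "mpf 3 N (pd j ?g)" using PF_pd[OF PF j] PF_def by blast
    then show ?thesis by (rule mpf_cong) (auto simp: vec3_def less_Suc_eq numeral_eq_Suc)
  qed
  show "\<exists>d. polyfun3 d (dx f)" "\<exists>d. polyfun3 d (dy f)" "\<exists>d. polyfun3 d (dz f)"
    using PF_pd[OF PF, of 0] PF_pd[OF PF, of 1] PF_pd[OF PF, of 2]
    unfolding polyfun3_def PF_def partials_eq_pd[OF assms] by (simp_all add: *[simplified])
qed

text \<open>Keeping \<open>x 0\<close> and \<open>x 1\<close> as components places the image of the
  collisions in near pairs of \<open>X\<close> times near pairs of \<open>D\<close>.\<close>

definition \<theta>3 :: "(real \<Rightarrow> real \<Rightarrow> real \<Rightarrow> real) \<Rightarrow> nat \<Rightarrow> (nat \<Rightarrow> real) \<Rightarrow> real" where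
  "\<theta>3 f i x = (if i = 0 then x 0 else if i = 1 then x 1
     else if i = 2 then f (x 0) (x 2) (x 3) else f (x 1) (x 2) (x 3))"

text \<open>Ordered so that on a collision components 0, 1 and components 2, 3 are near pairs of
  \<open>D\<close>.\<close>

definition \<theta>2 :: "(real \<Rightarrow> real \<Rightarrow> real \<Rightarrow> real) \<Rightarrow> nat \<Rightarrow> (nat \<Rightarrow> real) \<Rightarrow> real" where
  "\<theta>2 f i x = (if i = 0 then f (x 0) (x 2) 0 else if i = 1 then f (x 1) (x 2) 0
     else if i = 2 then f (x 0) (x 3) 0 else f (x 1) (x 3) 0)"

lemma mpf_\<theta>3: "polyfun3 d f \<Longrightarrow> mpf 4 (3 * d + 1) (\<theta>3 f i)"
  unfolding \<theta>3_def[abs_def]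
  using mpf_mono[OF polyfun3_compose, of d f 4 _ _ _ "3 * d + 1"]
  by (cases "i = 0"; cases "i = 1"; cases "i = 2") (simp_all add: mpf_var)

lemma mpf_\<theta>2: "polyfun3 d f \<Longrightarrow> mpf 4 (3 * d + 1) (\<theta>2 f i)"
  unfolding \<theta>2_def[abs_def]
  using mpf_mono[OF polyfun3_compose, of d f 4 _ _ _ "3 * d + 1"]
  by (cases "i = 0"; cases "i = 1"; cases "i = 2") (simp_all add: mpf_var mpf_const)

lemma sum4: "(\<Sum>i<4. h i) = h 0 + h 1 + h 2 + (h 3 :: real)" for h :: "nat \<Rightarrow> real"
  by (simp add: numeral_eq_Suc)

text \<open>The first two components are coordinates, so the Jacobian determinant reduces to the
  minor \<open>M\<close> in the directions of \<open>x 2\<close> and \<open>x 3\<close>. If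
  \<open>M\<close> is not identically zero, Cramer's rule kills the whole kernel vector.\<close>

lemma rank_deficient_\<theta>3:
  assumes f: "polyfun3 d f" and rd: "rank_deficient 4 4 (\<theta>3 f)"
  shows "dy f u y z * dz f v y z = dz f u y z * dy f v y z"
proof -
  obtain p where p: "\<And>i. i < 4 \<Longrightarrow> PF 4 (p i)" "\<exists>i<4. \<exists>x. p i x \<noteq> 0"
    "\<And>j x. j < 4 \<Longrightarrow> (\<Sum>i<4. p i x * pd j (\<theta>3 f i) x) = 0"
    using rd unfolding rank_deficient_def by blast
  have PF\<theta>: "PF 4 (\<theta>3 f i)" for i using mpf_\<theta>3[OF f] PF_def by blast
  note D = partials_eq_pd(1,3,5)[OF f]
  have pd: "pd 0 (\<theta>3 f 0) x = 1" "pd 1 (\<theta>3 f 0) x = 0" "pd 2 (\<theta>3 f 0) x = 0" "pd 3 (\<theta>3 f 0) x = 0"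
      "pd 0 (\<theta>3 f 1) x = 0" "pd 1 (\<theta>3 f 1) x = 1" "pd 2 (\<theta>3 f 1) x = 0" "pd 3 (\<theta>3 f 1) x = 0"
      "pd 0 (\<theta>3 f 2) x = dx f (x 0) (x 2) (x 3)" "pd 1 (\<theta>3 f 2) x = 0"
      "pd 2 (\<theta>3 f 2) x = dy f (x 0) (x 2) (x 3)" "pd 3 (\<theta>3 f 2) x = dz f (x 0) (x 2) (x 3)"
      "pd 0 (\<theta>3 f 3) x = 0" "pd 1 (\<theta>3 f 3) x = dx f (x 1) (x 2) (x 3)"
      "pd 2 (\<theta>3 f 3) x = dy f (x 1) (x 2) (x 3)" "pd 3 (\<theta>3 f 3) x = dz f (x 1) (x 2) (x 3)" for x
    by (rule pd_eqI[OF PF\<theta>], auto simp: \<theta>3_def intro!: D derivative_eq_intros)+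
  define M where "M = (\<lambda>x::nat\<Rightarrow>real. dy f (x 0) (x 2) (x 3) * dz f (x 1) (x 2) (x 3)
      - dz f (x 0) (x 2) (x 3) * dy f (x 1) (x 2) (x 3))"
  obtain ey ez where e: "polyfun3 ey (dy f)" "polyfun3 ez (dz f)" using polyfun3_partials[OF f] by blast
  have PFM: "PF 4 M" unfolding M_def
    by (intro PF_diff PF_mult PF_polyfun3[OF e(1)] PF_polyfun3[OF e(2)] PF_var) auto
  have e0: "p 0 x + p 2 x * dx f (x 0) (x 2) (x 3) = 0"
    and e1: "p 1 x + p 3 x * dx f (x 1) (x 2) (x 3) = 0"
    and e2: "p 2 x * dy f (x 0) (x 2) (x 3) + p 3 x * dy f (x 1) (x 2) (x 3) = 0"
    and e3: "p 2 x * dz f (x 0) (x 2) (x 3) + p 3 x * dz f (x 1) (x 2) (x 3) = 0" for x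
    using p(3)[of 0 x] p(3)[of 1 x] p(3)[of 2 x] p(3)[of 3 x] by (simp_all only: sum4 pd) simp_all
  have p2M: "p 2 x * M x = 0" for x
  proof -
    have "p 2 x * M x = dz f (x 1) (x 2) (x 3) * (p 2 x * dy f (x 0) (x 2) (x 3) + p 3 x * dy f (x 1) (x 2) (x 3))
        - dy f (x 1) (x 2) (x 3) * (p 2 x * dz f (x 0) (x 2) (x 3) + p 3 x * dz f (x 1) (x 2) (x 3))"
      unfolding M_def by (simp add: algebra_simps)
    then show ?thesis by (simp only: e2 e3)
  qed
  have p3M: "p 3 x * M x = 0" for x
  proof -
    have "p 3 x * M x = dy f (x 0) (x 2) (x 3) * (p 2 x * dz f (x 0) (x 2) (x 3) + p 3 x * dz f (x 1) (x 2) (x 3))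
        - dz f (x 0) (x 2) (x 3) * (p 2 x * dy f (x 0) (x 2) (x 3) + p 3 x * dy f (x 1) (x 2) (x 3))"
      unfolding M_def by (simp add: algebra_simps)
    then show ?thesis by (simp only: e2 e3)
  qed
  have "\<forall>x. M x = 0"
  proof (rule ccontr)
    assume M: "\<not> (\<forall>x. M x = 0)"
    then have "\<forall>x. p 2 x = 0" "\<forall>x. p 3 x = 0"
      using PF_no_zero_divisors[OF p(1)[of 2] PFM p2M] PF_no_zero_divisors[OF p(1)[of 3] PFM p3M] by auto
    moreover from this have "\<forall>x. p 0 x = 0" "\<forall>x. p 1 x = 0" using e0 e1 by auto
    moreover have "i = 0 \<or> i = 1 \<or> i = 2 \<or> i = 3" if "i < 4" for i :: nat using that by auto
    ultimately show False using p(2) by metis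
  qed
  from this[rule_format, of "vec4 (u, v, y, z)"] show ?thesis unfolding M_def by simp
qed

text \<open>The Jacobian is a weighted incidence matrix of a 4-cycle: each corner involves two of
  the four coordinates. Its determinant \<open>M\<close> has just two terms, one for each way of
  matching the corners to distinct coordinates.\<close>

lemma rank_deficient_\<theta>2:
  assumes f: "polyfun3 d f" and rd: "rank_deficient 4 4 (\<theta>2 f)"
  shows "dx f u y 0 * dy f u z 0 * dy f v y 0 * dx f v z 0 = dy f u y 0 * dx f u z 0 * dx f v y 0 * dy f v z 0"
proof -
  obtain p where p: "\<And>i. i < 4 \<Longrightarrow> PF 4 (p i)" "\<exists>i<4. \<exists>x. p i x \<noteq> 0"
    "\<And>j x. j < 4 \<Longrightarrow> (\<Sum>i<4. p i x * pd j (\<theta>2 f i) x) = 0"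
    using rd unfolding rank_deficient_def by blast
  have PF\<theta>: "PF 4 (\<theta>2 f i)" for i using mpf_\<theta>2[OF f] PF_def by blast
  note D = partials_eq_pd(1,3)[OF f]
  define X where "X = (\<lambda>i j x::nat\<Rightarrow>real. dx f (x i) (x j) 0)"
  define Y where "Y = (\<lambda>i j x::nat\<Rightarrow>real. dy f (x i) (x j) 0)"
  have pd: "pd 0 (\<theta>2 f 0) x = X 0 2 x" "pd 1 (\<theta>2 f 0) x = 0" "pd 2 (\<theta>2 f 0) x = Y 0 2 x" "pd 3 (\<theta>2 f 0) x = 0"
      "pd 0 (\<theta>2 f 1) x = 0" "pd 1 (\<theta>2 f 1) x = X 1 2 x" "pd 2 (\<theta>2 f 1) x = Y 1 2 x" "pd 3 (\<theta>2 f 1) x = 0"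
      "pd 0 (\<theta>2 f 2) x = X 0 3 x" "pd 1 (\<theta>2 f 2) x = 0" "pd 2 (\<theta>2 f 2) x = 0" "pd 3 (\<theta>2 f 2) x = Y 0 3 x"
      "pd 0 (\<theta>2 f 3) x = 0" "pd 1 (\<theta>2 f 3) x = X 1 3 x" "pd 2 (\<theta>2 f 3) x = 0" "pd 3 (\<theta>2 f 3) x = Y 1 3 x" for x
    unfolding X_def Y_def
    by (rule pd_eqI[OF PF\<theta>], auto simp: \<theta>2_def intro!: D derivative_eq_intros)+
  define M where "M = (\<lambda>x. X 0 2 x * Y 0 3 x * Y 1 2 x * X 1 3 x - Y 0 2 x * X 0 3 x * X 1 2 x * Y 1 3 x)"
  obtain ex ey where e: "polyfun3 ex (dx f)" "polyfun3 ey (dy f)" using polyfun3_partials[OF f] by blast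
  have PFX: "PF 4 (X i j)" "PF 4 (Y i j)" if "i < 4" "j < 4" for i j unfolding X_def Y_def
    by (intro PF_polyfun3[OF e(1)] PF_polyfun3[OF e(2)] PF_var PF_const that)+
  have PFM: "PF 4 M" unfolding M_def by (intro PF_diff PF_mult PFX) auto
  have e0: "p 0 x * X 0 2 x + p 2 x * X 0 3 x = 0" and e1: "p 1 x * X 1 2 x + p 3 x * X 1 3 x = 0"
    and e2: "p 0 x * Y 0 2 x + p 1 x * Y 1 2 x = 0" and e3: "p 2 x * Y 0 3 x + p 3 x * Y 1 3 x = 0" for x
    using p(3)[of 0 x] p(3)[of 1 x] p(3)[of 2 x] p(3)[of 3 x] by (simp_all only: sum4 pd) simp_all
  \<comment> \<open>Cramer's rule for \<open>p 0\<close>: the kernel equations are combined along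
    the cycle so that the other components cancel.\<close>
  have p0M: "p 0 x * M x = 0" for x
  proof -
    have "p 0 x * M x = (p 0 x * X 0 2 x + p 2 x * X 0 3 x) * Y 0 3 x * Y 1 2 x * X 1 3 x
        - (p 2 x * Y 0 3 x + p 3 x * Y 1 3 x) * X 0 3 x * Y 1 2 x * X 1 3 x
        + (p 1 x * X 1 2 x + p 3 x * X 1 3 x) * Y 1 3 x * X 0 3 x * Y 1 2 x
        - (p 0 x * Y 0 2 x + p 1 x * Y 1 2 x) * X 0 3 x * X 1 2 x * Y 1 3 x"
      unfolding M_def by (simp add: algebra_simps)
    then show ?thesis by (simp only: e0 e1 e2 e3)
  qed
  have "\<forall>x. M x = 0"
  proof (rule ccontr)
    assume M: "\<not> (\<forall>x. M x = 0)"
    then have p0: "\<forall>x. p 0 x = 0" using PF_no_zero_divisors[OF p(1)[of 0] PFM p0M] by auto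
    \<comment> \<open>Each \<open>X i j\<close> is \<open>dx f\<close> and each \<open>Y i j\<close>
      is \<open>dy f\<close> up to renaming coordinates, so the factors of a nonzero term of
      \<open>M\<close> show that these entries do not vanish identically. The other components of
      \<open>p\<close> then vanish one after another.\<close>
    have nz: "\<not> (\<forall>x. X 0 3 x = 0)" "\<not> (\<forall>x. Y 1 2 x = 0)" "\<not> (\<forall>x. X 1 3 x = 0)"
    proof -
      obtain x where x: "M x \<noteq> 0" using M by blast
      obtain a b c e where abc: "a = x 0" "b = x 1" "c = x 2" "e = x 3" by simp
      have "X 0 3 x \<noteq> 0 \<or> X 0 2 x * Y 0 3 x * Y 1 2 x * X 1 3 x \<noteq> 0"
        "Y 1 2 x \<noteq> 0 \<or> Y 0 2 x * X 0 3 x * X 1 2 x * Y 1 3 x \<noteq> 0"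
        "X 1 3 x \<noteq> 0 \<or> Y 0 2 x * X 0 3 x * X 1 2 x * Y 1 3 x \<noteq> 0"
        using x unfolding M_def by auto
      moreover have "X 0 3 (vec4 (a, b, e, c)) = X 0 2 x" "X 1 3 (vec4 (b, a, c, e)) = X 0 3 x"
        "Y 1 2 (vec4 (b, a, c, e)) = Y 0 2 x"
        unfolding X_def Y_def abc by simp_all
      ultimately show "\<not> (\<forall>x. X 0 3 x = 0)" "\<not> (\<forall>x. Y 1 2 x = 0)" "\<not> (\<forall>x. X 1 3 x = 0)"
        by (metis mult_zero_left mult_zero_right)+
    qed
    have "p 2 x * X 0 3 x = 0" "p 1 x * Y 1 2 x = 0" for x using e0[of x] e2[of x] p0 by auto
    then have p12: "\<forall>x. p 2 x = 0" "\<forall>x. p 1 x = 0"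
      using PF_no_zero_divisors[OF p(1)[of 2] PFX(1)[of 0 3]] PF_no_zero_divisors[OF p(1)[of 1] PFX(2)[of 1 2]] nz by auto
    then have "p 3 x * X 1 3 x = 0" for x using e1[of x] by auto
    then have "\<forall>x. p 3 x = 0" using PF_no_zero_divisors[OF p(1)[of 3] PFX(1)[of 1 3]] nz by auto
    moreover have "i = 0 \<or> i = 1 \<or> i = 2 \<or> i = 3" if "i < 4" for i :: nat using that by auto
    ultimately show False using p(2) p0 p12 by metis
  qed
  from this[rule_format, of "vec4 (u, v, y, z)"] show ?thesis unfolding M_def X_def Y_def by simp
qed

section \<open>Rank deficiency from many hits\<close>

lemma card_near_fibre: "finite X \<Longrightarrow> s > 0 \<Longrightarrow> u \<in> X \<Longrightarrow> card {v. (u, v) \<in> near X s} \<le> s"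
  using card_block[of X s "block X s u"] unfolding near_def by (simp add: eq_commute)

lemma card_near_pairs:
  assumes "finite A" "v > 0" "finite B" "w > 0"
  defines "V \<equiv> (\<lambda>((a, b), c, e). (a, b, c, e)) ` (near A v \<times> near B w)"
  shows "finite V" "card V \<le> (v * card A) * (w * card B)"
proof -
  note n = card_near[OF assms(1,2)] card_near[OF assms(3,4)]
  show "finite V" unfolding V_def using n by simp
  have "card V \<le> card (near A v \<times> near B w)" unfolding V_def using n by (intro card_image_le) simp
  also have "\<dots> \<le> (v * card A) * (w * card B)" unfolding card_cartesian_product using n by (intro mult_le_mono) auto
  finally show "card V \<le> (v * card A) * (w * card B)" .
qed

text \<open>The number \<open>T\<close> of collisions is bounded below through
  \<open>proximity\<close>, with parameters in Y x Z, and above through generic finiteness.\<close>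

lemma hits_bound_ternary:
  assumes f: "polyfun3 d f" and nd: "\<not> rank_deficient 4 4 (\<theta>3 f)"
    and X: "finite X" "s > 0" and D: "finite D" "w > 0" and YZ: "finite Y" "finite Z"
    and N: "N = (4 * (3 * d + 1) + 1) ^ 4"
  shows "\<exists>T. (card {(x, y, z). x \<in> X \<and> y \<in> Y \<and> z \<in> Z \<and> f x y z \<in> D})\<^sup>2
        \<le> card Y * card Z * (card X div s + 2 * (d * (card D div w)) + 2) * T
      \<and> T \<le> N ^ 4 * ((s * card X) * (w * card D))
         + 16 * N * (3 * d + 1) * (card X * card Y * card Z + s * (card X * card Y + card X * card Z + card Y * card Z))"
proof -
  let ?G = "\<lambda>x. f (x 0) (x 1) (x 2)"
  have G: "mpf 3 d ?G" "PF 3 ?G" using f unfolding polyfun3_def PF_def by auto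
  define g where "g = (\<lambda>(y, z). slice 0 ?G (vec3 0 y z))"
  have poly_g: "poly (g p) x = f x (fst p) (snd p)" for p x
    unfolding g_def using poly_slice[OF G(2), of 0 _ x] by (cases p) (simp add: vec3_def)
  have deg_g: "degree (g p) \<le> d" for p
    unfolding g_def using degree_slice[OF G(1)] by (cases p) simp
  define T where "T = {(u, v, y, z). (u, v) \<in> near X s \<and> y \<in> Y \<and> z \<in> Z \<and> (f u y z, f v y z) \<in> near D w}"
  have H: "{(x, p). x \<in> X \<and> p \<in> Y \<times> Z \<and> poly (g p) x \<in> D} = {(x, y, z). x \<in> X \<and> y \<in> Y \<and> z \<in> Z \<and> f x y z \<in> D}"
    by (auto simp: poly_g)
  have T: "{(u, v, p). (u, v) \<in> near X s \<and> p \<in> Y \<times> Z \<and> (poly (g p) u, poly (g p) v) \<in> near D w} = T"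
    unfolding T_def by (auto simp: poly_g)
  have "(card {(x, y, z). x \<in> X \<and> y \<in> Y \<and> z \<in> Z \<and> f x y z \<in> D})\<^sup>2
      \<le> card Y * card Z * (card X div s + 2 * (d * (card D div w)) + 2) * card T"
    using proximity[OF X D, of "Y \<times> Z" g d] YZ deg_g unfolding H T by (simp only: card_cartesian_product finite_cartesian_product)
  moreover have "card T \<le> N ^ 4 * ((s * card X) * (w * card D))
       + 16 * N * (3 * d + 1) * (card X * card Y * card Z + s * (card X * card Y + card X * card Z + card Y * card Z))"
  proof -
    define V where "V = (\<lambda>((u, v), a, b). (u, v, a, b)) ` (near X s \<times> near D w)"
    note V = card_near_pairs[OF X D, folded V_def]
    have "card T \<le> N ^ 4 * card V
       + 16 * N * (3 * d + 1) * (card X * card Y * card Z + s * (card X * card Y + card X * card Z + card Y * card Z))"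
    proof (rule card_generic_fibres[OF mpf_\<theta>3[OF f] nd N X(1) YZ])
      show "near X s \<subseteq> X \<times> X" unfolding near_def by auto
      show "card {v. (u, v) \<in> near X s} \<le> s" if "u \<in> X" for u using card_near_fibre[OF X that] .
      show "T \<subseteq> {(u, v, y, z). (u, v) \<in> near X s \<and> y \<in> Y \<and> z \<in> Z}" unfolding T_def by auto
      show "(\<theta>3 f 0 (vec4 q), \<theta>3 f 1 (vec4 q), \<theta>3 f 2 (vec4 q), \<theta>3 f 3 (vec4 q)) \<in> V" if "q \<in> T" for q
        using that unfolding T_def V_def \<theta>3_def by (force simp: image_iff)
    qed (use V in simp)
    also have "N ^ 4 * card V \<le> N ^ 4 * ((s * card X) * (w * card D))" by (intro mult_le_mono2 V)
    finally show ?thesis by simp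
  qed
  ultimately show ?thesis by blast
qed

text \<open>\<open>proximity\<close> only yields collisions (u, v, y). A further Cauchy-Schwarz over
  the near pairs (u, v) doubles them to (u, v, y, z), the rectangles that \<open>\<theta>2\<close>
  needs.\<close>

lemma hits_bound_binary:
  assumes f: "polyfun3 d f" and nd: "\<not> rank_deficient 4 4 (\<theta>2 f)"
    and X: "finite X" "s > 0" and D: "finite D" "w > 0" and Y: "finite Y"
    and N: "N = (4 * (3 * d + 1) + 1) ^ 4"
  shows "\<exists>S T. (card {(x, y). x \<in> X \<and> y \<in> Y \<and> f x y 0 \<in> D})\<^sup>2
        \<le> card Y * (card X div s + 2 * (d * (card D div w)) + 2) * S
      \<and> S\<^sup>2 \<le> (s * card X) * T
      \<and> T \<le> N ^ 4 * ((w * card D) * (w * card D))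
         + 16 * N * (3 * d + 1) * (card X * card Y * card Y + s * (card X * card Y + card X * card Y + card Y * card Y))"
proof -
  let ?G = "\<lambda>x. f (x 0) (x 1) (x 2)"
  have G: "mpf 3 d ?G" "PF 3 ?G" using f unfolding polyfun3_def PF_def by auto
  define g where "g = (\<lambda>y. slice 0 ?G (vec3 0 y 0))"
  have poly_g: "poly (g y) x = f x y 0" for y x
    unfolding g_def using poly_slice[OF G(2), of 0 _ x] by (simp add: vec3_def)
  have deg_g: "degree (g p) \<le> d" for p
    unfolding g_def using degree_slice[OF G(1)] by simp
  define K where "K = (\<lambda>(u, v). {y \<in> Y. (f u y 0, f v y 0) \<in> near D w})"
  have finK: "finite (K p)" for p unfolding K_def using Y by (cases p) simp
  have nears: "finite (near X s)" "card (near X s) \<le> s * card X" "finite (near D w)" "card (near D w) \<le> w * card D"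
    using card_near[OF X] card_near[OF D] by auto
  define T where "T = {(u, v, y, z). (u, v) \<in> near X s \<and> y \<in> K (u, v) \<and> z \<in> K (u, v)}"
  define S where "S = {(u, v, y). (u, v) \<in> near X s \<and> y \<in> Y \<and> (poly (g y) u, poly (g y) v) \<in> near D w}"
  have "(card {(x, y). x \<in> X \<and> y \<in> Y \<and> f x y 0 \<in> D})\<^sup>2
      \<le> card Y * (card X div s + 2 * (d * (card D div w)) + 2) * card S"
    using proximity[OF X D Y, of g d] deg_g unfolding S_def by (simp only: poly_g)
  moreover have "(card S)\<^sup>2 \<le> (s * card X) * card T"
  proof -
    have "card S = card (SIGMA p:near X s. K p)"
      by (rule bij_betw_same_card[of "\<lambda>(u, v, y). ((u, v), y)"])
         (auto simp: bij_betw_def inj_on_def S_def K_def image_iff poly_g)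
    also have "\<dots> = (\<Sum>p\<in>near X s. card (K p))" using nears finK by simp
    finally have S: "card S = (\<Sum>p\<in>near X s. card (K p))" .
    have "card T = card (SIGMA p:near X s. K p \<times> K p)"
      by (rule bij_betw_same_card[of "\<lambda>(u, v, y, z). ((u, v), (y, z))"])
         (auto simp: bij_betw_def inj_on_def T_def image_iff)
    also have "\<dots> = (\<Sum>p\<in>near X s. (card (K p))\<^sup>2)"
      using nears finK by (simp add: card_cartesian_product power2_eq_square)
    finally have "(card S)\<^sup>2 \<le> card (near X s) * card T" unfolding S using sum_squared_le_card by metis
    also have "\<dots> \<le> (s * card X) * card T" by (intro mult_le_mono1 nears)
    finally show ?thesis .
  qed
  moreover have "card T \<le> N ^ 4 * ((w * card D) * (w * card D))
       + 16 * N * (3 * d + 1) * (card X * card Y * card Y + s * (card X * card Y + card X * card Y + card Y * card Y))"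
  proof -
    define V where "V = (\<lambda>((u, v), a, b). (u, v, a, b)) ` (near D w \<times> near D w)"
    note V = card_near_pairs[OF D D, folded V_def]
    have "card T \<le> N ^ 4 * card V
       + 16 * N * (3 * d + 1) * (card X * card Y * card Y + s * (card X * card Y + card X * card Y + card Y * card Y))"
    proof (rule card_generic_fibres[OF mpf_\<theta>2[OF f] nd N X(1) Y Y])
      show "near X s \<subseteq> X \<times> X" unfolding near_def by auto
      show "card {v. (u, v) \<in> near X s} \<le> s" if "u \<in> X" for u using card_near_fibre[OF X that] .
      show "T \<subseteq> {(u, v, y, z). (u, v) \<in> near X s \<and> y \<in> Y \<and> z \<in> Y}" unfolding T_def K_def by auto
      show "(\<theta>2 f 0 (vec4 q), \<theta>2 f 1 (vec4 q), \<theta>2 f 2 (vec4 q), \<theta>2 f 3 (vec4 q)) \<in> V" if "q \<in> T" for q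
        using that unfolding T_def V_def \<theta>2_def K_def by (force simp: image_iff)
    qed (use V in simp)
    also have "N ^ 4 * card V \<le> N ^ 4 * ((w * card D) * (w * card D))" by (intro mult_le_mono2 V)
    finally show ?thesis by simp
  qed
  ultimately show ?thesis by blast
qed

text \<open>Rounding m / t up keeps the number of complete blocks at most \<open>t\<close>, and
  because \<open>m\<close> is at least \<open>t\<close> it costs no more than a factor 2.\<close>

lemma block_size_bounds:
  fixes t :: real
  assumes "t \<ge> 1" "real m \<ge> t"
  defines "s \<equiv> nat \<lceil>real m / t\<rceil>"
  shows "s > 0" "real s * t \<le> 2 * real m" "real (m div s) \<le> t"
proof -
  have pos: "real m / t > 0" using assms by simp
  then show s: "s > 0" unfolding s_def by simp
  have le: "real m / t \<le> real s" unfolding s_def by (simp add: real_nat_ceiling_ge)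
  have "real s \<le> real m / t + 1" unfolding s_def using pos by (simp add: of_nat_nat)
  also have "\<dots> \<le> 2 * (real m / t)" using assms by (simp add: field_simps)
  finally show "real s * t \<le> 2 * real m" using assms(1) by (simp add: pos_le_divide_eq)
  have "real (m div s) * real s \<le> real m" by (simp flip: of_nat_mult)
  also have "\<dots> \<le> t * real s" using le assms(1) by (simp add: pos_divide_le_eq mult.commute)
  finally show "real (m div s) \<le> t" using s by simp
qed

lemma cells_bound:
  fixes t :: real
  assumes "t \<ge> 1" "real a \<le> t" "real b \<le> t"
  shows "real (a + 2 * (d * b) + 2) \<le> (2 * real d + 3) * t"
proof -
  have "real d * real b \<le> real d * t" by (intro mult_left_mono assms) simp
  then show ?thesis using assms by (simp add: algebra_simps)
qed

text \<open>In the next two lemmas \<open>q = n powr (-1/12)\<close>, \<open>t = n powr (3/4)\<close>; the assumptions on \<open>q\<close> are all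
  consequences of \<open>x, y, z \<ge> n powr (5/6)\<close>.\<close>

lemma ternary_arith:
  fixes x y z n t q s w c E K M W T h :: real
  assumes pos: "x > 0" "y > 0" "z > 0" "n \<ge> 0" "t > 0" "q > 0" "s \<ge> 0" "w \<ge> 0" "K \<ge> 0" "M \<ge> 0" "T \<ge> 0" "c > 0" "E > 0"
    and q: "t \<le> q * x" "1 \<le> q * x" "1 \<le> q * y" "1 \<le> q * z" "n ^ 2 \<le> q * t * y * z"
    and s: "s * t \<le> 2 * x" and w: "w * t \<le> 2 * n" and W: "W \<le> E * t"
    and h: "c * x * y * z \<le> h" "h\<^sup>2 \<le> y * z * W * T"
    and T: "T \<le> K * ((s * x) * (w * n)) + M * (x * y * z + s * (x * y + x * z + y * z))"
  shows "c\<^sup>2 \<le> E * (4 * K + 7 * M) * q"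
proof -
  have wn: "w * n \<le> 2 * (q * y * z)"
  proof -
    have "(w * n) * t = (w * t) * n" by simp
    also have "\<dots> \<le> (2 * n) * n" by (intro mult_right_mono w pos)
    also have "\<dots> \<le> (2 * (q * y * z)) * t" using q(5) by (simp add: power2_eq_square mult_ac)
    finally show ?thesis using pos(5) by simp
  qed
  have xyz: "x * y * z * t \<le> (x * y * z) * (q * x)" by (intro mult_left_mono q) (use pos in simp)
  have 1: "x * (x * y) \<le> x * (x * y) * (q * z)" "x * (x * z) \<le> x * (x * z) * (q * y)" "x * (y * z) \<le> x * (y * z) * (q * x)"
    using mult_left_mono[OF q(4), of "x * (x * y)"] mult_left_mono[OF q(3), of "x * (x * z)"]
      mult_left_mono[OF q(2), of "x * (y * z)"] pos by simp_all
  \<comment> \<open>4 = 2 * 2, from rounding up both block sizes.\<close>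
  have K: "(s * x) * (w * n) * t \<le> 4 * (x\<^sup>2 * y * z * q)"
  proof -
    have "(s * x) * (w * n) * t = (s * t) * (x * (w * n))" by simp
    also have "\<dots> \<le> (2 * x) * (x * (w * n))" using pos by (intro mult_right_mono s) auto
    also have "\<dots> \<le> (2 * x) * (x * (2 * (q * y * z)))" using pos by (intro mult_left_mono wn) auto
    finally show ?thesis by (simp add: power2_eq_square mult_ac)
  qed
  \<comment> \<open>7 = 1 + 2 * 3: the full product once, each of the three mixed terms twice
    through \<open>s * t \<le> 2 * x\<close>.\<close>
  have M: "(x * y * z + s * (x * y + x * z + y * z)) * t \<le> 7 * (x\<^sup>2 * y * z * q)"
  proof -
    have "(x * y * z + s * (x * y + x * z + y * z)) * t = x * y * z * t + (s * t) * (x * y + x * z + y * z)"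
      by (simp add: algebra_simps)
    also have "\<dots> \<le> x * y * z * t + (2 * x) * (x * y + x * z + y * z)"
      using pos by (intro add_left_mono mult_right_mono s) auto
    also have "\<dots> \<le> 7 * (x\<^sup>2 * y * z * q)"
      using xyz 1 by (simp add: algebra_simps power2_eq_square)
    finally show ?thesis .
  qed
  have "T * t \<le> (K * ((s * x) * (w * n)) + M * (x * y * z + s * (x * y + x * z + y * z))) * t"
    using pos by (intro mult_right_mono T) simp
  also have "\<dots> = K * ((s * x) * (w * n) * t) + M * ((x * y * z + s * (x * y + x * z + y * z)) * t)"
    by (simp add: algebra_simps)
  also have "\<dots> \<le> K * (4 * (x\<^sup>2 * y * z * q)) + M * (7 * (x\<^sup>2 * y * z * q))"
    using pos by (intro add_mono mult_left_mono K M) auto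
  finally have Tt: "T * t \<le> (4 * K + 7 * M) * q * (x\<^sup>2 * y * z)" by (simp add: algebra_simps)
  have "(c * x * y * z)\<^sup>2 \<le> h\<^sup>2" using pos by (intro power_mono h) auto
  also have "\<dots> \<le> y * z * W * T" by (rule h)
  also have "\<dots> \<le> y * z * (E * t) * T" using pos by (intro mult_right_mono mult_left_mono W) auto
  also have "\<dots> = y * z * E * (T * t)" by simp
  also have "\<dots> \<le> y * z * E * ((4 * K + 7 * M) * q * (x\<^sup>2 * y * z))" using pos by (intro mult_left_mono Tt) auto
  finally have "c\<^sup>2 * (x\<^sup>2 * y\<^sup>2 * z\<^sup>2) \<le> (E * (4 * K + 7 * M) * q) * (x\<^sup>2 * y\<^sup>2 * z\<^sup>2)"
    by (simp add: power_mult_distrib power2_eq_square mult_ac)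
  then show ?thesis using pos by simp
qed

lemma binary_arith:
  fixes x y n t q s w c E K M W S T h :: real
  assumes pos: "x > 0" "y > 0" "n \<ge> 0" "t > 0" "q > 0" "s \<ge> 0" "w \<ge> 0" "K \<ge> 0" "M \<ge> 0" "T \<ge> 0" "S \<ge> 0" "c > 0" "E > 0"
    and q: "t \<le> q * x" "1 \<le> q * x" "1 \<le> q * y" "n ^ 4 \<le> q * t * x\<^sup>2 * y\<^sup>2"
    and s: "s * t \<le> 2 * x" and w: "w * t \<le> 2 * n" and W: "W \<le> E * t"
    and h: "c * x * y \<le> h" "h\<^sup>2 \<le> y * W * S" and S: "S\<^sup>2 \<le> (s * x) * T"
    and T: "T \<le> K * ((w * n) * (w * n)) + M * (x * y * y + s * (x * y + x * y + y * y))"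
  shows "c ^ 4 \<le> 2 * E\<^sup>2 * (4 * K + 7 * M) * q"
proof -
  have wn: "(w * n) * (w * n) * t \<le> 4 * (q * x\<^sup>2 * y\<^sup>2)"
  proof -
    have "((w * n) * (w * n) * t) * t = (w * t) * (w * t) * n\<^sup>2" by (simp add: power2_eq_square)
    also have "\<dots> \<le> (2 * n) * (2 * n) * n\<^sup>2" using pos by (intro mult_right_mono mult_mono w) auto
    also have "\<dots> \<le> (4 * (q * x\<^sup>2 * y\<^sup>2)) * t" using q(4) by (simp add: power2_eq_square numeral_eq_Suc mult_ac)
    finally show ?thesis using pos(4) by simp
  qed
  have xyz: "x * y * y * t \<le> (x * y * y) * (q * x)" by (intro mult_left_mono q) (use pos in simp)
  have 1: "x * (x * y) \<le> x * (x * y) * (q * y)" "x * (y * y) \<le> x * (y * y) * (q * x)"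
    using mult_left_mono[OF q(3), of "x * (x * y)"] mult_left_mono[OF q(2), of "x * (y * y)"] pos by simp_all
  have M: "(x * y * y + s * (x * y + x * y + y * y)) * t \<le> 7 * (q * x\<^sup>2 * y\<^sup>2)"
  proof -
    have "(x * y * y + s * (x * y + x * y + y * y)) * t = x * y * y * t + (s * t) * (x * y + x * y + y * y)"
      by (simp add: algebra_simps)
    also have "\<dots> \<le> x * y * y * t + (2 * x) * (x * y + x * y + y * y)"
      using pos by (intro add_left_mono mult_right_mono s) auto
    also have "\<dots> \<le> 7 * (q * x\<^sup>2 * y\<^sup>2)"
      using xyz 1 by (simp add: algebra_simps power2_eq_square)
    finally show ?thesis .
  qed
  have "T * t \<le> (K * ((w * n) * (w * n)) + M * (x * y * y + s * (x * y + x * y + y * y))) * t"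
    using pos by (intro mult_right_mono T) simp
  also have "\<dots> = K * ((w * n) * (w * n) * t) + M * ((x * y * y + s * (x * y + x * y + y * y)) * t)"
    by (simp add: algebra_simps)
  also have "\<dots> \<le> K * (4 * (q * x\<^sup>2 * y\<^sup>2)) + M * (7 * (q * x\<^sup>2 * y\<^sup>2))"
    using pos by (intro add_mono mult_left_mono wn M) auto
  finally have Tt: "T * t \<le> (4 * K + 7 * M) * q * (x\<^sup>2 * y\<^sup>2)" by (simp add: algebra_simps)
  have St: "S\<^sup>2 * t\<^sup>2 \<le> 2 * x\<^sup>2 * ((4 * K + 7 * M) * q * (x\<^sup>2 * y\<^sup>2))"
  proof -
    have "S\<^sup>2 * t\<^sup>2 \<le> ((s * x) * T) * t\<^sup>2" by (intro mult_right_mono S) simp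
    also have "\<dots> = (s * t) * (x * (T * t))" by (simp add: power2_eq_square)
    also have "\<dots> \<le> (2 * x) * (x * (T * t))" using pos by (intro mult_right_mono s) auto
    also have "\<dots> \<le> (2 * x) * (x * ((4 * K + 7 * M) * q * (x\<^sup>2 * y\<^sup>2)))" using pos by (intro mult_left_mono Tt) auto
    finally show ?thesis by (simp add: power2_eq_square mult_ac)
  qed
  have "(c * x * y)\<^sup>2 \<le> h\<^sup>2" using pos by (intro power_mono h) auto
  also have "\<dots> \<le> y * W * S" by (rule h)
  also have "\<dots> \<le> y * (E * t) * S" using pos by (intro mult_right_mono mult_left_mono W) auto
  \<comment> \<open>Squared once more because \<open>S\<close> is controlled only through
    \<open>S\<^sup>2\<close>; this is why the conclusion has \<open>c ^ 4\<close>.\<close>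
  finally have "((c * x * y)\<^sup>2)\<^sup>2 \<le> (y * (E * t) * S)\<^sup>2" by (intro power_mono) auto
  also have "\<dots> = y\<^sup>2 * E\<^sup>2 * (S\<^sup>2 * t\<^sup>2)" by (simp add: power_mult_distrib)
  also have "\<dots> \<le> y\<^sup>2 * E\<^sup>2 * (2 * x\<^sup>2 * ((4 * K + 7 * M) * q * (x\<^sup>2 * y\<^sup>2)))" by (intro mult_left_mono St) auto
  finally have "c ^ 4 * (x ^ 4 * y ^ 4) \<le> (2 * E\<^sup>2 * (4 * K + 7 * M) * q) * (x ^ 4 * y ^ 4)"
    by (simp add: power_mult_distrib power2_eq_square numeral_eq_Suc mult_ac)
  then show ?thesis using pos by simp
qed

text \<open>\<open>t \<le> q * x\<close> and
  \<open>n ^ 4 \<le> q * t * x\<^sup>2 * y\<^sup>2\<close> are equalities at x = y = n^(5/6), which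
  pins down 3/4 and 1/12. The ternary inequality \<open>n ^ 2 \<le> q * t * y * z\<close> has a
  factor n^(1/3) to spare.\<close>

lemma exponents:
  fixes n x y z :: real
  assumes n: "n \<ge> 1" and xyz: "x \<ge> n powr (5/6)" "y \<ge> n powr (5/6)" "z \<ge> n powr (5/6)"
  defines "t \<equiv> n powr (3/4)" and "q \<equiv> n powr (-1/12)"
  shows "1 \<le> t" "0 < q" "t \<le> x" "t \<le> n" "0 < x" "t \<le> q * x" "1 \<le> q * x" "n ^ 2 \<le> q * t * y * z" "n ^ 4 \<le> q * t * x\<^sup>2 * y\<^sup>2"
proof -
  show "1 \<le> t" unfolding t_def using n by (simp add: ge_one_powr_ge_zero)
  show "0 < q" unfolding q_def using n by simp
  have "t \<le> n powr (5/6)" unfolding t_def using n by (intro powr_mono) auto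
  then show "t \<le> x" using xyz by simp
  show "t \<le> n" unfolding t_def using powr_mono[of "3/4" 1 n] n by simp
  show "0 < x" using xyz(1) n by (smt (verit) powr_gt_zero)
  have "q * n powr (5/6) = t" unfolding q_def t_def by (simp flip: powr_add)
  moreover have "q * n powr (5/6) \<le> q * x" using \<open>0 < q\<close> xyz by (intro mult_left_mono) auto
  ultimately show "t \<le> q * x" by simp
  with \<open>1 \<le> t\<close> show "1 \<le> q * x" by simp
  have "n ^ 2 = n powr 2" using n by (simp add: powr_realpow)
  also have "\<dots> \<le> n powr (7/3)" using n by (intro powr_mono) auto
  also have "\<dots> = q * t * (n powr (5/6) * n powr (5/6))" unfolding q_def t_def by (simp flip: powr_add)
  also have "\<dots> \<le> q * t * (y * z)" using \<open>0 < q\<close> \<open>1 \<le> t\<close> xyz order_trans[OF powr_ge_zero xyz(2)]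
    by (intro mult_left_mono mult_mono) auto
  finally show "n ^ 2 \<le> q * t * y * z" by (simp add: mult.assoc)
  have "n ^ 4 = n powr 4" using n by (simp add: powr_realpow)
  also have "\<dots> = q * t * ((n powr (5/6))\<^sup>2 * (n powr (5/6))\<^sup>2)" unfolding q_def t_def
    by (simp add: power2_eq_square flip: powr_add)
  also have "\<dots> \<le> q * t * (x\<^sup>2 * y\<^sup>2)" using \<open>0 < q\<close> \<open>1 \<le> t\<close> xyz
    by (intro mult_left_mono mult_mono power_mono) auto
  finally show "n ^ 4 \<le> q * t * x\<^sup>2 * y\<^sup>2" by (simp add: mult.assoc)
qed

text \<open>A form of the hypothesis with no distinguished variable among the three, so that the
  collision argument can be run in each of them.\<close>

definition many_hits :: "real \<Rightarrow> nat \<Rightarrow> (real \<Rightarrow> real \<Rightarrow> real \<Rightarrow> real) \<Rightarrow> real set \<Rightarrow> real set \<Rightarrow> real set \<Rightarrow> real set \<Rightarrow> bool" where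
  "many_hits c n f X Y Z D \<longleftrightarrow> finite X \<and> finite Y \<and> finite Z \<and> finite D \<and> card D = n \<and>
     real n powr (5/6) \<le> card X \<and> real n powr (5/6) \<le> card Y \<and> real n powr (5/6) \<le> card Z \<and>
     c * card X * card Y * card Z \<le> real (card {(x, y, z). x \<in> X \<and> y \<in> Y \<and> z \<in> Z \<and> f x y z \<in> D})"

lemma ternary_rank_deficient:
  assumes c: "c > 0"
  shows "\<exists>n0. \<forall>f n X Y Z D. polyfun3 d f \<and> n > n0 \<and> many_hits c n f X Y Z D \<longrightarrow> rank_deficient 4 4 (\<theta>3 f)"
proof -
  define N where "N = (4 * (3 * d + 1) + 1) ^ 4"
  define K where "K = real (N ^ 4)" define M where "M = real (16 * N * (3 * d + 1))"
  define E where "E = 2 * real d + 3"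
  \<comment> \<open>As \<open>q\<close> is n^(-1/12), the 12th power makes
    \<open>E * (4 * K + 7 * M) * q\<close> smaller than \<open>c\<^sup>2\<close> for all larger
    \<open>n\<close>.\<close>
  define n0 where "n0 = nat \<lceil>(E * (4 * K + 7 * M) / c\<^sup>2) powr 12\<rceil> + 1"
  have KM: "E > 0" "K > 0" "M \<ge> 0" unfolding E_def K_def M_def N_def by simp_all
  show ?thesis
  proof (intro exI[of _ n0] allI impI, elim conjE, rule ccontr)
    fix f n and X Y Z D :: "real set"
    assume f: "polyfun3 d f" and n: "n > n0" and hits: "many_hits c n f X Y Z D" and nd: "\<not> rank_deficient 4 4 (\<theta>3 f)"
    have fin: "finite X" "finite Y" "finite Z" "finite D" and D: "card D = n"
      and xyz: "real n powr (5/6) \<le> card X" "real n powr (5/6) \<le> card Y" "real n powr (5/6) \<le> card Z"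
      using hits unfolding many_hits_def by blast+
    have n1: "real n \<ge> 1" using n unfolding n0_def by simp
    define t where "t = real n powr (3/4)"
    define q where "q = real n powr (-1/12)"
    note e1 = exponents[OF n1 xyz, folded t_def q_def]
    note e2 = exponents[OF n1 xyz(2,3,1), folded t_def q_def]
    note e3 = exponents[OF n1 xyz(3,1,2), folded t_def q_def]
    define s where "s = nat \<lceil>real (card X) / t\<rceil>"
    define w where "w = nat \<lceil>real (card D) / t\<rceil>"
    note s = block_size_bounds[OF e1(1) e1(3), folded s_def]
    have "t \<le> real (card D)" using e1(4) D by simp
    note w = block_size_bounds[OF e1(1) this, folded w_def]
    obtain T where T: "(card {(x, y, z). x \<in> X \<and> y \<in> Y \<and> z \<in> Z \<and> f x y z \<in> D})\<^sup>2
        \<le> card Y * card Z * (card X div s + 2 * (d * (card D div w)) + 2) * T"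
      "T \<le> N ^ 4 * ((s * card X) * (w * card D))
         + 16 * N * (3 * d + 1) * (card X * card Y * card Z + s * (card X * card Y + card X * card Z + card Y * card Z))"
      using hits_bound_ternary[OF f nd fin(1) s(1) fin(4) w(1) fin(2,3) N_def] by blast
    have "c\<^sup>2 \<le> E * (4 * K + 7 * M) * q"
    proof (rule ternary_arith)
      show "real s * t \<le> 2 * real (card X)" "real w * t \<le> 2 * real n" using s(2) w(2) D by simp_all
      show "real (card X div s + 2 * (d * (card D div w)) + 2) \<le> E * t"
        unfolding E_def by (rule cells_bound[OF e1(1) s(3) w(3)])
      show "c * card X * card Y * card Z \<le> real (card {(x, y, z). x \<in> X \<and> y \<in> Y \<and> z \<in> Z \<and> f x y z \<in> D})"
        using hits unfolding many_hits_def by blast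
      show "(real (card {(x, y, z). x \<in> X \<and> y \<in> Y \<and> z \<in> Z \<and> f x y z \<in> D}))\<^sup>2
        \<le> real (card Y) * real (card Z) * real (card X div s + 2 * (d * (card D div w)) + 2) * real T"
        using of_nat_mono[OF T(1), where ?'a = real] by (simp only: of_nat_mult of_nat_power)
      show "real T \<le> K * ((real s * real (card X)) * (real w * real n))
         + M * (real (card X) * real (card Y) * real (card Z)
            + real s * (real (card X) * real (card Y) + real (card X) * real (card Z) + real (card Y) * real (card Z)))"
        using of_nat_mono[OF T(2), where ?'a = real] unfolding K_def M_def D by (simp only: of_nat_mult of_nat_add)
    qed (use e1 e2 e3 KM c in simp_all)
    note qc = this
    have P: "E * (4 * K + 7 * M) / c\<^sup>2 > 0" using KM c by simp
    have "(E * (4 * K + 7 * M) / c\<^sup>2) powr 12 < real n" using n unfolding n0_def by linarith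
    then have "((E * (4 * K + 7 * M) / c\<^sup>2) powr 12) powr (1/12) < real n powr (1/12)"
      by (intro powr_less_mono2) auto
    then have "E * (4 * K + 7 * M) / c\<^sup>2 < real n powr (1/12)"
      using P KM unfolding powr_powr by (simp add: abs_mult)
    then have "E * (4 * K + 7 * M) / c\<^sup>2 * q < real n powr (1/12) * q" using e1(2) by (rule mult_strict_right_mono)
    also have "\<dots> = 1" unfolding q_def using n1 by (simp flip: powr_add)
    finally have "E * (4 * K + 7 * M) * q / c\<^sup>2 < 1" by simp
    then have "E * (4 * K + 7 * M) * q < c\<^sup>2" using c by (subst (asm) pos_divide_less_eq) auto
    with qc show False by linarith
  qed
qed

lemma binary_rank_deficient:
  assumes c: "c > 0"
  shows "\<exists>n0. \<forall>f n X Y Z D. polyfun3 d f \<and> n > n0 \<and> many_hits c n f X Y Z D \<and> (\<forall>x y z. f x y z = f x y 0)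
      \<longrightarrow> rank_deficient 4 4 (\<theta>2 f)"
proof -
  define N where "N = (4 * (3 * d + 1) + 1) ^ 4"
  define K where "K = real (N ^ 4)" define M where "M = real (16 * N * (3 * d + 1))"
  define E where "E = 2 * real d + 3"
  define L where "L = 2 * E\<^sup>2 * (4 * K + 7 * M)"
  define n0 where "n0 = nat \<lceil>(L / c ^ 4) powr 12\<rceil> + 1"
  have KM: "E > 0" "K > 0" "M \<ge> 0" unfolding E_def K_def M_def N_def by simp_all
  then have L: "L > 0" unfolding L_def by simp
  show ?thesis
  proof (intro exI[of _ n0] allI impI, elim conjE, rule ccontr)
    fix f n and X Y Z D :: "real set"
    assume f: "polyfun3 d f" and n: "n > n0" and mh: "many_hits c n f X Y Z D" and z: "\<forall>x y z. f x y z = f x y 0"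
      and nd: "\<not> rank_deficient 4 4 (\<theta>2 f)"
    have fin: "finite X" "finite Y" "finite D" and D: "card D = n"
      and xy: "real n powr (5/6) \<le> card X" "real n powr (5/6) \<le> card Y"
      using mh unfolding many_hits_def by blast+
    have n1: "real n \<ge> 1" using n unfolding n0_def by simp
    \<comment> \<open>As \<open>f\<close> ignores \<open>z\<close>, the set of hits is a product
      with \<open>Z\<close>, and the size of \<open>Z\<close> cancels.\<close>
    have hits: "c * card X * card Y \<le> real (card {(x, y). x \<in> X \<and> y \<in> Y \<and> f x y 0 \<in> D})"
    proof -
      have "real n powr (5/6) > 0" using n1 by simp
      then have Z: "card Z > 0" using mh unfolding many_hits_def by (metis gr0I leD of_nat_0)
      have "f x y z \<in> D \<longleftrightarrow> f x y 0 \<in> D" for x y z using z by metis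
      then have sets: "{(x, y, z). x \<in> X \<and> y \<in> Y \<and> z \<in> Z \<and> f x y z \<in> D} = {(x, y, z). x \<in> X \<and> y \<in> Y \<and> z \<in> Z \<and> f x y 0 \<in> D}"
        by blast
      have "card {(x, y, z). x \<in> X \<and> y \<in> Y \<and> z \<in> Z \<and> f x y z \<in> D} = card ({(x, y). x \<in> X \<and> y \<in> Y \<and> f x y 0 \<in> D} \<times> Z)"
        unfolding sets
        by (rule bij_betw_same_card[of "\<lambda>(x, y, z). ((x, y), z)"]) (auto simp: bij_betw_def inj_on_def image_iff)
      then show ?thesis using mh Z unfolding many_hits_def by (simp add: card_cartesian_product)
    qed
    define t where "t = real n powr (3/4)"
    define q where "q = real n powr (-1/12)"
    note e1 = exponents[OF n1 xy(1,2,1), folded t_def q_def]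
    note e2 = exponents[OF n1 xy(2,1,2), folded t_def q_def]
    define s where "s = nat \<lceil>real (card X) / t\<rceil>"
    define w where "w = nat \<lceil>real (card D) / t\<rceil>"
    note s = block_size_bounds[OF e1(1) e1(3), folded s_def]
    have "t \<le> real (card D)" using e1(4) D by simp
    note w = block_size_bounds[OF e1(1) this, folded w_def]
    obtain S T where T: "(card {(x, y). x \<in> X \<and> y \<in> Y \<and> f x y 0 \<in> D})\<^sup>2
        \<le> card Y * (card X div s + 2 * (d * (card D div w)) + 2) * S" "S\<^sup>2 \<le> (s * card X) * T"
      "T \<le> N ^ 4 * ((w * card D) * (w * card D))
         + 16 * N * (3 * d + 1) * (card X * card Y * card Y + s * (card X * card Y + card X * card Y + card Y * card Y))"
      using hits_bound_binary[OF f nd fin(1) s(1) fin(3) w(1) fin(2) N_def] by blast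
    have "c ^ 4 \<le> 2 * E\<^sup>2 * (4 * K + 7 * M) * q"
    proof (rule binary_arith)
      show "real s * t \<le> 2 * real (card X)" "real w * t \<le> 2 * real n" using s(2) w(2) D by simp_all
      show "real (card X div s + 2 * (d * (card D div w)) + 2) \<le> E * t"
        unfolding E_def by (rule cells_bound[OF e1(1) s(3) w(3)])
      show "c * card X * card Y \<le> real (card {(x, y). x \<in> X \<and> y \<in> Y \<and> f x y 0 \<in> D})" by (rule hits)
      show "(real (card {(x, y). x \<in> X \<and> y \<in> Y \<and> f x y 0 \<in> D}))\<^sup>2
        \<le> real (card Y) * real (card X div s + 2 * (d * (card D div w)) + 2) * real S"
        using of_nat_mono[OF T(1), where ?'a = real] by (simp only: of_nat_mult of_nat_power)
      show "(real S)\<^sup>2 \<le> (real s * real (card X)) * real T"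
        using of_nat_mono[OF T(2), where ?'a = real] by (simp only: of_nat_mult of_nat_power)
      show "real T \<le> K * ((real w * real n) * (real w * real n))
         + M * (real (card X) * real (card Y) * real (card Y)
            + real s * (real (card X) * real (card Y) + real (card X) * real (card Y) + real (card Y) * real (card Y)))"
        using of_nat_mono[OF T(3), where ?'a = real] unfolding K_def M_def D by (simp only: of_nat_mult of_nat_add)
    qed (use e1 e2 KM c in simp_all)
    then have qc: "c ^ 4 / L \<le> q" using L unfolding L_def by (simp add: pos_divide_le_eq mult.commute)
    have P: "L / c ^ 4 > 0" using L c by simp
    have "(L / c ^ 4) powr 12 < real n" using n unfolding n0_def by linarith
    then have "((L / c ^ 4) powr 12) powr (1/12) < real n powr (1/12)"
      by (intro powr_less_mono2) auto
    then have "L / c ^ 4 < real n powr (1/12)" using P L unfolding powr_powr by simp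
    then have "L / c ^ 4 * q < real n powr (1/12) * q" using e1(2) by (rule mult_strict_right_mono)
    also have "\<dots> = 1" unfolding q_def using n1 by (simp flip: powr_add)
    finally show False using qc L c by (simp add: field_simps)
  qed
qed

section \<open>Partial derivatives and the additive form\<close>

text \<open>Polynomial functions as the ring generated by constants and coordinates, so that
  properties are checked on generators, sums and products.\<close>

lemma PF_induct [consumes 1, case_names const var add mult]:
  assumes "PF k f"
    and const: "\<And>a. P (\<lambda>x. a)" and var: "\<And>j. j < k \<Longrightarrow> P (\<lambda>x. x j)"
    and add: "\<And>f g. PF k f \<Longrightarrow> PF k g \<Longrightarrow> P f \<Longrightarrow> P g \<Longrightarrow> P (\<lambda>x. f x + g x)"
    and mult: "\<And>f g. PF k f \<Longrightarrow> PF k g \<Longrightarrow> P f \<Longrightarrow> P g \<Longrightarrow> P (\<lambda>x. f x * g x)"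
  shows "P f"
proof -
  have pow: "P (\<lambda>x. x j ^ n)" if "j < k" for j n
  proof (induction n)
    case (Suc n)
    show ?case using mult[OF PF_var[OF that] PF_power[OF PF_var[OF that]] var[OF that] Suc] by simp
  qed (simp add: const)
  have prod: "PF k (\<lambda>x. \<Prod>i\<in>I. x i ^ e i) \<and> P (\<lambda>x. \<Prod>i\<in>I. x i ^ e i)"
    if "finite I" "I \<subseteq> {..<k}" for I and e :: "nat \<Rightarrow> nat"
    using that by (induction I rule: finite_induct) (auto intro!: const mult pow PF_mult PF_power PF_var)
  obtain N where "mpf k N f" using assms(1) PF_def by blast
  then show ?thesis
  proof induction
    case (monom e a)
    then show ?case using prod[of "{..<k}" e] by (auto intro!: mult const)
  next
    case (add f g)
    then show ?case using assms(4) PF_def by blast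
  qed
qed

lemma DERIV_pd_self: "PF k f \<Longrightarrow> ((\<lambda>t. f (x(j := t))) has_real_derivative pd j f x) (at (x j))"
  using DERIV_pd[of k f x j "x j"] by simp

lemma pd_const [simp]: "pd j (\<lambda>x. a) = (\<lambda>x. 0)"
  by (rule ext, rule pd_eqI[of 0]) auto

lemma pd_var: "i < k \<Longrightarrow> pd j (\<lambda>x. x i) = (\<lambda>x. if i = j then 1 else 0)"
  by (rule ext, rule pd_eqI[OF PF_var]) auto

lemma pd_add: "PF k f \<Longrightarrow> PF k g \<Longrightarrow> pd j (\<lambda>x. f x + g x) = (\<lambda>x. pd j f x + pd j g x)"
  by (rule ext, rule pd_eqI[OF PF_add]) (auto intro!: derivative_eq_intros DERIV_pd_self)

lemma pd_diff: "PF k f \<Longrightarrow> PF k g \<Longrightarrow> pd j (\<lambda>x. f x - g x) = (\<lambda>x. pd j f x - pd j g x)"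
  by (rule ext, rule pd_eqI[OF PF_diff]) (auto intro!: derivative_eq_intros DERIV_pd_self)

lemma pd_mult: "PF k f \<Longrightarrow> PF k g \<Longrightarrow> pd j (\<lambda>x. f x * g x) = (\<lambda>x. pd j f x * g x + f x * pd j g x)"
  by (rule ext, rule pd_eqI[OF PF_mult]) (auto intro!: derivative_eq_intros DERIV_pd_self)

lemma pd_sum: "(\<And>i. i \<in> I \<Longrightarrow> PF k (f i)) \<Longrightarrow> pd j (\<lambda>x. \<Sum>i\<in>I. f i x) = (\<lambda>x. \<Sum>i\<in>I. pd j (f i) x)"
  by (rule ext, rule pd_eqI[OF PF_sum]) (auto intro!: DERIV_sum DERIV_pd_self simp del: fun_upd_apply)

lemma pd_poly:
  assumes "PF k h"
  shows "pd j (\<lambda>x. poly p (h x)) = (\<lambda>x. poly (pderiv p) (h x) * pd j h x)"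
proof (rule ext, rule pd_eqI[OF PF_poly[OF assms]])
  fix x
  show "((\<lambda>t. poly p (h (x(j := t)))) has_real_derivative poly (pderiv p) (h x) * pd j h x) (at (x j))"
    for x using DERIV_chain2[OF poly_DERIV DERIV_pd_self[OF assms, of x j], of p] by simp
qed

lemma pd_poly_var: "i < k \<Longrightarrow> pd j (\<lambda>x. poly p (x i)) = (\<lambda>x. if i = j then poly (pderiv p) (x i) else 0)"
  by (simp add: pd_poly[OF PF_var] pd_var fun_eq_iff)

lemma pd_commute:
  assumes "PF k f" "i < k" "j < k" shows "pd i (pd j f) = pd j (pd i f)"
  using assms(1)
proof (induction rule: PF_induct)
  case (var l)
  have "pd a (\<lambda>x. if l = b then 1 else 0) = (\<lambda>x. 0)" for a b by (cases "l = b") simp_all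
  then show ?case by (simp add: pd_var[OF var])
next
  case (add f g)
  then show ?case by (simp add: pd_add[of k] PF_pd assms)
next
  case (mult f g)
  then show ?case
    by (simp add: pd_mult[of k] pd_add[of k] PF_pd PF_mult assms fun_eq_iff)
qed simp

lemma pd_eq_0_imp_indep:
  assumes f: "PF k f" and 0: "\<And>x. pd j f x = 0" shows "f (x(j := t)) = f x"
proof -
  have "poly (pderiv (slice j f x)) s = 0" for s
    using 0[of "x(j := s)"] by (simp add: pd_def)
  then have "pderiv (slice j f x) = 0" using poly_all_0_iff_0 by blast
  then obtain c where "slice j f x = [:c:]" by (metis degree_eq_zeroE pderiv_eq_0_iff)
  then show ?thesis using poly_slice[OF f, of j x t] poly_slice_self[OF f, of j x] by simp
qed

lemma pd_all_0_imp_const: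
  assumes f: "PF 3 f" and 0: "\<And>j x. j < 3 \<Longrightarrow> pd j f x = 0" shows "\<exists>c. \<forall>x. f x = c"
proof -
  obtain N where N: "mpf 3 N f" using f PF_def by blast
  have "f x = f (\<lambda>_. 0)" for x
  proof -
    have "f x = f (x(0 := 0, 1 := 0, 2 := 0))"
      using pd_eq_0_imp_indep[OF f 0[of 0]] pd_eq_0_imp_indep[OF f 0[of 1]] pd_eq_0_imp_indep[OF f 0[of 2]] by simp
    also have "\<dots> = f (\<lambda>_. 0)" by (rule mpf_cong[OF N]) (auto simp: less_Suc_eq numeral_eq_Suc)
    finally show ?thesis .
  qed
  then show ?thesis by blast
qed

lemma PF_cancel:
  assumes "PF k u" "PF k f" "PF k g" "\<And>x. u x * f x = u x * g x" "u a \<noteq> 0"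
  shows "f x = g x"
  using PF_no_zero_divisors[OF assms(1) PF_diff[OF assms(2,3)]] assms(4,5) by (auto simp: right_diff_distrib)

lemma poly_nonzero_at: "(p :: real poly) \<noteq> 0 \<Longrightarrow> \<exists>t. poly p t \<noteq> 0"
  using poly_all_0_iff_0 by blast

text \<open>Where \<open>l x \<noteq> 0\<close>, the polynomial \<open>K\<close> divides the slice
  of \<open>f\<close>. The remainder modulo \<open>K\<close> is itself a polynomial function whose
  product with \<open>l\<close> vanishes, so it vanishes also at the zeros of
  \<open>l\<close>.\<close>

lemma PF_divide:
  assumes f: "PF k f" and h: "PF k h" and l: "PF k l" and j: "j < k"
    and indep: "\<And>x t. l (x(j := t)) = l x" and nz: "l a \<noteq> 0"
    and eq: "\<And>x. l x * f x = poly K (x j) * h x"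
  shows "\<exists>G. PF k G \<and> (\<forall>x. f x = poly K (x j) * G x) \<and> (\<forall>x. slice j f x = K * slice j G x)"
proof -
  define R where "R = (\<lambda>x. poly (slice j f x mod K) (x j))"
  define G where "G = (\<lambda>x. poly (slice j f x div K) (x j))"
  have R: "PF k R" unfolding R_def
    by (rule PF_linear_slice[OF f _ _ j]) (simp_all add: poly_mod_add_left mod_smult_left)
  have G: "PF k G" unfolding G_def
    by (rule PF_linear_slice[OF f _ _ j]) (simp_all add: poly_div_add_left div_smult_left)
  have "l x * R x = 0" for x
  proof (cases "l x = 0")
    case False
    have "smult (l x) (slice j f x) = K * slice j h x"
    proof -
      have "poly (smult (l x) (slice j f x)) t = poly (K * slice j h x) t" for t
        using eq[of "x(j := t)"] by (simp add: poly_slice[OF f] poly_slice[OF h] indep)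
      then show ?thesis by (simp add: poly_eq_poly_eq_iff[symmetric] fun_eq_iff)
    qed
    then have "K dvd slice j f x" using False by (metis dvd_smult_cancel dvd_triv_left)
    then show ?thesis by (simp add: R_def)
  qed simp
  from PF_no_zero_divisors[OF l R this] nz have R0: "R x = 0" for x by blast
  have "slice j f x mod K = 0" for x
  proof -
    have "poly (slice j f x mod K) t = 0" for t using R0[of "x(j := t)"] by (simp add: R_def)
    then show ?thesis using poly_all_0_iff_0 by blast
  qed
  then have S: "slice j f x = K * (slice j f x div K)" for x
    by (metis add.right_neutral mult_div_mod_eq)
  moreover have "slice j G x = slice j f x div K" for x
    by (rule slice_eqI) (simp add: G_def)
  moreover have "f x = poly K (x j) * G x" for x
    using arg_cong[OF S[of x], of "\<lambda>p. poly p (x j)"] by (simp add: poly_slice_self[OF f] G_def)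
  ultimately show ?thesis using G by metis
qed

lemma PF_cancel_poly:
  assumes "p \<noteq> 0" "i < k" "PF k f" "PF k g" "\<And>x. poly p (x i) * f x = poly p (x i) * g x"
  shows "f x = g x"
proof -
  obtain t where "poly p t \<noteq> 0" using poly_nonzero_at[OF assms(1)] by blast
  then show ?thesis
    using PF_cancel[of k "\<lambda>x. poly p (x i)" f g "\<lambda>_. t" x] assms(2-) by (simp add: PF_poly PF_var)
qed

lemma pderiv_sum: "pderiv (\<Sum>i\<in>I. p i) = (\<Sum>i\<in>I. pderiv (p i))"
  by (induction I rule: infinite_finite_induct) (simp_all add: pderiv_add)

lemma poly_antiderivative: "\<exists>q. pderiv q = (p :: real poly)"
proof -
  have "pderiv (\<Sum>i\<le>degree p. monom (coeff p i / real (Suc i)) (Suc i)) = (\<Sum>i\<le>degree p. monom (coeff p i) i)"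
    by (simp add: pderiv_sum pderiv_monom)
  then show ?thesis by (metis poly_as_sum_of_monoms)
qed

lemma additive_decomposition:
  fixes k l m :: "real poly"
  assumes k: "pderiv k \<noteq> 0" and l: "pderiv l \<noteq> 0"
    and "PF 3 f" "\<And>x. degree (slice 0 f x) \<le> M"
    and "\<And>x. pd 0 f x * poly (pderiv l) (x 1) = pd 1 f x * poly (pderiv k) (x 0)"
    and "\<And>x. pd 0 f x * poly (pderiv m) (x 2) = pd 2 f x * poly (pderiv k) (x 0)"
  shows "\<exists>g. \<forall>x. f x = poly g (poly k (x 0) + poly l (x 1) + poly m (x 2))"
  using assms(3-)
proof (induction M arbitrary: f)
  case (0 f)
  note f = 0(1)
  have p0: "pd 0 f x = 0" for x
  proof -
    have "pderiv (slice 0 f x) = 0" using 0(2)[of x] by (simp add: pderiv_eq_0_iff)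
    then show ?thesis by (simp add: pd_def)
  qed
  have "pd 1 f x = 0" for x
    by (rule PF_cancel_poly[OF k, of 0 3 "pd 1 f" "\<lambda>_. 0"])
       (use 0(3) p0 in \<open>simp_all add: PF_pd f mult.commute\<close>)
  moreover have "pd 2 f x = 0" for x
    by (rule PF_cancel_poly[OF k, of 0 3 "pd 2 f" "\<lambda>_. 0"])
       (use 0(4) p0 in \<open>simp_all add: PF_pd f mult.commute\<close>)
  ultimately have "pd j f x = 0" if "j < 3" for j x
    using that p0 by (auto simp: less_Suc_eq numeral_eq_Suc)
  then obtain c where "\<forall>x. f x = c" using pd_all_0_imp_const[OF f] by blast
  then show ?case by (intro exI[of _ "[:c:]"]) simp
next
  case (Suc M f)
  note f = Suc.prems(1)
  \<comment> \<open>\<open>pderiv l\<close> depends on another coordinate, so the first equation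
    makes \<open>pderiv k\<close> divide \<open>pd 0 f\<close>; \<open>u\<close> shows that the
    cofactor is not identically zero.\<close>
  obtain u where u: "poly (pderiv l) u \<noteq> 0" using poly_nonzero_at[OF l] by blast
  have "\<exists>G. PF 3 G \<and> (\<forall>x. pd 0 f x = poly (pderiv k) (x 0) * G x) \<and> (\<forall>x. slice 0 (pd 0 f) x = pderiv k * slice 0 G x)"
    by (rule PF_divide[of 3 _ "pd 1 f" "\<lambda>x. poly (pderiv l) (x 1)" 0 "\<lambda>_. u"])
       (use Suc.prems(3) u in \<open>auto intro!: PF_poly PF_var PF_pd f simp: mult.commute\<close>)
  then obtain G where G: "PF 3 G" "\<And>x. pd 0 f x = poly (pderiv k) (x 0) * G x"
    "\<And>x. slice 0 (pd 0 f) x = pderiv k * slice 0 G x" by blast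
  note PFs = PF_poly PF_var PF_pd PF_mult G(1) f
  have G1: "pd 1 f x = poly (pderiv l) (x 1) * G x" for x
  proof (rule PF_cancel_poly[OF k, of 0 3 "pd 1 f" "\<lambda>x. poly (pderiv l) (x 1) * G x"])
    show "poly (pderiv k) (x 0) * pd 1 f x = poly (pderiv k) (x 0) * (poly (pderiv l) (x 1) * G x)" for x
      using Suc.prems(3)[of x] unfolding G(2) by (simp only: mult_ac)
  qed (auto intro!: PFs)
  have G2: "pd 2 f x = poly (pderiv m) (x 2) * G x" for x
  proof (rule PF_cancel_poly[OF k, of 0 3 "pd 2 f" "\<lambda>x. poly (pderiv m) (x 2) * G x"])
    show "poly (pderiv k) (x 0) * pd 2 f x = poly (pderiv k) (x 0) * (poly (pderiv m) (x 2) * G x)" for x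
      using Suc.prems(4)[of x] unfolding G(2) by (simp only: mult_ac)
  qed (auto intro!: PFs)
  have f0: "pd 0 f = (\<lambda>x. poly (pderiv k) (x 0) * G x)" and f1: "pd 1 f = (\<lambda>x. poly (pderiv l) (x 1) * G x)"
    and f2: "pd 2 f = (\<lambda>x. poly (pderiv m) (x 2) * G x)"
    using G(2) G1 G2 by (auto simp: fun_eq_iff)
  have PFk: "PF 3 (\<lambda>x. poly p (x i))" if "i < 3" for p i by (intro PF_poly PF_var that)
  \<comment> \<open>The mixed second derivatives of \<open>f\<close> agree and each outer factor is
    constant in the other variable, so \<open>G\<close> satisfies the same equations as
    \<open>f\<close>.\<close>
  have c1: "pd 0 G x * poly (pderiv l) (x 1) = pd 1 G x * poly (pderiv k) (x 0)" for x
  proof -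
    have "pd 1 (pd 0 f) x = pd 0 (pd 1 f) x" using pd_commute[OF f, of 1 0] by simp
    then show ?thesis unfolding f0 f1
      by (simp add: pd_mult[OF PFk G(1)] pd_poly_var[of _ 3]) (simp add: mult.commute)
  qed
  have c2: "pd 0 G x * poly (pderiv m) (x 2) = pd 2 G x * poly (pderiv k) (x 0)" for x
  proof -
    have "pd 2 (pd 0 f) x = pd 0 (pd 2 f) x" using pd_commute[OF f, of 2 0] by simp
    then show ?thesis unfolding f0 f2
      by (simp add: pd_mult[OF PFk G(1)] pd_poly_var[of _ 3]) (simp add: mult.commute)
  qed
  have deg: "degree (slice 0 G x) \<le> M" for x
  proof (cases "slice 0 G x = 0")
    case False
    have "degree (pderiv k) + degree (slice 0 G x) = degree (slice 0 f x) - 1"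
      using G(3)[of x] slice_pd[OF f, of 0 x] degree_mult_eq[OF k False] degree_pderiv[of "slice 0 f x"] by simp
    then show ?thesis using Suc.prems(2)[of x] by linarith
  qed simp
  obtain g where g: "\<And>x. G x = poly g (poly k (x 0) + poly l (x 1) + poly m (x 2))"
    using Suc.IH[OF G(1) deg c1 c2] by blast
  obtain g' where g': "pderiv g' = g" using poly_antiderivative by blast
  define h where "h = (\<lambda>x::nat\<Rightarrow>real. poly k (x 0) + poly l (x 1) + poly m (x 2))"
  have h: "PF 3 h" unfolding h_def by (intro PF_add PFk) auto
  have gh: "G x = poly g (h x)" for x using g unfolding h_def .
  have pdh: "pd j h x = (if j = 0 then poly (pderiv k) (x 0) else if j = 1 then poly (pderiv l) (x 1) else poly (pderiv m) (x 2))"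
    if "j < 3" for j x
  proof -
    have "pd j h x = (if 0 = j then poly (pderiv k) (x 0) else 0) + (if 1 = j then poly (pderiv l) (x 1) else 0)
        + (if 2 = j then poly (pderiv m) (x 2) else 0)"
      unfolding h_def by (simp add: pd_add[of 3] PFk PF_add pd_poly_var[of _ 3])
    then show ?thesis using that by (auto simp: less_Suc_eq numeral_eq_Suc)
  qed
  \<comment> \<open>The gradient of \<open>f\<close> is \<open>G\<close> times that of
    \<open>h\<close>, and \<open>g'\<close> is an antiderivative of \<open>g\<close>.\<close>
  have "pd j (\<lambda>x. f x - poly g' (h x)) x = 0" if j: "j < 3" for j x
  proof -
    have "pd j f x = G x * pd j h x"
      using j G(2) G1 G2 pdh[OF j] by (auto simp: less_Suc_eq numeral_eq_Suc)
    then show ?thesis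
      by (simp add: pd_diff[OF f PF_poly[OF h]] pd_poly[OF h] g' gh)
  qed
  then obtain c where "\<forall>x. f x - poly g' (h x) = c"
    using pd_all_0_imp_const[OF PF_diff[OF f PF_poly[OF h]]] by blast
  then have "f x = poly (g' + [:c:]) (h x)" for x by (simp add: algebra_simps)
  then show ?case unfolding h_def by blast
qed

section \<open>The multiplicative form\<close>

lemma coeff_mult_top:
  fixes p q :: "'a :: comm_semiring_0 poly"
  assumes "degree p \<le> a" "degree q \<le> b"
  shows "coeff (p * q) (a + b) = coeff p a * coeff q b"
proof (cases "degree p = a \<and> degree q = b")
  case True
  then show ?thesis using coeff_mult_degree_sum[of p q] by simp
next
  case False
  with assms have "degree p < a \<or> degree q < b" by auto
  moreover have "degree (p * q) < a + b" using False assms degree_mult_le[of p q] by linarith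
  ultimately show ?thesis by (auto simp: coeff_eq_0)
qed

text \<open>Apart from constants, the top coefficients of the two sides are the product of the
  leading coefficients, multiplied by \<open>degree p\<close> and by \<open>degree b\<close>
  respectively.\<close>

lemma wronskian_degree:
  fixes p b :: "real poly"
  assumes w: "pderiv p * b = p * pderiv b" and nz: "p \<noteq> 0" "b \<noteq> 0"
  shows "degree p = degree b"
proof (cases "degree p = 0 \<or> degree b = 0")
  case True
  then have "pderiv p = 0 \<or> pderiv b = 0" by (simp add: pderiv_eq_0_iff)
  then have "pderiv p = 0 \<and> pderiv b = 0" using w nz by auto
  then show ?thesis by (simp add: pderiv_eq_0_iff)
next
  case False
  have E: "degree p - 1 + degree b = degree p + (degree b - 1)" using False by simp
  have "real (degree p) * lead_coeff p * lead_coeff b = coeff (pderiv p * b) (degree p - 1 + degree b)"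
    using False by (subst coeff_mult_top) (auto simp: degree_pderiv coeff_pderiv)
  also have "\<dots> = coeff (p * pderiv b) (degree p + (degree b - 1))" by (simp only: w E)
  also have "\<dots> = lead_coeff p * (real (degree b) * lead_coeff b)"
    using False by (subst coeff_mult_top) (auto simp: degree_pderiv coeff_pderiv)
  finally have "real (degree p) * (lead_coeff p * lead_coeff b) = real (degree b) * (lead_coeff p * lead_coeff b)"
    by (simp only: mult_ac)
  then have "real (degree p) = real (degree b)" using nz by (subst (asm) mult_cancel_right) auto
  then show ?thesis by simp
qed

text \<open>The hypothesis says that p / b has derivative 0, without dividing. Subtracting the
  multiple of \<open>b\<close> that removes the leading term leaves a solution whose degree would
  have to be that of \<open>b\<close>, so it is 0.\<close>

lemma wronskian_zero:
  fixes p b :: "real poly"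
  assumes w: "pderiv p * b = p * pderiv b" and b: "b \<noteq> 0"
  shows "\<exists>c. p = smult c b"
proof (cases "p = 0")
  case True
  then show ?thesis by (intro exI[of _ 0]) simp
next
  case False
  note deg = wronskian_degree[OF w False b]
  define c where "c = lead_coeff p / lead_coeff b"
  define r where "r = p - smult c b"
  have "pderiv r * b = r * pderiv b"
    unfolding r_def using w by (simp add: pderiv_diff pderiv_smult algebra_simps)
  moreover have "coeff r (degree b) = 0" unfolding r_def c_def using b deg by simp
  moreover have "degree r \<le> degree b" unfolding r_def using deg by (intro degree_diff_le) auto
  ultimately have "r = 0" using wronskian_degree[of r b] b by (metis leading_coeff_0_iff)
  then show ?thesis unfolding r_def by auto
qed

text \<open>\<open>log_power \<kappa> H s p\<close> says that \<open>p\<close> is a constant multiple of \<open>H powr (s / \<kappa>)\<close>.\<close>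

definition log_power :: "nat \<Rightarrow> real poly \<Rightarrow> nat \<Rightarrow> real poly \<Rightarrow> bool" where
  "log_power \<kappa> H s p \<longleftrightarrow> smult (real \<kappa>) (H * pderiv p) = smult (real s) (pderiv H * p)"

lemma log_power_mult:
  assumes "log_power \<kappa> H s p" "log_power \<kappa> H r q" shows "log_power \<kappa> H (s + r) (p * q)"
proof -
  have "smult (real \<kappa>) (H * pderiv (p * q)) = smult (real \<kappa>) (H * pderiv p) * q + p * smult (real \<kappa>) (H * pderiv q)"
    by (simp add: pderiv_mult algebra_simps smult_add_right)
  also have "\<dots> = smult (real (s + r)) (pderiv H * (p * q))"
    using assms unfolding log_power_def by (simp add: smult_add_left mult_ac)
  finally show ?thesis unfolding log_power_def .
qed

lemma log_power_power: "log_power \<kappa> H s p \<Longrightarrow> log_power \<kappa> H (n * s) (p ^ n)"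
  by (induction n) (auto intro!: log_power_mult simp: log_power_def[of _ _ 0])

lemma log_power_unique:
  assumes p: "log_power \<kappa> H s p" and b: "log_power \<kappa> H s b" "b \<noteq> 0" and H: "H \<noteq> 0" "\<kappa> > 0"
  shows "\<exists>c. p = smult c b"
proof (rule wronskian_zero[OF _ b(2)])
  have "smult (real \<kappa>) (H * (pderiv p * b)) = smult (real \<kappa>) (H * pderiv p) * b" by (simp add: mult_ac)
  also have "\<dots> = smult (real \<kappa>) (H * pderiv b) * p"
    using p b(1) unfolding log_power_def by (simp add: mult_ac)
  also have "\<dots> = smult (real \<kappa>) (H * (p * pderiv b))" by (simp add: mult_ac)
  finally have "smult (real \<kappa>) (H * (pderiv p * b - p * pderiv b)) = 0"
    by (simp only: right_diff_distrib smult_diff_right)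
  then show "pderiv p * b = p * pderiv b" using H by simp
qed

text \<open>\<open>p ^ r\<close> and \<open>q ^ s\<close> are both multiples of the same power of
  \<open>H\<close>, hence of each other. So \<open>p ^ s\<close> divides \<open>q ^ s\<close>, and
  unique factorization removes the exponent.\<close>

lemma log_power_dvd:
  assumes p: "log_power \<kappa> H s p" "p \<noteq> 0" and q: "log_power \<kappa> H r q" "q \<noteq> 0"
    and sr: "0 < s" "s \<le> r" and H: "H \<noteq> 0" "\<kappa> > 0"
  shows "p dvd q"
proof -
  have "log_power \<kappa> H (r * s) (p ^ r)" "log_power \<kappa> H (r * s) (q ^ s)"
    using log_power_power[OF p(1), of r] log_power_power[OF q(1), of s] by (simp_all add: mult.commute)
  then obtain c where c: "p ^ r = smult c (q ^ s)" using log_power_unique[of \<kappa> H "r * s" "p ^ r" "q ^ s"] q H by auto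
  then have "c \<noteq> 0" using p(2) by auto
  have "p ^ s dvd p ^ r" using sr(2) by (rule le_imp_power_dvd)
  then have "p ^ s dvd q ^ s" unfolding c using \<open>c \<noteq> 0\<close> dvd_smult_cancel by blast
  then show ?thesis using sr(1) by simp
qed

lemma log_power_quotient:
  assumes p: "log_power \<kappa> H s p" "p \<noteq> 0" and q: "log_power \<kappa> H r (p * q)" and sr: "s \<le> r"
  shows "log_power \<kappa> H (r - s) q"
proof -
  have "p * smult (real \<kappa>) (H * pderiv q) = smult (real \<kappa>) (H * pderiv (p * q)) - smult (real \<kappa>) (H * pderiv p) * q"
    by (simp add: pderiv_mult algebra_simps smult_add_right)
  also have "\<dots> = smult (real r) (pderiv H * (p * q)) - smult (real s) (pderiv H * p) * q"
    using p(1) q unfolding log_power_def by simp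
  also have "\<dots> = p * smult (real (r - s)) (pderiv H * q)"
    using sr by (simp add: of_nat_diff smult_diff_left right_diff_distrib mult_ac)
  finally have "p * smult (real \<kappa>) (H * pderiv q) = p * smult (real (r - s)) (pderiv H * q)" .
  then show ?thesis unfolding log_power_def using p(2) by (simp only: mult_cancel_left simp_thms)
qed

text \<open>The exponents s > 0 for which all three \<open>H j\<close> powr (s / \<kappa>) are
  polynomials up to constants. Closure under differences makes them multiples of the least one,
  which is what leads to powers of a single product.\<close>

definition log_degrees :: "(nat \<Rightarrow> real poly) \<Rightarrow> nat \<Rightarrow> nat set" where
  "log_degrees H \<kappa> = {s. s > 0 \<and> (\<forall>j<3. \<exists>b. b \<noteq> 0 \<and> log_power \<kappa> (H j) s b)}"

lemma log_degrees_diff: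
  assumes H: "\<And>j. j < 3 \<Longrightarrow> H j \<noteq> 0" "\<kappa> > 0" and s: "s \<in> log_degrees H \<kappa>" and r: "r \<in> log_degrees H \<kappa>" and sr: "s < r"
  shows "r - s \<in> log_degrees H \<kappa>"
proof -
  have "\<exists>b. b \<noteq> 0 \<and> log_power \<kappa> (H j) (r - s) b" if j: "j < 3" for j
  proof -
    obtain p where p: "p \<noteq> 0" "log_power \<kappa> (H j) s p" using s j unfolding log_degrees_def by blast
    obtain q where q: "q \<noteq> 0" "log_power \<kappa> (H j) r q" using r j unfolding log_degrees_def by blast
    have "p dvd q" using log_power_dvd[OF p(2,1) q(2,1)] s sr H j unfolding log_degrees_def by auto
    then obtain u where "q = p * u" by blast
    with q log_power_quotient[OF p(2,1), of r u] sr show ?thesis by (intro exI[of _ u]) auto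
  qed
  then show ?thesis using sr unfolding log_degrees_def by auto
qed

lemma log_degrees_multiple:
  assumes H: "\<And>j. j < 3 \<Longrightarrow> H j \<noteq> 0" "\<kappa> > 0" and e: "e \<in> log_degrees H \<kappa>"
    and least: "\<And>s. s \<in> log_degrees H \<kappa> \<Longrightarrow> e \<le> s" and s: "s \<in> log_degrees H \<kappa>"
  shows "e dvd s"
  using s
proof (induction s rule: less_induct)
  case (less s)
  show ?case
  proof (cases "s = e")
    case False
    then have es: "e < s" using least[OF less.prems] by simp
    have "e > 0" using e unfolding log_degrees_def by simp
    then have "e dvd s - e" using less.IH[of "s - e"] log_degrees_diff[OF H e less.prems es] es by simp
    then show ?thesis using es by (simp add: dvd_minus_self)
  qed simp
qed

text \<open>The operator taking \<open>P\<close> to \<open>Q\<close>, that is K P' / K', multiplies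
  a leading coefficient in degree \<open>Suc M\<close> by \<open>Suc M\<close> /
  \<open>degree K\<close>. If the difference still had degree above \<open>M\<close>, its product
  \<open>W\<close> with \<open>pderiv K\<close> would have its top coefficient in degree
  \<open>\<kappa> + M\<close>, where the two contributions cancel.\<close>

lemma degree_drop:
  fixes K P Q :: "real poly"
  assumes eq: "K * pderiv P = pderiv K * Q" and K: "degree K > 0" and P: "degree P \<le> Suc M"
  shows "degree (Q - smult (real (Suc M) / real (degree K)) P) \<le> M"
proof (rule ccontr)
  define \<kappa> where "\<kappa> = degree K"
  define \<sigma> where "\<sigma> = real (Suc M) / real \<kappa>"
  define R where "R = Q - smult \<sigma> P"
  assume "\<not> ?thesis"
  then have R: "degree R > M" unfolding R_def \<sigma>_def \<kappa>_def by simp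
  define W where "W = pderiv K * R"
  have W: "W = K * pderiv P - smult \<sigma> (pderiv K * P)"
    unfolding W_def R_def using eq by (simp add: algebra_simps)
  have K': "pderiv K \<noteq> 0" using K by (simp add: pderiv_eq_0_iff)
  have k1: "\<kappa> - 1 + Suc M = \<kappa> + M" using K unfolding \<kappa>_def by simp
  have dP': "degree (pderiv P) \<le> M" using P by (simp add: degree_pderiv)
  have "degree (K * pderiv P) \<le> \<kappa> + M"
    using degree_mult_le[of K "pderiv P"] dP' unfolding \<kappa>_def by linarith
  moreover have "degree (pderiv K * P) \<le> \<kappa> + M"
    using degree_mult_le[of "pderiv K" P] degree_pderiv[of K] P K unfolding \<kappa>_def by linarith
  then have "degree (smult \<sigma> (pderiv K * P)) \<le> \<kappa> + M" by (meson degree_smult_le le_trans)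
  ultimately have degW: "degree W \<le> \<kappa> + M" unfolding W by (intro degree_diff_le)
  have "coeff (K * pderiv P) (\<kappa> + M) = lead_coeff K * coeff (pderiv P) M"
    unfolding \<kappa>_def by (rule coeff_mult_top) (use dP' in auto)
  moreover have "coeff (pderiv K * P) (\<kappa> + M) = (real \<kappa> * lead_coeff K) * coeff P (Suc M)"
    unfolding k1[symmetric] using coeff_mult_top[of "pderiv K" "\<kappa> - 1" P "Suc M"] P K
    unfolding \<kappa>_def by (simp add: degree_pderiv coeff_pderiv)
  ultimately have "coeff W (\<kappa> + M) = 0"
    unfolding W \<sigma>_def using K by (simp add: coeff_pderiv \<kappa>_def)
  moreover have "R \<noteq> 0" using R by auto
  then have "degree W = degree (pderiv K) + degree R" unfolding W_def using K' by (rule degree_mult_eq[rotated])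
  then have "degree W \<ge> \<kappa> + M" using R K degree_pderiv[of K] unfolding \<kappa>_def by linarith
  with degW have "degree W = \<kappa> + M" by simp
  ultimately have "W = 0" by (metis leading_coeff_0_iff)
  with \<open>R \<noteq> 0\<close> K' show False unfolding W_def by simp
qed

text \<open>\<open>semi_invariant H \<kappa> s T\<close>: \<open>T\<close> is locally a constant multiple of
  \<open>(H 0 * H 1 * H 2) powr (s / \<kappa>)\<close>.\<close>

definition semi_invariant :: "(nat \<Rightarrow> real poly) \<Rightarrow> nat \<Rightarrow> nat \<Rightarrow> ((nat \<Rightarrow> real) \<Rightarrow> real) \<Rightarrow> bool" where
  "semi_invariant H \<kappa> s T \<longleftrightarrow> PF 3 T \<and>
     (\<forall>j<3. \<forall>x. real \<kappa> * (poly (H j) (x j) * pd j T x) = real s * (poly (pderiv (H j)) (x j) * T x))"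

lemma semi_invariant_scale:
  assumes "semi_invariant H \<kappa> s T" shows "semi_invariant H \<kappa> s (\<lambda>x. c * T x)"
proof -
  have T: "PF 3 T" using assms unfolding semi_invariant_def by blast
  have "real \<kappa> * (poly (H j) (x j) * pd j (\<lambda>x. c * T x) x) = real s * (poly (pderiv (H j)) (x j) * (c * T x))"
    if "j < 3" for j x
  proof -
    have "real \<kappa> * (poly (H j) (x j) * pd j (\<lambda>x. c * T x) x) = c * (real \<kappa> * (poly (H j) (x j) * pd j T x))"
      by (simp add: pd_mult[OF PF_const T])
    also have "\<dots> = c * (real s * (poly (pderiv (H j)) (x j) * T x))"
      using assms that unfolding semi_invariant_def by simp
    finally show ?thesis by simp
  qed
  then show ?thesis unfolding semi_invariant_def using PF_mult[OF PF_const T] by blast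
qed

lemma semi_invariant_slice:
  assumes T: "semi_invariant H \<kappa> s T" and j: "j < 3"
  shows "log_power \<kappa> (H j) s (slice j T x)"
proof -
  have P: "PF 3 T" using T unfolding semi_invariant_def by blast
  have "poly (smult (real \<kappa>) (H j * pderiv (slice j T x))) t = poly (smult (real s) (pderiv (H j) * slice j T x)) t" for t
  proof -
    have "real \<kappa> * (poly (H j) t * pd j T (x(j := t))) = real s * (poly (pderiv (H j)) t * T (x(j := t)))"
      using T j unfolding semi_invariant_def by (metis fun_upd_same)
    then show ?thesis by (simp add: pd_def poly_slice[OF P])
  qed
  then show ?thesis unfolding log_power_def by (simp add: poly_eq_poly_eq_iff[symmetric] fun_eq_iff)
qed

text \<open>Let E f = G stand for H_0 f_x = H_0' G. In degree \<open>Suc M\<close> of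
  \<open>x 0\<close> its leading eigenvalue is \<sigma> = (M + 1) / \<kappa>, so \<open>F\<close>,
  which is (E - \<sigma>) f, has lower degree and splits by induction. Removing from
  \<open>f\<close> the preimages of these parts under E - \<sigma> leaves a function killed by E -
  \<sigma>: the new top part.\<close>

lemma semi_invariant_decomposition:
  fixes H :: "nat \<Rightarrow> real poly"
  assumes H: "\<And>j. j < 3 \<Longrightarrow> H j \<noteq> 0" and H0: "pderiv (H 0) \<noteq> 0" and H1: "pderiv (H 1) \<noteq> 0"
    and "PF 3 f" "\<And>x. degree (slice 0 f x) \<le> M"
    and "\<And>j x. j < 3 \<Longrightarrow> pd 0 f x * (poly (H 0) (x 0) * poly (pderiv (H j)) (x j))
            = pd j f x * (poly (pderiv (H 0)) (x 0) * poly (H j) (x j))"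
  shows "\<exists>T. (\<forall>s\<le>M. semi_invariant H (degree (H 0)) s (T s)) \<and> (\<forall>x. f x = (\<Sum>s\<le>M. T s x))"
  using assms(4-)
proof (induction M arbitrary: f)
  case (0 f)
  note f = 0(1)
  have p0: "pd 0 f x = 0" for x
  proof -
    have "pderiv (slice 0 f x) = 0" using 0(2)[of x] by (simp add: pderiv_eq_0_iff)
    then show ?thesis by (simp add: pd_def)
  qed
  have pj: "poly (H j) (x j) * pd j f x = 0" if j: "j < 3" for j x
  proof (rule PF_cancel_poly[OF H0, of 0 3 "\<lambda>x. poly (H j) (x j) * pd j f x" "\<lambda>_. 0"])
    show "poly (pderiv (H 0)) (x 0) * (poly (H j) (x j) * pd j f x) = poly (pderiv (H 0)) (x 0) * 0" for x
      using 0(3)[OF j, of x] p0 by auto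
  qed (use j in \<open>auto intro!: PF_mult PF_poly PF_var PF_pd f\<close>)
  have "semi_invariant H (degree (H 0)) 0 f"
    unfolding semi_invariant_def using f pj by simp
  then show ?case by (intro exI[of _ "\<lambda>_. f"]) simp
next
  case (Suc M f)
  note f = Suc.prems(1)
  define \<kappa> where "\<kappa> = degree (H 0)"
  have \<kappa>: "\<kappa> > 0" unfolding \<kappa>_def using H0 by (simp add: pderiv_eq_0_iff)
  define a where "a = (\<lambda>j x::nat\<Rightarrow>real. poly (H j) (x j))"
  define a' where "a' = (\<lambda>j x::nat\<Rightarrow>real. poly (pderiv (H j)) (x j))"
  have PFa: "PF 3 (a j)" "PF 3 (a' j)" if "j < 3" for j
    unfolding a_def a'_def by (intro PF_poly PF_var that)+
  have inv: "pd 0 f x * (a 0 x * a' j x) = pd j f x * (a' 0 x * a j x)" if "j < 3" for j x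
    using Suc.prems(3)[OF that] unfolding a_def a'_def .
  obtain u where u: "poly (pderiv (H 1)) u \<noteq> 0" using poly_nonzero_at[OF H1] by blast
  have "\<exists>G. PF 3 G \<and> (\<forall>x. a 0 x * pd 0 f x = poly (pderiv (H 0)) (x 0) * G x) \<and>
      (\<forall>x. slice 0 (\<lambda>x. a 0 x * pd 0 f x) x = pderiv (H 0) * slice 0 G x)"
  proof (rule PF_divide[of 3 _ "\<lambda>x. pd 1 f x * a 1 x" "a' 1" 0 "\<lambda>_. u"])
    show "a' 1 x * (a 0 x * pd 0 f x) = poly (pderiv (H 0)) (x 0) * (pd 1 f x * a 1 x)" for x
      using inv[of 1 x] unfolding a'_def by (simp add: mult_ac)
    show "PF 3 (a' 1)" by (intro PFa) simp
  qed (use u in \<open>auto intro!: PF_mult PF_pd PFa f simp: a'_def\<close>)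
  then obtain G where G: "PF 3 G" "\<And>x. a 0 x * pd 0 f x = a' 0 x * G x"
    "\<And>x. slice 0 (\<lambda>x. a 0 x * pd 0 f x) x = pderiv (H 0) * slice 0 G x" unfolding a'_def by blast
  have Gj: "a j x * pd j f x = a' j x * G x" if j: "j < 3" for j x
  proof (rule PF_cancel_poly[OF H0, of 0 3 "\<lambda>x. a j x * pd j f x" "\<lambda>x. a' j x * G x"])
    show "poly (pderiv (H 0)) (x 0) * (a j x * pd j f x) = poly (pderiv (H 0)) (x 0) * (a' j x * G x)" for x
    proof -
      have "a' 0 x * (a j x * pd j f x) = (a 0 x * pd 0 f x) * a' j x" using inv[OF j, of x] by (simp add: mult_ac)
      also have "\<dots> = a' 0 x * (a' j x * G x)" unfolding G(2) by (simp add: mult_ac)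
      finally show ?thesis unfolding a'_def .
    qed
  qed (use j in \<open>auto intro!: PF_mult PF_pd PFa f G(1)\<close>)
  \<comment> \<open>For \<open>j \<noteq> 0\<close> the mixed derivative of \<open>f\<close> is
    computed in both orders from the equations that define \<open>G\<close>.\<close>
  have Ginv: "pd 0 G x * (a 0 x * a' j x) = pd j G x * (a' 0 x * a j x)" if j: "j < 3" for j x
  proof (cases "j = 0")
    case False
    have ind: "pd 0 (a j) = (\<lambda>x. 0)" "pd 0 (a' j) = (\<lambda>x. 0)" "pd j (a 0) = (\<lambda>x. 0)" "pd j (a' 0) = (\<lambda>x. 0)"
      unfolding a_def a'_def using False j by (simp_all add: pd_poly_var[of _ 3])
    have "pd 0 (\<lambda>x. a j x * pd j f x) x = pd 0 (\<lambda>x. a' j x * G x) x" using Gj[OF j] by simp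
    then have e1: "a j x * pd 0 (pd j f) x = a' j x * pd 0 G x"
      using pd_mult[OF PFa(1)[OF j] PF_pd[OF f j], of 0] pd_mult[OF PFa(2)[OF j] G(1), of 0] ind by simp
    have "pd j (\<lambda>x. a 0 x * pd 0 f x) x = pd j (\<lambda>x. a' 0 x * G x) x" using G(2) by simp
    then have e2: "a 0 x * pd j (pd 0 f) x = a' 0 x * pd j G x"
      using pd_mult[OF PFa(1)[of 0] PF_pd[OF f, of 0], of j] pd_mult[OF PFa(2)[of 0] G(1), of j] ind by simp
    have "pd 0 G x * (a 0 x * a' j x) = a 0 x * (a' j x * pd 0 G x)" by (simp add: mult_ac)
    also have "\<dots> = a j x * (a 0 x * pd j (pd 0 f) x)"
      unfolding e1[symmetric] using pd_commute[OF f, of 0 j] j by (simp add: mult_ac)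
    also have "\<dots> = pd j G x * (a' 0 x * a j x)" unfolding e2 by (simp add: mult_ac)
    finally show ?thesis .
  qed (simp add: mult_ac)
  define \<sigma> where "\<sigma> = real (Suc M) / real \<kappa>"
  define F where "F = (\<lambda>x. G x - \<sigma> * f x)"
  have PFsf: "PF 3 (\<lambda>x. \<sigma> * f x)" by (intro PF_mult PF_const f)
  have F: "PF 3 F" unfolding F_def by (intro PF_diff G(1) PFsf)
  have pdF: "pd j F x = pd j G x - \<sigma> * pd j f x" for j x
    unfolding F_def by (simp add: pd_diff[OF G(1) PFsf] pd_mult[OF PF_const f])
  have Fdeg: "degree (slice 0 F x) \<le> M" for x
  proof -
    have "slice 0 (\<lambda>x. a 0 x * pd 0 f x) x = H 0 * pderiv (slice 0 f x)"
      by (rule slice_eqI) (simp add: a_def pd_def)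
    then have "H 0 * pderiv (slice 0 f x) = pderiv (H 0) * slice 0 G x" using G(3) by simp
    from degree_drop[OF this _ Suc.prems(2)] \<kappa>
    have "degree (slice 0 G x - smult \<sigma> (slice 0 f x)) \<le> M" unfolding \<sigma>_def \<kappa>_def by simp
    moreover have "slice 0 F x = slice 0 G x - smult \<sigma> (slice 0 f x)"
      by (rule slice_eqI) (simp add: F_def poly_slice[OF G(1)] poly_slice[OF f] del: fun_upd_apply)
    ultimately show ?thesis by simp
  qed
  have Finv: "pd 0 F x * (poly (H 0) (x 0) * poly (pderiv (H j)) (x j))
            = pd j F x * (poly (pderiv (H 0)) (x 0) * poly (H j) (x j))" if "j < 3" for j x
  proof -
    have "pd 0 F x * (a 0 x * a' j x) = pd 0 G x * (a 0 x * a' j x) - \<sigma> * (pd 0 f x * (a 0 x * a' j x))"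
      unfolding pdF by (simp add: left_diff_distrib)
    also have "\<dots> = pd j F x * (a' 0 x * a j x)"
      unfolding pdF Ginv[OF that] inv[OF that] by (simp add: left_diff_distrib)
    finally show ?thesis unfolding a_def a'_def .
  qed
  obtain T where T: "\<And>s. s \<le> M \<Longrightarrow> semi_invariant H \<kappa> s (T s)" "\<And>x. F x = (\<Sum>s\<le>M. T s x)"
    using Suc.IH[OF F Fdeg Finv] unfolding \<kappa>_def by blast
  have PFT: "PF 3 (T s)" if "s \<le> M" for s using T(1)[OF that] unfolding semi_invariant_def by blast
  \<comment> \<open>E multiplies \<open>T s\<close> by s / \<kappa>, so E - \<sigma> multiplies it
    by (s - Suc M) / \<kappa>; \<open>c s\<close> is the inverse, which exists because s \<le>
    M.\<close>
  define c where "c = (\<lambda>s. real \<kappa> / (real s - real (Suc M)))"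
  define S where "S = (\<lambda>x. f x - (\<Sum>s\<le>M. c s * T s x))"
  have PFcT: "PF 3 (\<lambda>x. c s * T s x)" if "s \<le> M" for s using PFT[OF that] by (intro PF_mult PF_const)
  have PFsum: "PF 3 (\<lambda>x. \<Sum>s\<le>M. c s * T s x)" by (intro PF_sum PFcT) simp
  have S: "PF 3 S" unfolding S_def by (intro PF_diff f PFsum)
  have "real \<kappa> * (a j x * pd j S x) = real (Suc M) * (a' j x * S x)" if j: "j < 3" for j x
  proof -
    have "pd j S x = pd j f x - (\<Sum>s\<le>M. c s * pd j (T s) x)"
    proof -
      have "pd j (\<lambda>x. \<Sum>s\<le>M. c s * T s x) x = (\<Sum>s\<le>M. pd j (\<lambda>x. c s * T s x) x)"
        using pd_sum[of "{..M}" 3 "\<lambda>s x. c s * T s x" j] PFcT by simp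
      also have "\<dots> = (\<Sum>s\<le>M. c s * pd j (T s) x)"
        by (intro sum.cong refl) (simp add: pd_mult[OF PF_const PFT])
      finally show ?thesis unfolding S_def by (simp add: pd_diff[OF f PFsum])
    qed
    then have "real \<kappa> * (a j x * pd j S x) = real \<kappa> * (a j x * pd j f x) - (\<Sum>s\<le>M. c s * (real \<kappa> * (a j x * pd j (T s) x)))"
      by (simp add: right_diff_distrib sum_distrib_left mult_ac)
    also have "(\<Sum>s\<le>M. c s * (real \<kappa> * (a j x * pd j (T s) x))) = (\<Sum>s\<le>M. c s * (real s * (a' j x * T s x)))"
      using T(1) j unfolding semi_invariant_def a_def a'_def by (intro sum.cong refl) simp
    also have "\<dots> = (\<Sum>s\<le>M. a' j x * (real \<kappa> * T s x + real (Suc M) * (c s * T s x)))"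
    proof (intro sum.cong refl)
      fix s assume "s \<in> {..M}"
      then have "real s - real (Suc M) \<noteq> 0" by simp
      then have "c s * real s = real \<kappa> + real (Suc M) * c s" unfolding c_def
        by (simp add: field_simps)
      then have "a' j x * T s x * (c s * real s) = a' j x * T s x * (real \<kappa> + real (Suc M) * c s)" by (rule arg_cong)
      then show "c s * (real s * (a' j x * T s x)) = a' j x * (real \<kappa> * T s x + real (Suc M) * (c s * T s x))"
        by (simp only: distrib_left distrib_right mult_ac)
    qed
    also have "\<dots> = a' j x * (real \<kappa> * F x + real (Suc M) * (\<Sum>s\<le>M. c s * T s x))"
      unfolding T(2) by (simp only: sum_distrib_left[symmetric] sum.distrib)
    also have "real \<kappa> * (a j x * pd j f x) = a' j x * (real \<kappa> * F x + real (Suc M) * f x)"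
      unfolding Gj[OF j] F_def \<sigma>_def using \<kappa> by (simp add: field_simps)
    finally show ?thesis unfolding S_def by (simp only: right_diff_distrib distrib_left mult_ac)
  qed
  then have "semi_invariant H \<kappa> (Suc M) S" unfolding semi_invariant_def a_def a'_def using S by blast
  moreover have "f x = (\<Sum>s\<le>M. c s * T s x) + S x" for x unfolding S_def by simp
  ultimately show ?case
    using semi_invariant_scale[OF T(1)] unfolding \<kappa>_def
    by (intro exI[of _ "\<lambda>s. if s = Suc M then S else (\<lambda>x. c s * T s x)"]) (auto simp: le_Suc_eq)
qed

text \<open>Each nonzero part of positive exponent is, in every variable separately, a multiple of a
  power of \<open>p j\<close>, the polynomial belonging to the least exponent \<open>e\<close>. So
  it is a monomial in one product common to all parts.\<close>

lemma multiplicative_decomposition: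
  fixes H :: "nat \<Rightarrow> real poly"
  assumes H: "\<And>j. j < 3 \<Longrightarrow> H j \<noteq> 0" and H0: "pderiv (H 0) \<noteq> 0" and H1: "pderiv (H 1) \<noteq> 0"
    and f: "PF 3 f"
    and inv: "\<And>j x. j < 3 \<Longrightarrow> pd 0 f x * (poly (H 0) (x 0) * poly (pderiv (H j)) (x j))
            = pd j f x * (poly (pderiv (H 0)) (x 0) * poly (H j) (x j))"
  shows "\<exists>g k l m. \<forall>x. f x = poly g (poly k (x 0) * poly l (x 1) * poly m (x 2))"
proof -
  obtain M where M: "mpf 3 M f" using f PF_def by blast
  define \<kappa> where "\<kappa> = degree (H 0)"
  have \<kappa>: "\<kappa> > 0" unfolding \<kappa>_def using H0 by (simp add: pderiv_eq_0_iff)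
  obtain T where T: "\<And>s. s \<le> M \<Longrightarrow> semi_invariant H \<kappa> s (T s)" "\<And>x. f x = (\<Sum>s\<le>M. T s x)"
    using semi_invariant_decomposition[OF H H0 H1 f degree_slice[OF M] inv] unfolding \<kappa>_def by blast
  have PFT: "PF 3 (T s)" if "s \<le> M" for s using T(1)[OF that] unfolding semi_invariant_def by blast
  have T0: "\<exists>c. \<forall>x. T 0 x = c"
  proof (rule pd_all_0_imp_const[OF PFT])
    fix j x assume j: "j < (3::nat)"
    show "pd j (T 0) x = 0"
      using T(1)[of 0] \<kappa> j unfolding semi_invariant_def
      by (intro PF_cancel_poly[OF H[OF j] j PF_pd[OF PFT j], of 0 "\<lambda>_. 0"]) auto
  qed simp
  have Ts: "s \<in> log_degrees H \<kappa>" if s: "s \<le> M" "s > 0" "T s x \<noteq> 0" for s x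
  proof -
    have "slice j (T s) x \<noteq> 0" for j using poly_slice_self[OF PFT[OF s(1)], of j x] s(3) by auto
    then show ?thesis unfolding log_degrees_def using s(2) semi_invariant_slice[OF T(1)[OF s(1)]] by blast
  qed
  have "\<exists>k l m. \<forall>s\<le>M. \<exists>g. \<forall>x. T s x = poly g (poly k (x 0) * poly l (x 1) * poly m (x 2))"
  proof (cases "log_degrees H \<kappa> = {}")
    case True
    \<comment> \<open>No positive exponent is available, so only the constant \<open>T 0\<close> can
      be nonzero and any inner polynomials will do, for instance 0.\<close>
    have "\<exists>g. \<forall>x. T s x = poly g (poly 0 (x 0) * poly 0 (x 1) * poly 0 (x 2))" if s: "s \<le> M" for s
    proof (cases "s = 0")
      case True
      then obtain c where "\<forall>x. T s x = c" using T0 by blast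
      then show ?thesis by (intro exI[of _ "[:c:]"]) simp
    next
      case False
      then have "T s x = 0" for x using Ts[OF s, of x] True by blast
      then show ?thesis by (intro exI[of _ 0]) simp
    qed
    then show ?thesis by blast
  next
    case False
    define e where "e = (LEAST s. s \<in> log_degrees H \<kappa>)"
    have e: "e \<in> log_degrees H \<kappa>" unfolding e_def using False by (meson LeastI ex_in_conv)
    have least: "e \<le> s" if "s \<in> log_degrees H \<kappa>" for s unfolding e_def using that by (rule Least_le)
    have "\<forall>j. \<exists>b. j < 3 \<longrightarrow> b \<noteq> 0 \<and> log_power \<kappa> (H j) e b" using e unfolding log_degrees_def by auto
    from choice[OF this] obtain p where p: "\<And>j. j < 3 \<Longrightarrow> p j \<noteq> 0" "\<And>j. j < 3 \<Longrightarrow> log_power \<kappa> (H j) e (p j)" by auto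
    have "\<exists>g. \<forall>x. T s x = poly g (poly (p 0) (x 0) * poly (p 1) (x 1) * poly (p 2) (x 2))" if s: "s \<le> M" for s
    proof (cases "s = 0 \<or> (\<forall>x. T s x = 0)")
      case True
      then obtain c where "\<forall>x. T s x = c" using T0 by blast
      then show ?thesis by (intro exI[of _ "[:c:]"]) simp
    next
      case False
      then have "s \<in> log_degrees H \<kappa>" using Ts[OF s] by blast
      then have "e dvd s" using log_degrees_multiple[OF H \<kappa> e least] by blast
      then obtain r where r: "s = r * e" by (metis dvd_def mult.commute)
      have "\<forall>j. \<exists>t. j < 3 \<longrightarrow> poly (p j ^ r) t \<noteq> 0"
        using poly_nonzero_at[of "p j ^ r" for j] p(1) by auto
      from choice[OF this] obtain w where w: "\<And>j. j < 3 \<Longrightarrow> poly (p j ^ r) (w j) \<noteq> 0" by blast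
      \<comment> \<open>The slice is a multiple of \<open>p j ^ r\<close>, and its value at the
        normalization point \<open>w j\<close> determines the factor.\<close>
      have sep: "T s x = T s (x(j := w j)) / poly (p j ^ r) (w j) * poly (p j ^ r) (x j)" if j: "j < 3" for j x
      proof -
        obtain c where c: "slice j (T s) x = smult c (p j ^ r)"
          using log_power_unique[OF semi_invariant_slice[OF T(1)[OF s] j, of x], of "p j ^ r"]
            log_power_power[OF p(2)[OF j], of r] p(1)[OF j] H[OF j] \<kappa> unfolding r by auto
        have "T s (x(j := w j)) = c * poly (p j ^ r) (w j)"
          using poly_slice[OF PFT[OF s], of j x "w j"] c by simp
        moreover have "T s x = c * poly (p j ^ r) (x j)"
          using poly_slice_self[OF PFT[OF s], of j x] c by simp
        ultimately show ?thesis using w[OF j] by simp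
      qed
      obtain N where N: "mpf 3 N (T s)" using PFT[OF s] PF_def by blast
      define C where "C = T s w / (poly (p 0 ^ r) (w 0) * poly (p 1 ^ r) (w 1) * poly (p 2 ^ r) (w 2))"
      have "T s x = C * (poly (p 0 ^ r) (x 0) * poly (p 1 ^ r) (x 1) * poly (p 2 ^ r) (x 2))" for x
      proof -
        have "T s (x(0 := w 0, 1 := w 1, 2 := w 2)) = T s w"
          by (rule mpf_cong[OF N]) (auto simp: less_Suc_eq numeral_eq_Suc)
        then show ?thesis
          using sep[of 0 x] sep[of 1 "x(0 := w 0)"] sep[of 2 "x(0 := w 0, 1 := w 1)"] unfolding C_def by (simp add: mult_ac)
      qed
      then show ?thesis
        by (intro exI[of _ "monom C r"]) (simp add: poly_monom poly_power power_mult_distrib)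
    qed
    then show ?thesis by blast
  qed
  then obtain k l m where klm: "\<forall>s\<le>M. \<exists>g. \<forall>x. T s x = poly g (poly k (x 0) * poly l (x 1) * poly m (x 2))" by blast
  then have "\<forall>s. \<exists>g. s \<le> M \<longrightarrow> (\<forall>x. T s x = poly g (poly k (x 0) * poly l (x 1) * poly m (x 2)))" by blast
  from choice[OF this] obtain g where
    g: "\<And>s x. s \<le> M \<Longrightarrow> T s x = poly (g s) (poly k (x 0) * poly l (x 1) * poly m (x 2))" by blast
  have "f x = poly (\<Sum>s\<le>M. g s) (poly k (x 0) * poly l (x 1) * poly m (x 2))" for x
    unfolding T(2) poly_sum using g by (intro sum.cong) auto
  then show ?thesis by blast
qed

section \<open>Reduction to the two forms\<close>

text \<open>The outer variable of \<open>F\<close> is the first argument: degree and leading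
  coefficient of \<open>F\<close> refer to it, and the coefficients are polynomials in the
  second.\<close>

abbreviation eval2 :: "real poly poly \<Rightarrow> real \<Rightarrow> real \<Rightarrow> real" where
  "eval2 F s t \<equiv> poly (poly F [:s:]) t"

abbreviation lift :: "real poly \<Rightarrow> real poly poly" where
  "lift \<equiv> map_poly (\<lambda>c. [:c:])"

lemma eval2_lift: "eval2 (lift p) s t = poly p s"
  by (induction p) (simp_all add: map_poly_pCons)

lemma DERIV_eval2_fst: "((\<lambda>s. eval2 F s t) has_real_derivative eval2 (pderiv F) s t) (at s)"
proof (induction F)
  case (pCons a F)
  show ?case
    by (auto simp: pderiv_pCons intro!: derivative_eq_intros pCons.IH)
qed simp

lemma DERIV_eval2_snd: "((\<lambda>t. eval2 F s t) has_real_derivative eval2 (map_poly pderiv F) s t) (at t)"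
proof (induction F)
  case (pCons a F)
  show ?case
    using DERIV_add[OF poly_DERIV[of a] DERIV_cmult[OF pCons.IH, of s]] by (simp add: map_poly_pCons)
qed simp

lemma eval2_eqI:
  assumes "\<And>s t. eval2 F s t = eval2 G s t" shows "F = G"
proof (rule ccontr)
  assume "F \<noteq> G"
  then have "finite {p. poly (F - G) p = 0}" by (intro poly_roots_finite) simp
  moreover have "range (\<lambda>s. [:s:]) \<subseteq> {p. poly (F - G) p = 0}"
  proof clarify
    fix s
    have "poly (poly (F - G) [:s:]) t = 0" for t using assms by simp
    then show "poly (F - G) [:s:] = 0" using poly_all_0_iff_0 by blast
  qed
  moreover have "infinite (range (\<lambda>s::real. [:s:]))"
    by (subst finite_image_iff) (auto simp: inj_on_def infinite_UNIV_char_0)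
  ultimately show False using finite_subset by blast
qed

lemma PF_eval2:
  assumes "PF 3 f" "i \<noteq> j"
  shows "\<exists>F. \<forall>s t. f (w(i := s, j := t)) = eval2 F s t"
  using assms(1)
proof (induction rule: PF_induct)
  case (const a)
  then show ?case by (intro exI[of _ "[:[:a:]:]"]) simp
next
  case (var l)
  consider "l = i" | "l = j" | "l \<noteq> i" "l \<noteq> j" by blast
  then show ?case
  proof cases
    case 1
    then show ?thesis using assms(2) by (intro exI[of _ "[:0, 1:]"]) simp
  next
    case 2
    then show ?thesis by (intro exI[of _ "[:[:0, 1:]:]"]) simp
  next
    case 3
    then show ?thesis by (intro exI[of _ "[:[:w l:]:]"]) simp
  qed
next
  case (add f g)
  then obtain F G where "\<forall>s t. f (w(i := s, j := t)) = eval2 F s t" "\<forall>s t. g (w(i := s, j := t)) = eval2 G s t" by blast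
  then show ?case by (intro exI[of _ "F + G"]) (simp del: fun_upd_apply)
next
  case (mult f g)
  then obtain F G where "\<forall>s t. f (w(i := s, j := t)) = eval2 F s t" "\<forall>s t. g (w(i := s, j := t)) = eval2 G s t" by blast
  then show ?case by (intro exI[of _ "F * G"]) (simp del: fun_upd_apply)
qed

text \<open>Leading coefficients in the first variable are compared. With m the degree of
  \<open>F\<close> and j that of its derivative in the second variable, m - 1 + degree p0 = j +
  degree p1. If j = m, the leading coefficient a of \<open>F\<close> is not constant and q1 / q0 is
  a multiple of a' / a. If j < m, it is constant and q1 / q0 is the derivative of a multiple of
  \<open>coeff F j\<close>.\<close>

lemma leading_terms:
  fixes F :: "real poly poly" and p0 p1 q0 q1 :: "real poly"
  assumes eq: "pderiv F * lift p0 * [:q1:] = map_poly pderiv F * lift p1 * [:q0:]"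
    and nz: "p0 \<noteq> 0" "p1 \<noteq> 0" "q0 \<noteq> 0" "q1 \<noteq> 0" "pderiv F \<noteq> 0"
  shows "\<exists>m>0. (degree p0 = degree p1 + 1 \<and> (\<exists>a. pderiv a \<noteq> 0 \<and>
              smult (real m * lead_coeff p0) (a * q1) = smult (lead_coeff p1) (pderiv a * q0)))
          \<or> (degree p0 \<le> degree p1 \<and> (\<exists>l. q1 = pderiv l * q0))"
proof -
  define m where "m = degree F"
  define G where "G = map_poly pderiv F"
  define j where "j = degree G"
  have m: "m > 0" unfolding m_def using nz(5) by (metis gr0I pderiv_eq_0_iff)
  have lift: "degree (lift p) = degree p" "lead_coeff (lift p) = [:lead_coeff p:]" "lift p = 0 \<longleftrightarrow> p = 0" for p
  proof -
    show d: "degree (lift p) = degree p" by (rule degree_map_poly) simp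
    show "lead_coeff (lift p) = [:lead_coeff p:]" unfolding d by (simp add: coeff_map_poly)
    show "lift p = 0 \<longleftrightarrow> p = 0" by (metis coeff_map_poly leading_coeff_0_iff coeff_0 pCons_0_0 pCons_eq_0_iff poly_eqI)
  qed
  have lhs: "pderiv F * lift p0 * [:q1:] \<noteq> 0" using nz lift(3) by simp
  then have G: "G \<noteq> 0" using eq unfolding G_def by auto
  have eqG: "pderiv F * lift p0 * [:q1:] = G * lift p1 * [:q0:]" using eq unfolding G_def .
  have d1: "degree (pderiv F * lift p0 * [:q1:]) = m - 1 + degree p0"
    using nz lift(1,3) by (simp add: degree_mult_eq degree_pderiv m_def)
  have d2: "degree (G * lift p1 * [:q0:]) = j + degree p1"
    using nz lift(1,3) G by (simp add: degree_mult_eq j_def)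
  have deg: "m - 1 + degree p0 = j + degree p1" using d1[unfolded eqG] d2 by linarith
  have l1: "lead_coeff (pderiv F * lift p0 * [:q1:]) = smult (real m * lead_coeff p0) (lead_coeff F * q1)"
  proof -
    have "lead_coeff (pderiv F) = of_nat m * lead_coeff F"
      using m by (simp add: degree_pderiv coeff_pderiv m_def)
    then show ?thesis by (simp add: lead_coeff_mult lift(2) of_nat_poly mult_ac)
  qed
  have l2: "lead_coeff (G * lift p1 * [:q0:]) = smult (lead_coeff p1) (pderiv (coeff F j) * q0)"
    by (simp add: lead_coeff_mult lift(2)) (simp add: j_def[symmetric], simp add: G_def coeff_map_poly mult.commute)
  have lead: "smult (real m * lead_coeff p0) (lead_coeff F * q1) = smult (lead_coeff p1) (pderiv (coeff F j) * q0)"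
    by (rule trans[OF l1[unfolded eqG, symmetric] l2])
  have jm: "j \<le> m" unfolding j_def G_def m_def 
    by (rule degree_le) (simp add: coeff_map_poly coeff_eq_0)
  have "pderiv (coeff F j) \<noteq> 0"
    using G by (metis G_def coeff_map_poly j_def leading_coeff_0_iff pderiv_0)
  show ?thesis
  proof (cases "j = m")
    case True
    then have "degree p0 = degree p1 + 1" using deg m by simp
    then show ?thesis using True lead \<open>pderiv (coeff F j) \<noteq> 0\<close> m unfolding m_def by blast
  next
    case False
    then have jm: "j < m" using jm by simp
    have "pderiv (lead_coeff F) = coeff G m" unfolding G_def m_def by (simp add: coeff_map_poly)
    also have "\<dots> = 0" using jm unfolding j_def by (rule coeff_eq_0)
    finally obtain c where c: "lead_coeff F = [:c:]" by (metis degree_eq_zeroE pderiv_eq_0_iff)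
    have "F \<noteq> 0" using m unfolding m_def by auto
    then have c0: "c \<noteq> 0" using c by (metis leading_coeff_0_iff pCons_0_0)
    define \<alpha> where "\<alpha> = real m * lead_coeff p0 * c"
    have "\<alpha> \<noteq> 0" unfolding \<alpha>_def using m nz c0 by simp
    have "smult \<alpha> q1 = smult (lead_coeff p1) (pderiv (coeff F j) * q0)"
      using lead unfolding c \<alpha>_def by simp
    then have "smult (1 / \<alpha>) (smult \<alpha> q1) = smult (1 / \<alpha>) (smult (lead_coeff p1) (pderiv (coeff F j) * q0))" by simp
    then have "q1 = pderiv (smult (lead_coeff p1 / \<alpha>) (coeff F j)) * q0"
      using \<open>\<alpha> \<noteq> 0\<close> by (simp add: pderiv_smult)
    then show ?thesis using deg jm m by (intro exI[of _ m]) auto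
  qed
qed

text \<open>\<open>leading_terms\<close> on the plane through \<open>w\<close> in the directions
  \<open>i\<close> and \<open>j\<close>. Which alternative holds is decided by the degrees of
  \<open>p0\<close> and \<open>p1\<close>, so it is the same for every partner of the variable
  \<open>i\<close>.\<close>

lemma leading_dichotomy:
  assumes f: "PF 3 f" and ij: "i < 3" "j < 3" "i \<noteq> j"
    and eq: "\<And>x. pd i f x * (poly p0 (x i) * poly q1 (x j)) = pd j f x * (poly p1 (x i) * poly q0 (x j))"
    and nz: "p0 \<noteq> 0" "p1 \<noteq> 0" "q0 \<noteq> 0" "q1 \<noteq> 0" "pd i f w \<noteq> 0"
  shows "\<exists>m>0. (degree p0 = degree p1 + 1 \<and> (\<exists>a. pderiv a \<noteq> 0 \<and>
              smult (real m * lead_coeff p0) (a * q1) = smult (lead_coeff p1) (pderiv a * q0)))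
          \<or> (degree p0 \<le> degree p1 \<and> (\<exists>l. q1 = pderiv l * q0))"
proof -
  obtain F where F: "\<And>s t. f (w(i := s, j := t)) = eval2 F s t" using PF_eval2[OF f ij(3)] by blast
  have pi: "pd i f (w(i := s, j := t)) = eval2 (pderiv F) s t" for s t
  proof (rule DERIV_unique)
    show "((\<lambda>u. f ((w(i := s, j := t))(i := u))) has_real_derivative pd i f (w(i := s, j := t))) (at s)"
      using DERIV_pd_self[OF f, of "w(i := s, j := t)" i] ij(3) by (simp del: fun_upd_apply) (simp add: fun_upd_apply)
    have "f ((w(i := s, j := t))(i := u)) = eval2 F u t" for u
      using F[of u t] ij(3) by (simp add: fun_upd_twist)
    then show "((\<lambda>u. f ((w(i := s, j := t))(i := u))) has_real_derivative eval2 (pderiv F) s t) (at s)"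
      by (simp only: DERIV_eval2_fst)
  qed
  have pj: "pd j f (w(i := s, j := t)) = eval2 (map_poly pderiv F) s t" for s t
  proof (rule DERIV_unique)
    show "((\<lambda>u. f ((w(i := s, j := t))(j := u))) has_real_derivative pd j f (w(i := s, j := t))) (at t)"
      using DERIV_pd[OF f, of "w(i := s)" j t] by (simp only: fun_upd_upd)
    have "f ((w(i := s, j := t))(j := u)) = eval2 F s u" for u
      using F[of s u] by (simp only: fun_upd_upd)
    then show "((\<lambda>u. f ((w(i := s, j := t))(j := u))) has_real_derivative eval2 (map_poly pderiv F) s t) (at t)"
      by (simp only: DERIV_eval2_snd)
  qed
  have "pderiv F * lift p0 * [:q1:] = map_poly pderiv F * lift p1 * [:q0:]"
  proof (rule eval2_eqI)
    fix s t
    show "eval2 (pderiv F * lift p0 * [:q1:]) s t = eval2 (map_poly pderiv F * lift p1 * [:q0:]) s t"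
      using eq[of "w(i := s, j := t)"] ij(3) by (simp add: eval2_lift pi pj mult_ac)
  qed
  moreover have "pderiv F \<noteq> 0" using pi[of "w i" "w j"] nz(5) by auto
  ultimately show ?thesis using leading_terms[of F p0 q1 p1 q0] nz by blast
qed

text \<open>An \<open>n\<close>-th power multiplies the logarithmic derivative by \<open>n\<close>;
  this serves to equalize the proportionality factors of the three variables.\<close>

lemma pderiv_power_log:
  assumes "smult \<alpha> (a * q1) = smult \<beta> (pderiv a * q0)" "\<beta> \<noteq> (0::real)"
  shows "pderiv (a ^ n) * q0 = smult (real n * \<alpha> / \<beta>) (a ^ n * q1)"
proof (induction n)
  case (Suc n)
  have a: "pderiv a * q0 = smult (\<alpha> / \<beta>) (a * q1)"
  proof -
    have "smult (1 / \<beta>) (smult \<alpha> (a * q1)) = smult (1 / \<beta>) (smult \<beta> (pderiv a * q0))" using assms(1) by simp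
    then show ?thesis using assms(2) by simp
  qed
  have "pderiv (a ^ Suc n) * q0 = a * (pderiv (a ^ n) * q0) + a ^ n * (pderiv a * q0)"
    by (simp add: pderiv_mult algebra_simps del: pderiv_power_Suc)
  also have "\<dots> = smult (real n * \<alpha> / \<beta> + \<alpha> / \<beta>) (a ^ Suc n * q1)"
    unfolding Suc a smult_add_left by (simp add: mult_ac)
  also have "real n * \<alpha> / \<beta> + \<alpha> / \<beta> = real (Suc n) * \<alpha> / \<beta>"
    by (simp add: add_divide_distrib distrib_right)
  finally show ?case .
qed (use assms in simp)

text \<open>The level sets of \<open>f\<close> are those of a separated function: \<open>q1 / q0\<close> and \<open>p1 / p0\<close> are either
  both derivatives of polynomials or both logarithmic derivatives.\<close>

lemma special_form:
  assumes f: "PF 3 f" and w: "pd 0 f w \<noteq> 0"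
    and nz: "p0 \<noteq> 0" "p1 \<noteq> 0" "q0 \<noteq> 0" "q1 \<noteq> 0"
    and eq1: "\<And>x. pd 0 f x * (poly p0 (x 0) * poly q1 (x 1)) = pd 1 f x * (poly p1 (x 0) * poly q0 (x 1))"
    and eq2: "(\<forall>x. pd 2 f x = 0) \<or> (\<exists>r0 r1. r0 \<noteq> 0 \<and> r1 \<noteq> 0 \<and>
        (\<forall>x. pd 0 f x * (poly p0 (x 0) * poly r1 (x 2)) = pd 2 f x * (poly p1 (x 0) * poly r0 (x 2))))"
  shows "\<exists>g k l m. (\<forall>x. f x = poly g (poly k (x 0) + poly l (x 1) + poly m (x 2)))
             \<or> (\<forall>x. f x = poly g (poly k (x 0) * poly l (x 1) * poly m (x 2)))"
proof -
  obtain N where N: "mpf 3 N f" using f PF_def by blast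
  note PFs = PF_mult PF_pd PF_poly PF_var f
  have cancel: "u x = v x"
    if "j < 3" "p \<noteq> 0" "q \<noteq> 0" "PF 3 u" "PF 3 v" "\<And>x. poly p (x 0) * (poly q (x j) * u x) = poly p (x 0) * (poly q (x j) * v x)"
    for j p q u v x
  proof (rule PF_cancel_poly[OF that(3,1,4,5)])
    fix x
    show "poly q (x j) * u x = poly q (x j) * v x"
      by (rule PF_cancel_poly[OF that(2), of 0 3 "\<lambda>x. poly q (x j) * u x" "\<lambda>x. poly q (x j) * v x"])
         (use that in \<open>auto intro!: PF_mult PF_poly PF_var\<close>)
  qed
  have "\<exists>w. pd 1 f w \<noteq> 0"
  proof (rule ccontr)
    assume "\<not> ?thesis"
    then have "pd 0 f w = 0" for w
      using eq1 by (intro cancel[OF _ nz(1,4), of 1 "pd 0 f" "\<lambda>_. 0"]) (auto intro!: PFs simp: mult_ac)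
    with w show False by blast
  qed
  then obtain w1 where w1: "pd 1 f w1 \<noteq> 0" by blast
  \<comment> \<open>The two variables exchange roles, which gives information on p1 / p0 as
    well.\<close>
  have eq1': "pd 1 f x * (poly q0 (x 1) * poly p1 (x 0)) = pd 0 f x * (poly q1 (x 1) * poly p0 (x 0))" for x
    using eq1[of x] by (simp only: mult_ac)
  obtain m where m: "m > 0" "(degree p0 = degree p1 + 1 \<and> (\<exists>a. pderiv a \<noteq> 0 \<and>
              smult (real m * lead_coeff p0) (a * q1) = smult (lead_coeff p1) (pderiv a * q0)))
          \<or> (degree p0 \<le> degree p1 \<and> (\<exists>l. q1 = pderiv l * q0))"
    using leading_dichotomy[OF f _ _ _ eq1 nz w] by auto
  obtain m' where m': "m' > 0" "(degree q0 = degree q1 + 1 \<and> (\<exists>b. pderiv b \<noteq> 0 \<and>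
              smult (real m' * lead_coeff q0) (b * p1) = smult (lead_coeff q1) (pderiv b * p0)))
          \<or> (degree q0 \<le> degree q1 \<and> (\<exists>k. p1 = pderiv k * p0))"
    using leading_dichotomy[OF f _ _ _ eq1' nz(3,4,1,2) w1] by auto
  show ?thesis
  proof (cases "degree p0 \<le> degree p1")
    case True
    with m obtain l where l: "q1 = pderiv l * q0" by auto
    then have l0: "pderiv l \<noteq> 0" using nz by auto
    have "degree q0 \<le> degree q1" unfolding l using l0 nz by (simp add: degree_mult_eq)
    with m' obtain k where k: "p1 = pderiv k * p0" by auto
    then have k0: "pderiv k \<noteq> 0" using nz by auto
    have e1: "pd 0 f x * poly (pderiv l) (x 1) = pd 1 f x * poly (pderiv k) (x 0)" for x
    proof (rule cancel[OF _ nz(1,3), of 1 "\<lambda>x. pd 0 f x * poly (pderiv l) (x 1)" "\<lambda>x. pd 1 f x * poly (pderiv k) (x 0)"])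
      show "poly p0 (x 0) * (poly q0 (x 1) * (pd 0 f x * poly (pderiv l) (x 1)))
        = poly p0 (x 0) * (poly q0 (x 1) * (pd 1 f x * poly (pderiv k) (x 0)))" for x
        using eq1[of x] unfolding k l poly_mult by (simp only: mult_ac)
    qed (auto intro!: PFs)
    have "\<exists>m. \<forall>x. pd 0 f x * poly (pderiv m) (x 2) = pd 2 f x * poly (pderiv k) (x 0)"
      using eq2
    proof
      assume "\<forall>x. pd 2 f x = 0"
      then show ?thesis by (intro exI[of _ 0]) simp
    next
      assume "\<exists>r0 r1. r0 \<noteq> 0 \<and> r1 \<noteq> 0 \<and>
        (\<forall>x. pd 0 f x * (poly p0 (x 0) * poly r1 (x 2)) = pd 2 f x * (poly p1 (x 0) * poly r0 (x 2)))"
      then obtain r0 r1 where r: "r0 \<noteq> 0" "r1 \<noteq> 0"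
        "\<And>x. pd 0 f x * (poly p0 (x 0) * poly r1 (x 2)) = pd 2 f x * (poly p1 (x 0) * poly r0 (x 2))" by blast
      obtain m where m: "r1 = pderiv m * r0"
        using leading_dichotomy[OF f _ _ _ r(3) nz(1,2) r(1,2) w] True by auto
      have "pd 0 f x * poly (pderiv m) (x 2) = pd 2 f x * poly (pderiv k) (x 0)" for x
      proof (rule cancel[OF _ nz(1) r(1), of 2 "\<lambda>x. pd 0 f x * poly (pderiv m) (x 2)" "\<lambda>x. pd 2 f x * poly (pderiv k) (x 0)"])
        show "poly p0 (x 0) * (poly r0 (x 2) * (pd 0 f x * poly (pderiv m) (x 2)))
          = poly p0 (x 0) * (poly r0 (x 2) * (pd 2 f x * poly (pderiv k) (x 0)))" for x
          using r(3)[of x] unfolding k m poly_mult by (simp only: mult_ac)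
      qed (auto intro!: PFs)
      then show ?thesis by blast
    qed
    then obtain m where "\<And>x. pd 0 f x * poly (pderiv m) (x 2) = pd 2 f x * poly (pderiv k) (x 0)" by blast
    from additive_decomposition[OF k0 l0 f degree_slice[OF N] e1 this] show ?thesis by blast
  next
    case False
    with m obtain a where p01: "degree p0 = degree p1 + 1" and a: "pderiv a \<noteq> 0"
      "smult (real m * lead_coeff p0) (a * q1) = smult (lead_coeff p1) (pderiv a * q0)" by auto
    \<comment> \<open>Degrees in the equation for \<open>a\<close> force the exchanged dichotomy
      into its logarithmic branch too.\<close>
    have "degree q0 = degree q1 + 1"
    proof -
      have a0: "a \<noteq> 0" "degree a > 0" using a(1) by (auto simp: pderiv_eq_0_iff)
      have "degree (smult (real m * lead_coeff p0) (a * q1)) = degree a + degree q1"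
        using m(1) nz a0 by (simp add: degree_mult_eq)
      moreover have "degree (smult (lead_coeff p1) (pderiv a * q0)) = degree a - 1 + degree q0"
        using nz a(1) by (simp add: degree_mult_eq degree_pderiv)
      ultimately show ?thesis using a(2) a0 by simp
    qed
    with m' obtain b where b: "pderiv b \<noteq> 0"
      "smult (real m' * lead_coeff q0) (b * p1) = smult (lead_coeff q1) (pderiv b * p0)" by auto
    define \<beta> where "\<beta> = degree b"
    have \<beta>: "\<beta> > 0" "b \<noteq> 0" using b(1) unfolding \<beta>_def by (auto simp: pderiv_eq_0_iff)
    have lead_b': "lead_coeff (pderiv b) = real \<beta> * lead_coeff b"
      using \<beta>(1) by (simp add: degree_pderiv coeff_pderiv \<beta>_def)
    \<comment> \<open>Leading coefficients in the equation for \<open>b\<close> eliminate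
      \<open>m'\<close>, so that all proportionality factors become integer multiples of lead_coeff
      p0 / lead_coeff p1.\<close>
    have "lead_coeff (smult (real m' * lead_coeff q0) (b * p1)) = lead_coeff (smult (lead_coeff q1) (pderiv b * p0))"
      using b(2) by simp
    then have "real m' * lead_coeff q0 * (lead_coeff b * lead_coeff p1) = lead_coeff q1 * (real \<beta> * lead_coeff b * lead_coeff p0)"
      unfolding lead_coeff_smult lead_coeff_mult lead_b' .
    then have ratio: "real m' * lead_coeff q0 / lead_coeff q1 = real \<beta> * lead_coeff p0 / lead_coeff p1"
      using \<beta>(2) nz by (simp add: field_simps)
    obtain m2 n r0 r1 where n: "m2 > 0" "n \<noteq> 0" "r0 \<noteq> 0"
      "smult (real m2 * lead_coeff p0) (n * r1) = smult (lead_coeff p1) (pderiv n * r0)"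
      "\<And>x. pd 0 f x * (poly p0 (x 0) * poly r1 (x 2)) = pd 2 f x * (poly p1 (x 0) * poly r0 (x 2))"
    proof -
      from eq2 consider "\<forall>x. pd 2 f x = 0" | r0 r1 where "r0 \<noteq> 0" "r1 \<noteq> 0"
        "\<And>x. pd 0 f x * (poly p0 (x 0) * poly r1 (x 2)) = pd 2 f x * (poly p1 (x 0) * poly r0 (x 2))" by blast
      then show ?thesis
      proof cases
        case 1
        \<comment> \<open>If \<open>f\<close> does not depend on the third variable, the constant
          \<open>n = 1\<close> with \<open>r0 = 1\<close> and \<open>r1 = 0\<close> meets every
          condition.\<close>
        then show ?thesis using that[of 1 1 1 0] by simp
      next
        case (2 r0 r1)
        obtain m2 n where "m2 > 0" "pderiv n \<noteq> 0"
          "smult (real m2 * lead_coeff p0) (n * r1) = smult (lead_coeff p1) (pderiv n * r0)"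
          using leading_dichotomy[OF f _ _ _ 2(3) nz(1,2) 2(1,2) w] False by auto
        then show ?thesis using that[of m2 n r0 r1] 2 by fastforce
      qed
    qed
    \<comment> \<open>The factors for \<open>b\<close>, \<open>a\<close> and \<open>n\<close> are
      \<beta>, m and m2 times the same ratio; raising each to the product of the other two makes all
      of them equal to \<open>\<rho>\<close>.\<close>
    define \<rho> where "\<rho> = real \<beta> * real m * real m2 * lead_coeff p0 / lead_coeff p1"
    define H where "H = (\<lambda>j::nat. if j = 0 then b ^ (m * m2) else if j = 1 then a ^ (\<beta> * m2) else n ^ (\<beta> * m))"
    have K: "pderiv (H 0) * p0 = smult \<rho> (H 0 * p1)"
    proof -
      have "real (m * m2) * (real m' * lead_coeff q0) / lead_coeff q1
          = real (m * m2) * (real m' * lead_coeff q0 / lead_coeff q1)" by simp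
      also have "\<dots> = \<rho>" unfolding ratio \<rho>_def by simp
      finally have "real (m * m2) * (real m' * lead_coeff q0) / lead_coeff q1 = \<rho>" .
      then show ?thesis using pderiv_power_log[OF b(2), of "m * m2"] nz unfolding H_def by simp
    qed
    have L: "pderiv (H 1) * q0 = smult \<rho> (H 1 * q1)"
      using pderiv_power_log[OF a(2), of "\<beta> * m2"] nz unfolding H_def \<rho>_def by (simp add: mult_ac)
    have M: "pderiv (H 2) * r0 = smult \<rho> (H 2 * r1)"
      using pderiv_power_log[OF n(4), of "\<beta> * m"] nz unfolding H_def \<rho>_def by (simp add: mult_ac)
    have \<rho>0: "\<rho> \<noteq> 0" unfolding \<rho>_def using \<beta> m n nz by simp
    have H: "H j \<noteq> 0" for j unfolding H_def using \<beta> a n(2) by auto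
    have H0: "pderiv (H 0) \<noteq> 0" using K H[of 0] \<rho>0 nz by auto
    have H1: "pderiv (H 1) \<noteq> 0" using L H[of 1] \<rho>0 nz by auto
    have key: "pd 0 f x * (poly (H 0) (x 0) * poly (pderiv (H j)) (x j)) = pd j f x * (poly (pderiv (H 0)) (x 0) * poly (H j) (x j))"
      if j: "j < 3" and s0: "s0 \<noteq> 0" and hj: "pderiv (H j) * s0 = smult \<rho> (H j * s1)"
        and e: "\<And>x. pd 0 f x * (poly p0 (x 0) * poly s1 (x j)) = pd j f x * (poly p1 (x 0) * poly s0 (x j))" for j s0 s1 x
    proof (rule cancel[OF j nz(1) s0, of "\<lambda>x. pd 0 f x * (poly (H 0) (x 0) * poly (pderiv (H j)) (x j))"
          "\<lambda>x. pd j f x * (poly (pderiv (H 0)) (x 0) * poly (H j) (x j))"])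
      fix x
      have h: "poly (pderiv (H j)) (x j) * poly s0 (x j) = \<rho> * (poly (H j) (x j) * poly s1 (x j))"
        using arg_cong[OF hj, of "\<lambda>p. poly p (x j)"] by simp
      have k: "poly (pderiv (H 0)) (x 0) * poly p0 (x 0) = \<rho> * (poly (H 0) (x 0) * poly p1 (x 0))"
        using arg_cong[OF K, of "\<lambda>p. poly p (x 0)"] by simp
      have "poly p0 (x 0) * (poly s0 (x j) * (pd 0 f x * (poly (H 0) (x 0) * poly (pderiv (H j)) (x j))))
          = poly p0 (x 0) * pd 0 f x * poly (H 0) (x 0) * (poly (pderiv (H j)) (x j) * poly s0 (x j))" by (simp only: mult_ac)
      also have "\<dots> = \<rho> * poly (H 0) (x 0) * poly (H j) (x j) * (pd 0 f x * (poly p0 (x 0) * poly s1 (x j)))"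
        unfolding h by (simp only: mult_ac)
      also have "\<dots> = pd j f x * poly (H j) (x j) * poly s0 (x j) * (\<rho> * (poly (H 0) (x 0) * poly p1 (x 0)))"
        unfolding e by (simp only: mult_ac)
      also have "\<dots> = poly p0 (x 0) * (poly s0 (x j) * (pd j f x * (poly (pderiv (H 0)) (x 0) * poly (H j) (x j))))"
        unfolding k[symmetric] by (simp only: mult_ac)
      finally show "poly p0 (x 0) * (poly s0 (x j) * (pd 0 f x * (poly (H 0) (x 0) * poly (pderiv (H j)) (x j))))
        = poly p0 (x 0) * (poly s0 (x j) * (pd j f x * (poly (pderiv (H 0)) (x 0) * poly (H j) (x j))))" .
    qed (use j in \<open>auto intro!: PFs\<close>)
    have "pd 0 f x * (poly (H 0) (x 0) * poly (pderiv (H j)) (x j)) = pd j f x * (poly (pderiv (H 0)) (x 0) * poly (H j) (x j))"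
      if j: "j < 3" for j x
    proof -
      consider "j = 0" | "j = 1" | "j = 2" using j by (auto simp: less_Suc_eq numeral_eq_Suc)
      then show ?thesis
      proof cases
        case 1
        then show ?thesis by simp
      next
        case 2
        then show ?thesis using key[of 1 q0 q1 x] nz L eq1 by simp
      next
        case 3
        then show ?thesis using key[of 2 r0 r1 x] n M by simp
      qed
    qed
    from multiplicative_decomposition[OF H H0 H1 f this] show ?thesis by blast
  qed
qed

section \<open>Separability from many hits\<close>

definition separable :: "(real \<Rightarrow> real \<Rightarrow> real \<Rightarrow> real) \<Rightarrow> bool" where
  "separable f \<longleftrightarrow> (\<exists>g k l m :: real poly.
      (\<forall>x y z. f x y z = poly g (poly k x + poly l y + poly m z)) \<or>
      (\<forall>x y z. f x y z = poly g (poly k x * poly l y * poly m z)))"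

lemma separable_permute:
  "separable (\<lambda>x y z. f x z y) \<Longrightarrow> separable f"
  "separable (\<lambda>x y z. f z x y) \<Longrightarrow> separable f"
proof -
  assume "separable (\<lambda>x y z. f x z y)"
  then obtain g k l m where "(\<forall>x y z. f x z y = poly g (poly k x + poly l y + poly m z)) \<or>
      (\<forall>x y z. f x z y = poly g (poly k x * poly l y * poly m z))" unfolding separable_def by blast
  then have "(\<forall>x y z. f x y z = poly g (poly k x + poly m y + poly l z)) \<or>
      (\<forall>x y z. f x y z = poly g (poly k x * poly m y * poly l z))" by (elim disjE) (simp_all add: add_ac mult_ac)
  then show "separable f" unfolding separable_def by blast
next
  assume "separable (\<lambda>x y z. f z x y)"
  then obtain g k l m where "(\<forall>x y z. f z x y = poly g (poly k x + poly l y + poly m z)) \<or>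
      (\<forall>x y z. f z x y = poly g (poly k x * poly l y * poly m z))" unfolding separable_def by blast
  then have "(\<forall>x y z. f x y z = poly g (poly m x + poly k y + poly l z)) \<or>
      (\<forall>x y z. f x y z = poly g (poly m x * poly k y * poly l z))" by (elim disjE) (simp_all add: add_ac mult_ac)
  then show "separable f" unfolding separable_def by blast
qed

lemma pd_polyfun3:
  assumes "polyfun3 d f"
  shows "pd 0 (\<lambda>x. f (x 0) (x 1) (x 2)) x = dx f (x 0) (x 1) (x 2)"
    "pd 1 (\<lambda>x. f (x 0) (x 1) (x 2)) x = dy f (x 0) (x 1) (x 2)"
    "pd 2 (\<lambda>x. f (x 0) (x 1) (x 2)) x = dz f (x 0) (x 1) (x 2)"
proof -
  have P: "PF 3 (\<lambda>x. f (x 0) (x 1) (x 2))" using assms unfolding polyfun3_def PF_def by blast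
  note D = partials_eq_pd(1,3,5)[OF assms]
  show "pd 0 (\<lambda>x. f (x 0) (x 1) (x 2)) x = dx f (x 0) (x 1) (x 2)" by (rule pd_eqI[OF P]) (simp add: D)
  show "pd 1 (\<lambda>x. f (x 0) (x 1) (x 2)) x = dy f (x 0) (x 1) (x 2)" by (rule pd_eqI[OF P]) (simp add: D)
  show "pd 2 (\<lambda>x. f (x 0) (x 1) (x 2)) x = dz f (x 0) (x 1) (x 2)" by (rule pd_eqI[OF P]) (simp add: D)
qed

lemma polyfun3_univariate:
  assumes "polyfun3 d f"
  shows "\<exists>p. \<forall>t. poly p t = f t b c" "\<exists>p. \<forall>t. poly p t = f a t c" "\<exists>p. \<forall>t. poly p t = f a b t"
proof -
  have P: "PF 3 (\<lambda>x. f (x 0) (x 1) (x 2))" using assms unfolding polyfun3_def PF_def by blast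
  show "\<exists>p. \<forall>t. poly p t = f t b c" using poly_slice[OF P, of 0 "vec3 0 b c"] by (auto simp: vec3_def)
  show "\<exists>p. \<forall>t. poly p t = f a t c" using poly_slice[OF P, of 1 "vec3 a 0 c"] by (auto simp: vec3_def)
  show "\<exists>p. \<forall>t. poly p t = f a b t" using poly_slice[OF P, of 2 "vec3 a b 0"] by (auto simp: vec3_def)
qed

lemma partial_zero_imp_indep:
  assumes "polyfun3 d f"
  shows "(\<And>x y z. dx f x y z = 0) \<Longrightarrow> f x y z = f x' y z"
    and "(\<And>x y z. dy f x y z = 0) \<Longrightarrow> f x y z = f x y' z"
    and "(\<And>x y z. dz f x y z = 0) \<Longrightarrow> f x y z = f x y z'"
proof -
  note D = partials_eq_pd(1,3,5)[OF assms]
  show "f x y z = f x' y z" if "\<And>x y z. dx f x y z = 0"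
    using DERIV_isconst_all[of "\<lambda>t. f t y z" x x'] D(1)[of y z] that by simp
  show "f x y z = f x y' z" if "\<And>x y z. dy f x y z = 0"
    using DERIV_isconst_all[of "\<lambda>t. f x t z" y y'] D(2)[of x z] that by simp
  show "f x y z = f x y z'" if "\<And>x y z. dz f x y z = 0"
    using DERIV_isconst_all[of "\<lambda>t. f x y t" z z'] D(3)[of x y] that by simp
qed

lemma PF3_cancel:
  assumes "polyfun3 d u" "polyfun3 d' f" "polyfun3 d'' g" "\<And>x y z. u x y z * f x y z = u x y z * g x y z" "u a b c \<noteq> 0"
  shows "f x y z = g x y z"
proof -
  let ?h = "\<lambda>u (x::nat\<Rightarrow>real). u (x 0) (x 1) (x 2) :: real"
  have "?h f (vec3 x y z) = ?h g (vec3 x y z)"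
    by (rule PF_cancel[of 3 "?h u" _ _ "vec3 a b c"]) (use assms in \<open>auto simp: polyfun3_def PF_def\<close>)
  then show ?thesis by simp
qed

lemma separable_from_special:
  assumes f: "polyfun3 d f" and X0: "dx f x0 y0 z0 \<noteq> 0"
    and p: "p0 \<noteq> 0" "p1 \<noteq> 0" "q0 \<noteq> 0" "q1 \<noteq> 0"
    and 1: "\<And>x y z. dx f x y z * (poly p0 x * poly q1 y) = dy f x y z * (poly p1 x * poly q0 y)"
    and 2: "(\<forall>x y z. dz f x y z = 0) \<or> (\<exists>r0 r1. r0 \<noteq> 0 \<and> r1 \<noteq> 0 \<and>
        (\<forall>x y z. dx f x y z * (poly p0 x * poly r1 z) = dz f x y z * (poly p1 x * poly r0 z)))"
  shows "separable f"
proof -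
  let ?g = "\<lambda>x::nat \<Rightarrow> real. f (x 0) (x 1) (x 2)"
  have P: "PF 3 ?g" using f unfolding polyfun3_def PF_def by blast
  have "\<exists>g k l m. (\<forall>x. ?g x = poly g (poly k (x 0) + poly l (x 1) + poly m (x 2)))
             \<or> (\<forall>x. ?g x = poly g (poly k (x 0) * poly l (x 1) * poly m (x 2)))"
  proof (rule special_form[OF P _ p])
    show "pd 0 ?g (vec3 x0 y0 z0) \<noteq> 0" unfolding pd_polyfun3[OF f] using X0 by simp
    show "pd 0 ?g x * (poly p0 (x 0) * poly q1 (x 1)) = pd 1 ?g x * (poly p1 (x 0) * poly q0 (x 1))" for x
      unfolding pd_polyfun3[OF f] by (rule 1)
    show "(\<forall>x. pd 2 ?g x = 0) \<or> (\<exists>r0 r1. r0 \<noteq> 0 \<and> r1 \<noteq> 0 \<and>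
        (\<forall>x. pd 0 ?g x * (poly p0 (x 0) * poly r1 (x 2)) = pd 2 ?g x * (poly p1 (x 0) * poly r0 (x 2))))"
      unfolding pd_polyfun3[OF f] using 2 by blast
  qed
  then obtain g k l m where
    "(\<forall>x. ?g x = poly g (poly k (x 0) + poly l (x 1) + poly m (x 2)))
       \<or> (\<forall>x. ?g x = poly g (poly k (x 0) * poly l (x 1) * poly m (x 2)))" by blast
  then have "(\<forall>x y z. f x y z = poly g (poly k x + poly l y + poly m z)) \<or>
      (\<forall>x y z. f x y z = poly g (poly k x * poly l y * poly m z))"
  proof
    assume *: "\<forall>x. ?g x = poly g (poly k (x 0) + poly l (x 1) + poly m (x 2))"
    have "f x y z = poly g (poly k x + poly l y + poly m z)" for x y z
      using *[rule_format, of "vec3 x y z"] by simp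
    then show ?thesis by blast
  next
    assume *: "\<forall>x. ?g x = poly g (poly k (x 0) * poly l (x 1) * poly m (x 2))"
    have "f x y z = poly g (poly k x * poly l y * poly m z)" for x y z
      using *[rule_format, of "vec3 x y z"] by simp
    then show ?thesis by blast
  qed
  then show ?thesis unfolding separable_def by blast
qed

lemma separable_binary:
  assumes f: "polyfun3 d f" and z: "\<And>x y z. f x y z = f x y 0"
    and id: "\<And>u v y z. dx f u y 0 * dy f u z 0 * dy f v y 0 * dx f v z 0 = dy f u y 0 * dx f u z 0 * dx f v y 0 * dy f v z 0"
  shows "separable f"
proof -
  have fx: "dx f x y z = dx f x y 0" and fy: "dy f x y z = dy f x y 0" for x y z
    unfolding dx_def dy_def by (simp_all only: z[of _ _ z])
  have fz: "dz f x y z = 0" for x y z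
  proof -
    have "(\<lambda>t. f x y t) = (\<lambda>t. f x y 0)" using z by blast
    then have "((\<lambda>t. f x y t) has_real_derivative 0) (at z) = ((\<lambda>t. f x y 0) has_real_derivative 0) (at z)"
      by (rule arg_cong)
    then show ?thesis unfolding dz_def using DERIV_const slope_eqI by blast
  qed
  obtain ex ey where e: "polyfun3 ex (dx f)" "polyfun3 ey (dy f)" using polyfun3_partials[OF f] by blast
  \<comment> \<open>If the two partials are never nonzero together, one of them vanishes identically
    and \<open>f\<close> is univariate.\<close>
  consider "\<And>x y z. dx f x y z = 0" | "\<And>x y z. dy f x y z = 0"
    | x0 y0 where "dx f x0 y0 0 \<noteq> 0" "dy f x0 y0 0 \<noteq> 0"
  proof (cases "\<exists>x y. dx f x y 0 * dy f x y 0 \<noteq> 0")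
    case False
    then have *: "dx f x y z * dy f x y z = 0" for x y z using fx[of x y z] fy[of x y z] by auto
    show ?thesis
    proof (cases "\<exists>x y z. dx f x y z \<noteq> 0")
      case True
      then obtain a b c where "dx f a b c \<noteq> 0" by blast
      moreover have "polyfun3 0 (\<lambda>x y z. 0)" unfolding polyfun3_def by (rule mpf_const)
      ultimately have "dy f x y z = 0" for x y z
        using PF3_cancel[OF e(1,2), of 0 "\<lambda>x y z. 0" a b c] * by simp
      then show ?thesis using that(2) by blast
    qed (use that(1) in blast)
  qed (use that(3) in fastforce)
  then show ?thesis
  proof cases
    case 1
    obtain p where "\<forall>t. poly p t = f 0 t 0" using polyfun3_univariate(2)[OF f] by blast
    moreover have "f x y z = f 0 y 0" for x y z
      using z[of x y z] partial_zero_imp_indep(1)[OF f 1, of x y 0 0] by simp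
    ultimately have "f x y z = poly p (poly 0 x + poly [:0, 1:] y + poly 0 z)" for x y z by simp
    then show ?thesis unfolding separable_def by blast
  next
    case 2
    obtain p where "\<forall>t. poly p t = f t 0 0" using polyfun3_univariate(1)[OF f] by blast
    moreover have "f x y z = f x 0 0" for x y z
      using z[of x y z] partial_zero_imp_indep(2)[OF f 2, of x y 0 0] by simp
    ultimately have "f x y z = poly p (poly [:0, 1:] x + poly 0 y + poly 0 z)" for x y z by simp
    then show ?thesis unfolding separable_def by blast
  next
    case (3 x0 y0)
    define a where "a = dx f x0 y0 0"
    define b where "b = dy f x0 y0 0"
    \<comment> \<open>Up to a constant, the four-corner identity with one corner at (x0, y0) writes
      f_x / f_y at (x, y) as the product of its values at (x, y0) and (x0, y). These are p1 / p0 and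
      q0 / q1.\<close>
    obtain p0 where p0: "\<And>t. poly p0 t = dy f t y0 0" using polyfun3_univariate(1)[OF e(2)] by blast
    obtain p1 where p1: "\<And>t. poly p1 t = dx f t y0 0" using polyfun3_univariate(1)[OF e(1)] by blast
    obtain q0 where q0: "\<And>t. poly q0 t = dx f x0 t 0" using polyfun3_univariate(2)[OF e(1)] by blast
    obtain q1 where q1: "\<And>t. poly q1 t = dy f x0 t 0" using polyfun3_univariate(2)[OF e(2)] by blast
    have nz: "p0 \<noteq> 0" "p1 \<noteq> 0" "smult b q0 \<noteq> 0" "smult a q1 \<noteq> 0"
      using p0[of x0] p1[of x0] q0[of y0] q1[of y0] 3 unfolding a_def b_def by auto
    have "dx f x y z * (poly p0 x * poly (smult a q1) y) = dy f x y z * (poly p1 x * poly (smult b q0) y)" for x y z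
      using id[of x y y0 x0] unfolding fx[of x y z] fy[of x y z] poly_smult p0 p1 q0 q1 a_def b_def by (simp only: mult_ac)
    then show ?thesis by (rule separable_from_special[OF f 3(1) nz]) (use fz in blast)
  qed
qed

text \<open>The identities say that f_y / f_z is free of x, f_x / f_z of y and f_x / f_y of z. So at
  z = z0 the ratio f_x / f_y is a function of x divided by a function of y, and \<open>C\<close>
  carries this to every z. Restriction to lines through the base point makes these functions ratios
  of polynomials.\<close>

lemma separable_ternary:
  assumes f: "polyfun3 d f" and nz: "dx f x0 y0 z0 \<noteq> 0" "dy f x0 y0 z0 \<noteq> 0" "dz f x0 y0 z0 \<noteq> 0"
    and A: "\<And>u v y z. dy f u y z * dz f v y z = dz f u y z * dy f v y z"
    and B: "\<And>x u v z. dx f x u z * dz f x v z = dz f x u z * dx f x v z"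
    and C: "\<And>x y u v. dx f x y u * dy f x y v = dy f x y u * dx f x y v"
  shows "separable f"
proof -
  define a where "a = dx f x0 y0 z0"
  define b where "b = dy f x0 y0 z0"
  define c where "c = dz f x0 y0 z0"
  obtain ex ey ez where e: "polyfun3 ex (dx f)" "polyfun3 ey (dy f)" "polyfun3 ez (dz f)"
    using polyfun3_partials[OF f] by blast
  obtain p0 where p0: "\<And>t. poly p0 t = dy f t y0 z0" using polyfun3_univariate(1)[OF e(2)] by blast
  obtain p1 where p1: "\<And>t. poly p1 t = dx f t y0 z0" using polyfun3_univariate(1)[OF e(1)] by blast
  obtain q0 where q0: "\<And>t. poly q0 t = dx f x0 t z0" using polyfun3_univariate(2)[OF e(1)] by blast
  obtain q1 where q1: "\<And>t. poly q1 t = dy f x0 t z0" using polyfun3_univariate(2)[OF e(2)] by blast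
  obtain r0 where r0: "\<And>t. poly r0 t = dx f x0 y0 t" using polyfun3_univariate(3)[OF e(1)] by blast
  obtain r1 where r1: "\<And>t. poly r1 t = dz f x0 y0 t" using polyfun3_univariate(3)[OF e(3)] by blast
  have nz': "p0 \<noteq> 0" "p1 \<noteq> 0" "smult b q0 \<noteq> 0" "smult a q1 \<noteq> 0" "smult b r0 \<noteq> 0" "smult a r1 \<noteq> 0"
    using p0[of x0] p1[of x0] q0[of y0] q1[of y0] r0[of z0] r1[of z0] nz unfolding a_def b_def by auto
  have slice_z0: "dx f x y z0 * (poly p0 x * (a * poly q1 y)) = dy f x y z0 * (poly p1 x * (b * poly q0 y))" for x y
  proof -
    have a0: "dy f x y0 z0 * c = dz f x y0 z0 * b" using A[of x y0 z0 x0] unfolding b_def c_def .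
    have b0: "dx f x0 y z0 * c = dz f x0 y z0 * a" using B[of x0 y z0 y0] unfolding a_def c_def .
    have "dx f x y z0 * (poly p0 x * (a * poly q1 y)) * c
        = dx f x y z0 * (dy f x y0 z0 * c) * a * dy f x0 y z0" unfolding p0 q1 by (simp only: mult_ac)
    also have "\<dots> = (dx f x y z0 * dz f x y0 z0) * b * a * dy f x0 y z0" unfolding a0 by (simp only: mult_ac)
    also have "\<dots> = dx f x y0 z0 * b * a * (dz f x y z0 * dy f x0 y z0)" unfolding B[of x y z0 y0] by (simp only: mult_ac)
    also have "\<dots> = dx f x y0 z0 * b * dy f x y z0 * (dz f x0 y z0 * a)" unfolding A[of x y z0 x0, symmetric] by (simp only: mult_ac)
    also have "\<dots> = dy f x y z0 * (poly p1 x * (b * poly q0 y)) * c" unfolding b0[symmetric] p1 q0 by (simp only: mult_ac)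
    finally show ?thesis using nz(3) unfolding c_def by simp
  qed
  have "dx f x y z * (poly p0 x * poly (smult a q1) y) = dy f x y z * (poly p1 x * poly (smult b q0) y)" for x y z
  proof -
    let ?w = "vec3 x y z"
    have "dx f (?w 0) (?w 1) (?w 2) * (poly p0 (?w 0) * poly (smult a q1) (?w 1))
        = dy f (?w 0) (?w 1) (?w 2) * (poly p1 (?w 0) * poly (smult b q0) (?w 1))"
    proof (rule PF_cancel[of 3 "\<lambda>x. dy f (x 0) (x 1) z0"
          "\<lambda>x. dx f (x 0) (x 1) (x 2) * (poly p0 (x 0) * poly (smult a q1) (x 1))"
          "\<lambda>x. dy f (x 0) (x 1) (x 2) * (poly p1 (x 0) * poly (smult b q0) (x 1))" "vec3 x0 y0 z0"])
      fix x :: "nat \<Rightarrow> real"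
      have "dy f (x 0) (x 1) z0 * (dx f (x 0) (x 1) (x 2) * (poly p0 (x 0) * poly (smult a q1) (x 1)))
          = (dx f (x 0) (x 1) (x 2) * dy f (x 0) (x 1) z0) * (poly p0 (x 0) * (a * poly q1 (x 1)))"
        by (simp only: mult_ac poly_smult)
      also have "\<dots> = dy f (x 0) (x 1) (x 2) * (dx f (x 0) (x 1) z0 * (poly p0 (x 0) * (a * poly q1 (x 1))))"
        unfolding C[of "x 0" "x 1" "x 2" z0] by (simp only: mult_ac)
      also have "\<dots> = dy f (x 0) (x 1) z0 * (dy f (x 0) (x 1) (x 2) * (poly p1 (x 0) * poly (smult b q0) (x 1)))"
        unfolding slice_z0 by (simp only: mult_ac poly_smult)
      finally show "dy f (x 0) (x 1) z0 * (dx f (x 0) (x 1) (x 2) * (poly p0 (x 0) * poly (smult a q1) (x 1)))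
          = dy f (x 0) (x 1) z0 * (dy f (x 0) (x 1) (x 2) * (poly p1 (x 0) * poly (smult b q0) (x 1)))" .
    qed (use nz in \<open>auto intro!: PF_mult PF_polyfun3[OF e(1)] PF_polyfun3[OF e(2)] PF_poly PF_var\<close>)
    then show ?thesis by simp
  qed
  \<comment> \<open>The same reduction for f_x / f_z, through the plane y = y0. It must use the same
    \<open>p0\<close> and \<open>p1\<close> as the first equation.\<close>
  moreover have "dx f x y z * (poly p0 x * poly (smult a r1) z) = dz f x y z * (poly p1 x * poly (smult b r0) z)" for x y z
  proof -
    let ?w = "vec3 x y z"
    have "dx f (?w 0) (?w 1) (?w 2) * (poly p0 (?w 0) * poly (smult a r1) (?w 2))
        = dz f (?w 0) (?w 1) (?w 2) * (poly p1 (?w 0) * poly (smult b r0) (?w 2))"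
    proof (rule PF_cancel[of 3 "\<lambda>x. dz f (x 0) y0 (x 2)"
          "\<lambda>x. dx f (x 0) (x 1) (x 2) * (poly p0 (x 0) * poly (smult a r1) (x 2))"
          "\<lambda>x. dz f (x 0) (x 1) (x 2) * (poly p1 (x 0) * poly (smult b r0) (x 2))" "vec3 x0 y0 z0"])
      fix w :: "nat \<Rightarrow> real"
      obtain x y z where w: "w 0 = x" "w 1 = y" "w 2 = z" by simp
      have "dz f x y0 z * (dx f x y z * (poly p0 x * poly (smult a r1) z))
          = (dx f x y z * dz f x y0 z) * (dy f x y0 z0 * (a * dz f x0 y0 z))"
        unfolding p0 r1 poly_smult by (simp only: mult_ac)
      also have "\<dots> = dz f x y z * (dx f x y0 z * dy f x y0 z0) * (a * dz f x0 y0 z)"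
        unfolding B[of x y z y0] by (simp only: mult_ac)
      also have "\<dots> = dz f x y z * dx f x y0 z0 * a * (dy f x y0 z * dz f x0 y0 z)"
        unfolding C[of x y0 z z0] by (simp only: mult_ac)
      also have "\<dots> = dz f x y z * dx f x y0 z0 * dz f x y0 z * (dy f x0 y0 z * dx f x0 y0 z0)"
        unfolding A[of x y0 z x0] a_def by (simp only: mult_ac)
      also have "\<dots> = dz f x y0 z * (dz f x y z * (poly p1 x * poly (smult b r0) z))"
        unfolding C[of x0 y0 z z0, symmetric] p1 r0 poly_smult b_def by (simp only: mult_ac)
      finally show "dz f (w 0) y0 (w 2) * (dx f (w 0) (w 1) (w 2) * (poly p0 (w 0) * poly (smult a r1) (w 2)))
          = dz f (w 0) y0 (w 2) * (dz f (w 0) (w 1) (w 2) * (poly p1 (w 0) * poly (smult b r0) (w 2)))"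
        unfolding w .
    qed (use nz in \<open>auto intro!: PF_mult PF_polyfun3[OF e(1)] PF_polyfun3[OF e(3)] PF_poly PF_var\<close>)
    then show ?thesis by simp
  qed
  ultimately show ?thesis
    using nz' by (intro separable_from_special[OF f nz(1) nz'(1-4)]) blast+
qed

lemma many_hits_permute:
  assumes "many_hits c n f X Y Z D"
  shows "many_hits c n (\<lambda>x y z. f y x z) Y X Z D" "many_hits c n (\<lambda>x y z. f y z x) Z X Y D"
    "many_hits c n (\<lambda>x y z. f x z y) X Z Y D" "many_hits c n (\<lambda>x y z. f z x y) Y Z X D"
proof -
  let ?S = "{(x, y, z). x \<in> X \<and> y \<in> Y \<and> z \<in> Z \<and> f x y z \<in> D}"
  have 1: "card {(y, x, z). y \<in> Y \<and> x \<in> X \<and> z \<in> Z \<and> f x y z \<in> D} = card ?S"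
    by (rule bij_betw_same_card[of "\<lambda>(x, y, z). (y, x, z)"]) (force simp: bij_betw_def inj_on_def image_iff)
  have 2: "card {(z, x, y). z \<in> Z \<and> x \<in> X \<and> y \<in> Y \<and> f x y z \<in> D} = card ?S"
    by (rule bij_betw_same_card[of "\<lambda>(x, y, z). (y, z, x)"]) (force simp: bij_betw_def inj_on_def image_iff)
  have 3: "card {(x, z, y). x \<in> X \<and> z \<in> Z \<and> y \<in> Y \<and> f x y z \<in> D} = card ?S"
    by (rule bij_betw_same_card[of "\<lambda>(x, y, z). (x, z, y)"]) (force simp: bij_betw_def inj_on_def image_iff)
  have 4: "card {(y, z, x). y \<in> Y \<and> z \<in> Z \<and> x \<in> X \<and> f x y z \<in> D} = card ?S"
    by (rule bij_betw_same_card[of "\<lambda>(x, y, z). (z, x, y)"]) (force simp: bij_betw_def inj_on_def image_iff)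
  show "many_hits c n (\<lambda>x y z. f y x z) Y X Z D" "many_hits c n (\<lambda>x y z. f y z x) Z X Y D"
    "many_hits c n (\<lambda>x y z. f x z y) X Z Y D" "many_hits c n (\<lambda>x y z. f z x y) Y Z X D"
    using assms unfolding many_hits_def 1 2 3 4 by (simp_all add: mult_ac)
qed

lemma many_hits_imp_separable:
  assumes c: "c > 0"
  shows "\<exists>n0. \<forall>f n X Y Z D. polyfun3 d f \<and> n > n0 \<and> many_hits c n f X Y Z D \<longrightarrow> separable f"
proof -
  \<comment> \<open>Permuting arguments is treated as composition with coordinate functions, which
    costs a factor 3 in the degree bound; \<open>n1\<close> and \<open>n2\<close> must serve the
    permuted functions too.\<close>
  define e where "e = 3 * d"
  obtain n1 where n1: "\<And>f n X Y Z D. polyfun3 e f \<Longrightarrow> n > n1 \<Longrightarrow> many_hits c n f X Y Z D \<Longrightarrow> rank_deficient 4 4 (\<theta>3 f)"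
    using ternary_rank_deficient[OF c, of e] by blast
  obtain n2 where n2: "\<And>f n X Y Z D. polyfun3 e f \<Longrightarrow> n > n2 \<Longrightarrow> many_hits c n f X Y Z D \<Longrightarrow>
      (\<And>x y z. f x y z = f x y 0) \<Longrightarrow> rank_deficient 4 4 (\<theta>2 f)"
    using binary_rank_deficient[OF c, of e] by blast
  have binary: "separable f"
    if "polyfun3 e f" "n > n2" "many_hits c n f X Y Z D" "\<And>x y z. f x y z = f x y 0" for f n X Y Z D
    using that(1,4) rank_deficient_\<theta>2[OF that(1) n2[OF that]] by (rule separable_binary)
  show ?thesis
  proof (intro exI[of _ "max n1 n2"] allI impI, elim conjE)
    fix f n X Y Z D
    assume f: "polyfun3 d f" and n: "n > max n1 n2" and h: "many_hits c n f X Y Z D"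
    have fe: "polyfun3 e f" using f mpf_mono[of 3 d _ e] unfolding polyfun3_def e_def by simp
    note perm = polyfun3_permute[OF f, folded e_def]
    note hp = many_hits_permute[OF h]
    \<comment> \<open>By absence of zero divisors, either some partial vanishes identically or all
      three are nonzero at one point.\<close>
    consider "\<And>x y z. dx f x y z = 0" | "\<And>x y z. dy f x y z = 0" | "\<And>x y z. dz f x y z = 0"
      | x0 y0 z0 where "dx f x0 y0 z0 \<noteq> 0" "dy f x0 y0 z0 \<noteq> 0" "dz f x0 y0 z0 \<noteq> 0"
    proof -
      obtain ex ey ez where e: "polyfun3 ex (dx f)" "polyfun3 ey (dy f)" "polyfun3 ez (dz f)"
        using polyfun3_partials[OF f] by blast
      let ?h = "\<lambda>u (x::nat\<Rightarrow>real). u (x 0) (x 1) (x 2) :: real"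
      have P: "PF 3 (?h (dx f))" "PF 3 (?h (dy f))" "PF 3 (?h (dz f))"
        using e unfolding polyfun3_def PF_def by blast+
      have V: "\<forall>x y z. u x y z = 0" if "\<forall>x. ?h u x = 0" for u
      proof (intro allI)
        fix x y z show "u x y z = 0" using that[rule_format, of "vec3 x y z"] by simp
      qed
      show ?thesis
      proof (cases "\<exists>x. ?h (dx f) x * (?h (dy f) x * ?h (dz f) x) \<noteq> 0")
        case True
        then show ?thesis using that(4) by auto
      next
        case False
        then have "(\<forall>x. ?h (dx f) x = 0) \<or> (\<forall>x. ?h (dy f) x * ?h (dz f) x = 0)"
          using PF_no_zero_divisors[OF P(1) PF_mult[OF P(2,3)]] by blast
        then have "(\<forall>x. ?h (dx f) x = 0) \<or> (\<forall>x. ?h (dy f) x = 0) \<or> (\<forall>x. ?h (dz f) x = 0)"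
          using PF_no_zero_divisors[OF P(2,3)] by blast
        then show ?thesis using V that(1-3) by metis
      qed
    qed
    then show "separable f"
    proof cases
      case 1
      \<comment> \<open>The missing variable is moved to the last place.\<close>
      have "separable (\<lambda>x y z. f z x y)"
        by (rule binary[OF perm(4) _ hp(4)]) (use n partial_zero_imp_indep(1)[OF f 1] in auto)
      then show ?thesis by (rule separable_permute(2))
    next
      case 2
      have "separable (\<lambda>x y z. f x z y)"
        by (rule binary[OF perm(3) _ hp(3)]) (use n partial_zero_imp_indep(2)[OF f 2] in auto)
      then show ?thesis by (rule separable_permute(1))
    next
      case 3
      show ?thesis by (rule binary[OF fe _ h]) (use n partial_zero_imp_indep(3)[OF f 3] in auto)
    next
      case (4 x0 y0 z0)
      have n: "n > n1" using n by simp
      note A = rank_deficient_\<theta>3[OF fe n1[OF fe n h]]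
      \<comment> \<open>The permutations put y, and then z, into the role of the variable that is
        doubled in the collision map.\<close>
      note B = rank_deficient_\<theta>3[OF perm(1) n1[OF perm(1) n hp(1)], unfolded dy_def dz_def]
      note C = rank_deficient_\<theta>3[OF perm(2) n1[OF perm(2) n hp(2)], unfolded dy_def dz_def]
      show ?thesis
        by (rule separable_ternary[OF f 4 A]) (use B C in \<open>simp_all only: dx_def dy_def dz_def\<close>)
    qed
  qed
qed

lemma poly3_of_degree_imp_polyfun3:
  assumes "poly3_of_degree f d" shows "polyfun3 d f"
proof -
  obtain a where a: "\<And>x y z. f x y z =
     (\<Sum>i\<le>d. \<Sum>j\<le>d. \<Sum>k\<le>d. if i + j + k \<le> d then a i j k * x ^ i * y ^ j * z ^ k else 0)"
    using assms unfolding poly3_of_degree_def by blast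
  have "mpf 3 d (\<lambda>x. if i + j + k \<le> d then a i j k * x 0 ^ i * x 1 ^ j * x 2 ^ k else 0)" for i j k
  proof (cases "i + j + k \<le> d")
    case True
    have "mpf 3 d (\<lambda>x. a i j k * (\<Prod>m<3. x m ^ (if m = 0 then i else if m = 1 then j else k)))"
      using True by (intro mpf.monom) auto
    then show ?thesis using True by (simp add: numeral_eq_Suc mult.assoc)
  qed (simp add: mpf_const)
  then show ?thesis unfolding polyfun3_def a by (intro mpf_sum)
qed

theorem theorem1p5:
  "\<forall>cc::real. cc > 0 \<longrightarrow> (\<forall>d::nat. d \<ge> 1 \<longrightarrow>
    (\<exists>n0::nat. \<forall>(\<epsilon>::real) (f::real \<Rightarrow> real \<Rightarrow> real \<Rightarrow> real) (n::nat)
        (A::real set) (B::real set) (C::real set) (D::real set).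
       \<epsilon> > 0 \<and> poly3_of_degree f d \<and> n > n0 \<and>
       real (card A) = real n \<and>
       real (card B) = real n powr (5/6 + \<epsilon>) \<and>
       real (card C) = real n powr (5/6 + \<epsilon>) \<and>
       real (card D) = real n \<and>
       real (card {(a, b, c', e). a \<in> A \<and> b \<in> B \<and> c' \<in> C \<and> e \<in> D \<and> e = f a b c'})
         \<ge> cc * real n powr (8/3 + 2 * \<epsilon>)
     \<longrightarrow> (\<exists>g k l m :: real poly.
            (\<forall>x y z. f x y z = poly g (poly k x + poly l y + poly m z)) \<or>
            (\<forall>x y z. f x y z = poly g (poly k x * poly l y * poly m z)))))"
proof (intro allI impI, goal_cases)
  case (1 c d)
  obtain n0 where n0: "\<And>f n X Y Z D. polyfun3 d f \<Longrightarrow> n > n0 \<Longrightarrow> many_hits c n f X Y Z D \<Longrightarrow> separable f"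
    using many_hits_imp_separable[OF 1(1), of d] by blast
  show ?case
  proof (intro exI[of _ n0] allI impI, elim conjE, goal_cases)
    case (1 \<epsilon> f n A B C D)
    note eps = 1(1) and f = 1(2) and n = 1(3) and card = 1(4-7) and h = 1(8)
    have n1: "real n \<ge> 1" using n by simp
    have "real n powr (5/6 + \<epsilon>) > 0" using n1 by simp
    \<comment> \<open>Positive cardinality gives finiteness, as infinite sets have
      \<open>card\<close> 0.\<close>
    then have "real (card A) > 0" "real (card B) > 0" "real (card C) > 0" "real (card D) > 0"
      using card n1 by linarith+
    then have fin: "finite A" "finite B" "finite C" "finite D"
      by (simp_all add: card_ge_0_finite)
    have "real n powr (5/6) \<le> real n powr 1" using n1 by (intro powr_mono) auto
    then have sizes: "real (card A) \<ge> real n powr (5/6)" "real (card B) \<ge> real n powr (5/6)" "real (card C) \<ge> real n powr (5/6)"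
      unfolding card using n1 eps by (auto intro!: powr_mono)
    \<comment> \<open>The threshold is \<open>c\<close> times the size of A x B x C, so the
      hypothesis asks for a positive proportion of hits.\<close>
    have "c * card A * card B * card C = c * (real n powr 1 * (real n powr (5/6 + \<epsilon>) * real n powr (5/6 + \<epsilon>)))"
      unfolding card using n1 by simp
    also have "\<dots> = c * real n powr (8/3 + 2 * \<epsilon>)"
    proof -
      have "1 + ((5/6 + \<epsilon>) + (5/6 + \<epsilon>)) = 8/3 + 2 * \<epsilon>" by simp
      then show ?thesis by (simp only: powr_add[symmetric])
    qed
    also have "\<dots> \<le> real (card {(a, b, c', e). a \<in> A \<and> b \<in> B \<and> c' \<in> C \<and> e \<in> D \<and> e = f a b c'})" by (rule h)
    also have "card {(a, b, c', e). a \<in> A \<and> b \<in> B \<and> c' \<in> C \<and> e \<in> D \<and> e = f a b c'} = card {(x, y, z). x \<in> A \<and> y \<in> B \<and> z \<in> C \<and> f x y z \<in> D}"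
      by (rule bij_betw_same_card[of "\<lambda>(a, b, c', e). (a, b, c')"])
         (force simp: bij_betw_def inj_on_def image_iff)
    finally have "many_hits c n f A B C D" unfolding many_hits_def using fin sizes card(4) by simp
    then have "separable f" by (rule n0[OF poly3_of_degree_imp_polyfun3[OF f] n])
    then show ?case unfolding separable_def .
  qed
qed

end
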